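(* Let $\mu,\nu$ be atomic measures on $\mathbb{R}^d$ with discrete spectra $\tilde\Lambda=\operatorname{supp}\hat\mu$, $\tilde\Gamma=\operatorname{supp}\hat\nu$ respectively, and with $|\mu|,|\nu|\in S^*(\mathbb{R}^d)$. Suppose that there are a set $E\subset\mathbb{R}^d$, a sequence of pairwise disjoint sets $\tilde\Lambda_n$ and a sequence of pairwise disjoint sets $\tilde\Gamma_n$, $n=1,2,\dots$, such that: (i) there exist balls $B(x_k,r_k)$, $k=1,2,\dots$, with $r_k\to\infty$, $r_k/|x_k|\to0$ and $\bigcup_{k=1}^\infty B(x_k,r_k)\subset E$; (ii) $\tilde\Lambda\cap E=\bigcup_n\tilde\Lambda_n$, $\ \tilde\Gamma\cap E=\bigcup_n\tilde\Gamma_n$, and $\operatorname{diam}(\tilde\Lambda_n\cup\tilde\Gamma_n)\to0$ as $n\to\infty$; (iii) for some $N<\infty$, $\ \#\{n:(\tilde\Lambda_n\cup\tilde\Gamma_n)\cap B(x,1)\ne\emptyset\}\le N$ for all $x\in E$. Suppose moreover that at least one of the following holds: (a) $\hat\mu,\hat\nu$ are measures, and $\hat\mu(\tilde\Lambda_n)-\hat\nu(\tilde\Gamma_n)\to0$ as $n\to\infty$; (b) for some nonnegative integer $m$ and some $\tilde p_{\lambda,j},\tilde q_{\gamma,j}\in\mathbb{C}$, $$\hat\mu=\sum_{\lambda\in\tilde\Lambda}\sum_{\|j\|\le m}\tilde p_{\lambda,j}D^j\delta_\lambda,\qquad \hat\nu=\sum_{\gamma\in\tilde\Gamma}\sum_{\|j\|\le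 m}\tilde q_{\gamma,j}D^j\delta_\gamma,$$ with $$\sum_{\lambda\in\tilde\Lambda_n}\tilde p_{\lambda,j}-\sum_{\gamma\in\tilde\Gamma_n}\tilde q_{\gamma,j}\to0\quad\text{as } n\to\infty,\ \text{ for every } j \text{ with } \|j\|\le m,$$ $$\max_j\sup_n\sum_{\lambda\in\tilde\Lambda_n}|\tilde p_{\lambda,j}|<\infty,\qquad \max_j\sup_n\sum_{\gamma\in\tilde\Gamma_n}|\tilde q_{\gamma,j}|<\infty .$$ Then the measures $\mu$ and $\nu$ coincide.
   Context: Here $B(x,r)=\{y\in\mathbb{R}^d:|y-x|<r\}$, $\delta_\lambda$ is the unit mass at $\lambda\in\mathbb{R}^d$, and for a multi-index $j=(j_1,\dots,j_d)\in(\mathbb{N}\cup\{0\})^d$, $\|j\|=\max\{j_1,\dots,j_d\}$ and $D^j=\partial_{x_1}^{j_1}\cdots\partial_{x_d}^{j_d}$. $S(\mathbb{R}^d)$ is the Schwartz space and $S^*(\mathbb{R}^d)$ its dual, the space of temperate (tempered) distributions. The Fourier transform is $\hat f(\varphi)=f(\hat\varphi)$ for $\varphi\in S(\mathbb{R}^d)$, where $\hat\varphi(y)=\int_{\mathbb{R}^d}\varphi(x)e^{-2\pi i\langle x,y\rangle}dx$. Measures are complex Radon (locally finite, not necessarily finite) measures on $\mathbb{R}^d$; a measure is atomic if it has the form $\sum_{s\in A}a_s\delta_s$ with $a_s\in\mathbb{C}$ and $A$ countable; $|\mu|$ is the total variation measure of $\mu$; a measure is said to belong to $S^*(\mathbb{R}^d)$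 if the distribution it defines is (extends to) a temperate distribution. The spectrum of $\mu$ is the support of its Fourier transform $\hat\mu$; it is discrete if each of its points $\lambda$ has a ball $B(\lambda,\varepsilon)$, $\varepsilon=\varepsilon(\lambda)>0$, containing no other point of it. The sets $\tilde\Lambda_n$, $\tilde\Gamma_n$ may be empty; the diameter of the empty set and the sum over the empty set are $0$. Since $\operatorname{diam}(\tilde\Lambda_n\cup\tilde\Gamma_n)\to 0$, the values $\hat\mu(\tilde\Lambda_n),\hat\nu(\tilde\Gamma_n)$ in (a) are well defined for all large $n$, which is all that (a) needs.
   Formalization: All sets Λ̃_n ∪ Γ̃_n are assumed bounded (finite diameter for every n, not only for large n); otherwise the claim fails, e.g. d=1, μ=Σδ_k over the integers, ν=0, E=ℝ, Λ̃_1=ℤ, all other sets empty. *)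

theory Defs
  imports "HOL-Analysis.Analysis"
begin

section \<open>Partial derivatives, test functions and Schwartz functions\<close>

definition partial_deriv :: "'d \<Rightarrow> (real^'d \<Rightarrow> complex) \<Rightarrow> real^'d \<Rightarrow> complex" where
  "partial_deriv i f x = vector_derivative (\<lambda>t. f (x + t *\<^sub>R axis i 1)) (at 0)"

primrec iter_partial :: "'d list \<Rightarrow> (real^'d \<Rightarrow> complex) \<Rightarrow> real^'d \<Rightarrow> complex" where
  "iter_partial [] f = f"
| "iter_partial (i # is) f = partial_deriv i (iter_partial is f)"

definition smooth :: "(real^'d \<Rightarrow> complex) \<Rightarrow> bool" where
  "smooth f \<longleftrightarrow> (\<forall>is x. iter_partial is f differentiable (at x))"

text \<open>A multi-index is a function on the coordinates. The order in which the partial derivatives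
  are taken is immaterial for smooth functions, the only ones for which \<open>deriv_multi\<close> is used; the
  index type carries no order, so an arbitrary one is chosen.\<close>

definition deriv_multi :: "('d \<Rightarrow> nat) \<Rightarrow> (real^'d \<Rightarrow> complex) \<Rightarrow> real^'d \<Rightarrow> complex" where
  "deriv_multi j f = iter_partial (SOME is. \<forall>i. count_list is i = j i) f"

definition multi_norm :: "('d::finite \<Rightarrow> nat) \<Rightarrow> nat" where
  "multi_norm j = Max (range j)"

definition test_functions :: "(real^'d \<Rightarrow> complex) set" where
  "test_functions = {f. smooth f \<and> compact (closure {x. f x \<noteq> 0})}"

definition schwartz :: "(real^'d \<Rightarrow> complex) set" where
  "schwartz = {f. smooth f \<and> (\<forall>k j. bounded (range (\<lambda>x. norm x ^ k * norm (deriv_multi j f x))))}"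

definition schwartz_seminorm :: "nat \<Rightarrow> ('d \<Rightarrow> nat) \<Rightarrow> (real^'d \<Rightarrow> complex) \<Rightarrow> real" where
  "schwartz_seminorm k j f = (SUP x. norm x ^ k * norm (deriv_multi j f x))"

definition schwartz_topology :: "(real^'d \<Rightarrow> complex) topology" where
  "schwartz_topology = topology (\<lambda>U. U \<subseteq> schwartz \<and>
     (\<forall>f\<in>U. \<exists>m. \<exists>\<epsilon>>0. \<forall>g\<in>schwartz.
        (\<forall>k j. k \<le> m \<longrightarrow> multi_norm j \<le> m \<longrightarrow> schwartz_seminorm k j (\<lambda>x. g x - f x) < \<epsilon>)
        \<longrightarrow> g \<in> U))"

lemma openin_schwartz_topology:
  fixes U :: "(real^'d \<Rightarrow> complex) set"
  shows "openin schwartz_topology U \<longleftrightarrow> U \<subseteq> schwartz \<and>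
     (\<forall>f\<in>U. \<exists>m. \<exists>\<epsilon>>0. \<forall>g\<in>schwartz.
        (\<forall>k j. k \<le> m \<longrightarrow> multi_norm j \<le> m \<longrightarrow> schwartz_seminorm k j (\<lambda>x. g x - f x) < \<epsilon>)
        \<longrightarrow> g \<in> U)"
proof -
  define Nb where "Nb f m \<epsilon> g \<longleftrightarrow>
      (\<forall>k j. k \<le> m \<longrightarrow> multi_norm j \<le> m \<longrightarrow> schwartz_seminorm k j (\<lambda>x. g x - f x) < \<epsilon>)"
    for f g :: "real^'d \<Rightarrow> complex" and m and \<epsilon> :: real
  define P where "P U \<longleftrightarrow> U \<subseteq> schwartz \<and>
      (\<forall>f\<in>U. \<exists>m. \<exists>\<epsilon>>0. \<forall>g\<in>schwartz. Nb f m \<epsilon> g \<longrightarrow> g \<in> U)"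
    for U :: "(real^'d \<Rightarrow> complex) set"
  have "P (S \<inter> T)" if S: "P S" and T: "P T" for S T
    unfolding P_def
  proof (intro conjI ballI)
    show "S \<inter> T \<subseteq> schwartz" using S by (auto simp: P_def)
    fix f assume f: "f \<in> S \<inter> T"
    obtain m \<epsilon> where 1: "\<epsilon> > 0" "\<forall>g\<in>schwartz. Nb f m \<epsilon> g \<longrightarrow> g \<in> S"
      using S f unfolding P_def by blast
    obtain n \<delta> where 2: "\<delta> > 0" "\<forall>g\<in>schwartz. Nb f n \<delta> g \<longrightarrow> g \<in> T"
      using T f unfolding P_def by blast
    have "Nb f m \<epsilon> g \<and> Nb f n \<delta> g" if "Nb f (max m n) (min \<epsilon> \<delta>) g" for g
      using that by (simp add: Nb_def)
    then show "\<exists>m. \<exists>\<epsilon>>0. \<forall>g\<in>schwartz. Nb f m \<epsilon> g \<longrightarrow> g \<in> S \<inter> T"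
      using 1 2 by (intro exI[of _ "max m n"] exI[of _ "min \<epsilon> \<delta>"]) simp
  qed
  moreover have "P (\<Union>\<K>)" if "\<forall>K\<in>\<K>. P K" for \<K>
    unfolding P_def
  proof (intro conjI ballI)
    show "\<Union>\<K> \<subseteq> schwartz" using that by (auto simp: P_def)
    fix f assume "f \<in> \<Union>\<K>"
    then obtain K where K: "K \<in> \<K>" "f \<in> K" by blast
    have "P K" using that K(1) by blast
    then obtain m \<epsilon> where "\<epsilon> > 0" "\<forall>g\<in>schwartz. Nb f m \<epsilon> g \<longrightarrow> g \<in> K"
      using K(2) unfolding P_def by blast
    then show "\<exists>m. \<exists>\<epsilon>>0. \<forall>g\<in>schwartz. Nb f m \<epsilon> g \<longrightarrow> g \<in> \<Union>\<K>"
      using K(1) by (intro exI[of _ m] exI[of _ \<epsilon>]) auto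
  qed
  ultimately have "istopology P" unfolding istopology_def by blast
  moreover have "schwartz_topology = topology P"
    by (simp add: schwartz_topology_def P_def[abs_def] Nb_def)
  ultimately have "openin schwartz_topology U \<longleftrightarrow> P U"
    by (metis topology_inverse')
  then show ?thesis by (simp add: P_def Nb_def)
qed

lemma topspace_schwartz_topology: "topspace schwartz_topology = schwartz"
proof
  have "openin schwartz_topology schwartz"
    by (auto simp: openin_schwartz_topology intro: exI[of _ 1])
  then show "schwartz \<subseteq> topspace schwartz_topology" by (rule openin_subset)
  show "topspace schwartz_topology \<subseteq> schwartz"
    using openin_topspace[of schwartz_topology] unfolding openin_schwartz_topology by (rule conjunct1)
qed


section \<open>Tempered distributions\<close>

text \<open>Distributions are functions on all of \<open>real^'d \<Rightarrow> complex\<close>; only their values on Schwartz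
  functions are meaningful.\<close>

definition tempered :: "((real^'d \<Rightarrow> complex) \<Rightarrow> complex) \<Rightarrow> bool" where
  "tempered T \<longleftrightarrow>
     (\<forall>f\<in>schwartz. \<forall>g\<in>schwartz. T (\<lambda>x. f x + g x) = T f + T g) \<and>
     (\<forall>c. \<forall>f\<in>schwartz. T (\<lambda>x. c * f x) = c * T f) \<and>
     continuous_map schwartz_topology euclidean T"

definition fourier :: "(real^'d \<Rightarrow> complex) \<Rightarrow> real^'d \<Rightarrow> complex" where
  "fourier f y = (LINT x|lborel. f x * exp (- 2 * pi * \<i> * (x \<bullet> y)))"

definition fourier_dist ::
  "((real^'d \<Rightarrow> complex) \<Rightarrow> complex) \<Rightarrow> (real^'d \<Rightarrow> complex) \<Rightarrow> complex" where
  "fourier_dist T f = T (fourier f)"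

definition dist_support :: "((real^'d \<Rightarrow> complex) \<Rightarrow> complex) \<Rightarrow> (real^'d) set" where
  "dist_support T = - \<Union>{U. open U \<and>
     (\<forall>f\<in>test_functions. closure {x. f x \<noteq> 0} \<subseteq> U \<longrightarrow> T f = 0)}"

definition deriv_delta :: "('d \<Rightarrow> nat) \<Rightarrow> real^'d \<Rightarrow> (real^'d \<Rightarrow> complex) \<Rightarrow> complex" where
  "deriv_delta j a f = (- 1) ^ (\<Sum>i\<in>UNIV. j i) * deriv_multi j f a"


section \<open>Complex Radon measures\<close>

text \<open>A locally finite complex measure need not have a value on unbounded sets, so it is a set
  function on the bounded Borel sets; its values elsewhere are irrelevant.\<close>

definition bounded_borel :: "'a::euclidean_space set set" where
  "bounded_borel = {B \<in> sets borel. bounded B}"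

definition radon :: "('a::euclidean_space set \<Rightarrow> complex) \<Rightarrow> bool" where
  "radon \<mu> \<longleftrightarrow> (\<forall>A :: nat \<Rightarrow> 'a set.
     range A \<subseteq> bounded_borel \<longrightarrow> disjoint_family A \<longrightarrow> bounded (\<Union>i. A i) \<longrightarrow>
     (\<lambda>i. \<mu> (A i)) sums \<mu> (\<Union>i. A i))"

definition atomic :: "('a::euclidean_space set \<Rightarrow> complex) \<Rightarrow> bool" where
  "atomic \<mu> \<longleftrightarrow> radon \<mu> \<and>
     (\<exists>A a. countable A \<and> (\<forall>B\<in>bounded_borel. (a has_sum \<mu> B) (A \<inter> B)))"

text \<open>The total variation, again as a set function of the same kind. The supremum is over finite
  Borel partitions of \<open>B\<close>; it is finite for every \<open>\<mu>\<close> satisfying \<open>radon\<close> and bounded \<open>B\<close>.\<close>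

definition total_variation :: "('a::euclidean_space set \<Rightarrow> complex) \<Rightarrow> 'a set \<Rightarrow> complex" where
  "total_variation \<mu> B = complex_of_real
     (SUP P\<in>{P. finite P \<and> disjoint P \<and> P \<subseteq> sets borel \<and> \<Union>P = B}. \<Sum>X\<in>P. norm (\<mu> X))"

text \<open>Upper variation of a real set function, the positive part in its Jordan decomposition. The
  function \<open>ennreal\<close> sends negative numbers to \<open>0\<close>.\<close>

definition upper_variation :: "('a::euclidean_space set \<Rightarrow> real) \<Rightarrow> 'a measure" where
  "upper_variation \<nu> = measure_of UNIV (sets borel)
     (\<lambda>B. SUP X\<in>{X \<in> bounded_borel. X \<subseteq> B}. ennreal (\<nu> X))"

definition radon_integral ::
  "('a::euclidean_space set \<Rightarrow> complex) \<Rightarrow> ('a \<Rightarrow> complex) \<Rightarrow> complex" where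
  "radon_integral \<mu> f =
     (LINT x|upper_variation (\<lambda>B. Re (\<mu> B)). f x) - (LINT x|upper_variation (\<lambda>B. - Re (\<mu> B)). f x)
     + \<i> * ((LINT x|upper_variation (\<lambda>B. Im (\<mu> B)). f x)
            - (LINT x|upper_variation (\<lambda>B. - Im (\<mu> B)). f x))"

definition dist_of_measure ::
  "((real^'d \<Rightarrow> complex) \<Rightarrow> complex) \<Rightarrow> ((real^'d) set \<Rightarrow> complex) \<Rightarrow> bool" where
  "dist_of_measure T \<mu> \<longleftrightarrow> (\<forall>f\<in>test_functions. T f = radon_integral \<mu> f)"

definition tempered_measure :: "((real^'d) set \<Rightarrow> complex) \<Rightarrow> bool" where
  "tempered_measure \<mu> \<longleftrightarrow> (\<exists>T. tempered T \<and> dist_of_measure T \<mu>)"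

text \<open>The tempered extension is unique on Schwartz functions, as test functions are dense there.
  It exists in particular when \<open>total_variation \<mu>\<close> is tempered.\<close>

definition tempered_ext ::
  "((real^'d) set \<Rightarrow> complex) \<Rightarrow> (real^'d \<Rightarrow> complex) \<Rightarrow> complex" where
  "tempered_ext \<mu> = (SOME T. tempered T \<and> dist_of_measure T \<mu>)"

definition fourier_measure ::
  "((real^'d) set \<Rightarrow> complex) \<Rightarrow> (real^'d \<Rightarrow> complex) \<Rightarrow> complex" where
  "fourier_measure \<mu> = fourier_dist (tempered_ext \<mu>)"

definition spectrum :: "((real^'d) set \<Rightarrow> complex) \<Rightarrow> (real^'d) set" where
  "spectrum \<mu> = dist_support (fourier_measure \<mu>)"

text \<open>Equality with \<open>\<Sum>\<lambda>\<in>L. \<Sum>\<parallel>j\<parallel>\<le>m. p \<lambda> j * D\<^sup>j \<delta>\<^sub>\<lambda>\<close> as distributions. For \<open>L\<close> closed and discrete only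
  finitely many \<open>\<lambda>\<close> contribute for each test function.\<close>

definition delta_series ::
  "((real^'d \<Rightarrow> complex) \<Rightarrow> complex) \<Rightarrow> (real^'d) set \<Rightarrow> nat \<Rightarrow>
   (real^'d \<Rightarrow> ('d \<Rightarrow> nat) \<Rightarrow> complex) \<Rightarrow> bool" where
  "delta_series T L m p \<longleftrightarrow> (\<forall>f\<in>test_functions.
     ((\<lambda>l. \<Sum>j | multi_norm j \<le> m. p l j * deriv_delta j l f) has_sum T f) L)"

end

theory Submission
  imports Defs
begin

text \<open>Write \<open>a\<^sub>s = \<mu>{s} - \<nu>{s}\<close>. Since \<open>|\<mu>|\<close> and \<open>|\<nu>|\<close> are tempered they have polynomial growth, so for a test
  function \<open>\<psi>\<close> the difference of the two transforms, tested on \<open>\<psi>(\<cdot> - y)\<close>, is an absolutely convergent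
  exponential sum \<open>g(y)\<close> with coefficients \<open>a\<^sub>s \<psi>^(s)\<close> and frequencies \<open>s\<close>. If \<open>g\<close> is small on arbitrarily large
  balls then all coefficients vanish: averaging \<open>g\<close> over two suitably placed points removes one
  frequency, and all but finitely many frequencies are negligible. On the given balls \<open>g\<close> is small
  because each cluster of the spectra almost behaves like a single point, provided that the
  coefficients in a cluster are bounded.

  In case (b) this is assumed. In case (a) the masses of \<open>\<mu>^\<close> may be unbounded, and the balls have to be
  replaced by suitable smaller ones. By almost periodicity, finite configurations of atoms of \<open>\<mu>^\<close> and
  \<open>\<nu>^\<close> reappear, up to small displacements, in the given balls, where their points lie in different
  clusters; hence the number of atoms in a ball of fixed radius is bounded. A copy of a configuration
  with the maximal number of atoms can contain no further atoms, so its points stay apart, and their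
  masses are bounded since the almost periodic functions \<open>g\<close> are.

  All test functions used are tensor products of functions of one variable.\<close>

section \<open>Smooth functions of one real variable\<close>

text \<open>Smallness of \<open>g\<close> is known only on balls of finite radius whose position is
  not controlled, so Bohr means over the whole space cannot be used to extract a coefficient. The
  averages over finitely many points replace them: the radius they need depends only on the
  frequencies to be removed, and the resulting estimate is indifferent to the centre of the ball.
  The quantifiers are ordered accordingly: frequencies, radius, window.

  The conditions on \<open>r\<close> and \<open>x\<close> make the given balls leave every bounded
  set, so a far ball meets only clusters of large index. This turns limits in \<open>n\<close> into
  smallness on windows, while the bound \<open>N\<close> keeps the number of small errors fixed.

  In case (a) only the totals of the clusters are compared. Large masses may cancel inside a
  cluster, so neither single masses nor absolute sums over clusters are bounded by hypothesis; hence
  the detour through windows in which the atoms stay apart.\<close>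

definition vderiv :: "(real \<Rightarrow> complex) \<Rightarrow> real \<Rightarrow> complex" where
  "vderiv f x = vector_derivative f (at x)"

text \<open>The derivative is existentially quantified, so closure under sums, products and affine
  substitution follows by induction on \<open>n\<close> with the functions left arbitrary.
  \<open>Ck 0\<close> is no condition at all; \<open>smooth1\<close> asks for every
  \<open>n\<close>.\<close>

primrec Ck :: "nat \<Rightarrow> (real \<Rightarrow> complex) \<Rightarrow> bool" where
  "Ck 0 f \<longleftrightarrow> True"
| "Ck (Suc n) f \<longleftrightarrow> (\<exists>f'. (\<forall>x. (f has_vector_derivative f' x) (at x)) \<and> Ck n f')"

definition smooth1 :: "(real \<Rightarrow> complex) \<Rightarrow> bool" where
  "smooth1 f \<longleftrightarrow> (\<forall>n. Ck n f)"

lemma Ck_SucD: "Ck (Suc n) f \<Longrightarrow> Ck n f"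
proof (induction n arbitrary: f)
  case (Suc n)
  then show ?case by (subst (asm) (2) Ck.simps(2), subst Ck.simps(2)) blast
qed simp

lemma Ck_const: "Ck n (\<lambda>x. c)"
  by (induction n arbitrary: c) (auto intro!: exI[of _ "\<lambda>x. 0"])

lemma Ck_add: "Ck n f \<Longrightarrow> Ck n g \<Longrightarrow> Ck n (\<lambda>x. f x + g x)"
proof (induction n arbitrary: f g)
  case (Suc n)
  then obtain f' g' where "\<forall>x. (f has_vector_derivative f' x) (at x)" "Ck n f'"
    "\<forall>x. (g has_vector_derivative g' x) (at x)" "Ck n g'"
    by auto
  then show ?case
    using Suc.IH[of f' g'] by (auto intro!: exI[of _ "\<lambda>x. f' x + g' x"] has_vector_derivative_add)
qed simp

lemma Ck_mult: "Ck n f \<Longrightarrow> Ck n g \<Longrightarrow> Ck n (\<lambda>x. f x * g x)"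
proof (induction n arbitrary: f g)
  case (Suc n)
  then obtain f' g' where *: "\<forall>x. (f has_vector_derivative f' x) (at x)" "Ck n f'"
    "\<forall>x. (g has_vector_derivative g' x) (at x)" "Ck n g'"
    by auto
  have "Ck n (\<lambda>x. f x * g' x + f' x * g x)"
    using * Ck_SucD[OF Suc.prems(1)] Ck_SucD[OF Suc.prems(2)] by (intro Ck_add Suc.IH)
  then show ?case
    using * by (auto intro!: exI[of _ "\<lambda>x. f x * g' x + f' x * g x"] has_vector_derivative_mult)
qed simp

lemma Ck_affine: "Ck n f \<Longrightarrow> Ck n (\<lambda>x. f (a * x + b))"
proof (induction n arbitrary: f)
  case (Suc n)
  then obtain f' where *: "\<forall>x. (f has_vector_derivative f' x) (at x)" "Ck n f'"
    by auto
  have "((\<lambda>x. f (a * x + b)) has_vector_derivative (of_real a * f' (a * x + b))) (at x)" for x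
  proof -
    have "((\<lambda>x. a * x + b) has_vector_derivative a) (at x)"
      by (auto intro!: derivative_eq_intros simp: has_real_derivative_iff_has_vector_derivative[symmetric])
    from vector_diff_chain_at[OF this *(1)[rule_format]] show ?thesis
      by (simp add: o_def scaleR_conv_of_real)
  qed
  moreover have "Ck n (\<lambda>x. of_real a * f' (a * x + b))"
    by (intro Ck_mult Ck_const Suc.IH *)
  ultimately show ?case
    by (auto intro!: exI[of _ "\<lambda>x. of_real a * f' (a * x + b)"])
qed simp

lemma Ck_cis: "Ck n (\<lambda>x. exp (\<i> * of_real (c * x)))"
proof (induction n)
  case (Suc n)
  have "((\<lambda>x. exp (\<i> * of_real (c * x))) has_vector_derivative (\<i> * of_real c) * exp (\<i> * of_real (c * x))) (at x)" for x
  proof -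
    have 1: "((\<lambda>x. \<i> * of_real (c * x)) has_vector_derivative (\<i> * of_real c)) (at x)"
      by (auto intro!: derivative_eq_intros simp: has_vector_derivative_def scaleR_conv_of_real)
    have 2: "(exp has_field_derivative exp (\<i> * of_real (c * x))) (at (\<i> * of_real (c * x)))"
      by (rule DERIV_exp)
    from field_vector_diff_chain_at[OF 1 2] show ?thesis by (simp add: o_def)
  qed
  moreover have "Ck n (\<lambda>x. (\<i> * of_real c) * exp (\<i> * of_real (c * x)))"
    by (rule Ck_mult[OF Ck_const Suc])
  ultimately show ?case
    by (auto intro!: exI[of _ "\<lambda>x. (\<i> * of_real c) * exp (\<i> * of_real (c * x))"] simp del: of_real_mult)
qed simp

lemma Ck_of_real: "Ck n of_real"
proof (cases n)
  case (Suc m)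
  have "(complex_of_real has_vector_derivative 1) (at x)" for x
    by (auto intro!: derivative_eq_intros simp: has_vector_derivative_def scaleR_conv_of_real)
  then show ?thesis unfolding Suc by (auto intro!: exI[of _ "\<lambda>x. 1"] Ck_const)
qed simp

lemma smooth1_vderiv:
  assumes "smooth1 f"
  shows "(f has_vector_derivative vderiv f x) (at x)" "smooth1 (vderiv f)"
proof -
  have *: "\<exists>f'. (\<forall>x. (f has_vector_derivative f' x) (at x)) \<and> Ck n f'" for n
    using assms unfolding smooth1_def by (metis Ck.simps(2))
  have 1: "f' = vderiv f" if "\<forall>x. (f has_vector_derivative f' x) (at x)" for f'
    using that by (auto simp: vderiv_def fun_eq_iff intro!: vector_derivative_at[symmetric])
  show "(f has_vector_derivative vderiv f x) (at x)"
    using *[of 0] 1 by blast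
  show "smooth1 (vderiv f)"
    using * 1 unfolding smooth1_def by metis
qed

lemma vderiv_eqI: "(\<And>x. (f has_vector_derivative f' x) (at x)) \<Longrightarrow> vderiv f = f'"
  by (auto simp: vderiv_def fun_eq_iff intro!: vector_derivative_at)

lemma smooth1_pow_vderiv: "smooth1 f \<Longrightarrow> smooth1 ((vderiv ^^ n) f)"
  by (induction n) (auto intro: smooth1_vderiv)

lemma smooth1_continuous: "smooth1 f \<Longrightarrow> continuous_on S f"
  by (meson continuous_at_imp_continuous_on has_vector_derivative_continuous smooth1_vderiv(1))

lemma smooth1_intros:
  shows "smooth1 (\<lambda>x. c)" and "smooth1 f \<Longrightarrow> smooth1 g \<Longrightarrow> smooth1 (\<lambda>x. f x + g x)"
    and "smooth1 f \<Longrightarrow> smooth1 g \<Longrightarrow> smooth1 (\<lambda>x. f x * g x)"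
    and "smooth1 f \<Longrightarrow> smooth1 (\<lambda>x. f (a * x + b))"
    and "smooth1 (\<lambda>x. exp (\<i> * of_real (k * x)))" "smooth1 of_real"
  by (auto simp only: smooth1_def intro!: Ck_const Ck_add Ck_mult Ck_affine Ck_cis Ck_of_real)

lemma vderiv_add: "smooth1 f \<Longrightarrow> smooth1 g \<Longrightarrow> vderiv (\<lambda>x. f x + g x) = (\<lambda>x. vderiv f x + vderiv g x)"
  by (intro vderiv_eqI has_vector_derivative_add smooth1_vderiv)

lemma vderiv_mult: "smooth1 f \<Longrightarrow> smooth1 g \<Longrightarrow> vderiv (\<lambda>x. f x * g x) = (\<lambda>x. vderiv f x * g x + f x * vderiv g x)"
  using has_vector_derivative_mult[OF smooth1_vderiv(1) smooth1_vderiv(1), of f g]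
  by (intro vderiv_eqI) (auto simp: add.commute)

lemma vderiv_const: "vderiv (\<lambda>x. c) = (\<lambda>x. 0)"
  by (intro vderiv_eqI) auto

lemma vderiv_cmult: "smooth1 f \<Longrightarrow> vderiv (\<lambda>x. c * f x) = (\<lambda>x. c * vderiv f x)"
  by (simp add: vderiv_mult smooth1_intros vderiv_const)

lemma pow_vderiv_add:
  "smooth1 f \<Longrightarrow> smooth1 g \<Longrightarrow> (vderiv ^^ n) (\<lambda>x. f x + g x) = (\<lambda>x. (vderiv ^^ n) f x + (vderiv ^^ n) g x)"
  by (induction n) (auto simp: vderiv_add smooth1_pow_vderiv)

lemma pow_vderiv_cmult:
  "smooth1 f \<Longrightarrow> (vderiv ^^ n) (\<lambda>x. c * f x) = (\<lambda>x. c * (vderiv ^^ n) f x)"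
  by (induction n) (auto simp: vderiv_cmult smooth1_pow_vderiv)

lemma vderiv_scale:
  assumes "smooth1 f" shows "vderiv (\<lambda>x. f (a * x + b)) = (\<lambda>x. of_real a * vderiv f (a * x + b))"
proof (rule vderiv_eqI)
  fix x
  have "((\<lambda>x. a * x + b) has_vector_derivative a) (at x)"
    by (auto intro!: derivative_eq_intros simp: has_real_derivative_iff_has_vector_derivative[symmetric])
  from vector_diff_chain_at[OF this smooth1_vderiv(1)[OF assms]]
  show "((\<lambda>x. f (a * x + b)) has_vector_derivative of_real a * vderiv f (a * x + b)) (at x)"
    by (simp add: o_def scaleR_conv_of_real)
qed

lemma pow_vderiv_scale:
  "smooth1 f \<Longrightarrow> (vderiv ^^ n) (\<lambda>x. f (a * x + b)) = (\<lambda>x. of_real a ^ n * (vderiv ^^ n) f (a * x + b))"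
  by (induction n)
    (auto simp: vderiv_cmult smooth1_pow_vderiv vderiv_scale smooth1_intros mult.assoc mult.left_commute)

section \<open>Flat functions and bumps on the line\<close>

definition flatr :: "nat \<Rightarrow> real \<Rightarrow> real" where
  "flatr k x = (if x > 0 then (1 / x) ^ k * exp (- (1 / x)) else 0)"

abbreviation "flat k x \<equiv> complex_of_real (flatr k x)"

lemma flatr_tendsto_0: "(flatr k \<longlongrightarrow> 0) (at_right 0)"
proof -
  have "((\<lambda>x::real. x ^ k / exp x) \<longlongrightarrow> 0) at_top"
    by (rule tendsto_power_div_exp_0)
  then have "((\<lambda>x::real. (inverse x) ^ k / exp (inverse x)) \<longlongrightarrow> 0) (at_right 0)"
    by (rule filterlim_compose[OF _ filterlim_inverse_at_top_right])
  then show ?thesis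
    by (rule Lim_transform_eventually)
      (auto simp: eventually_at_filter flatr_def exp_minus field_simps intro!: eventuallyI)
qed

text \<open>The powers of 1/x in \<open>flatr\<close> close the family under differentiation up to
  linear combinations. Smoothness of exp(-1/x), the case \<open>k = 0\<close>, thus becomes an
  induction over the whole family.\<close>

lemma DERIV_flatr: "(flatr k has_real_derivative (flatr (k + 2) x - k * flatr (k + 1) x)) (at x)"
proof -
  consider "x > 0" | "x < 0" | "x = 0" by linarith
  then show ?thesis
  proof cases
    case 1
    have "((\<lambda>x. (1 / x) ^ k * exp (- (1 / x))) has_real_derivative (flatr (k + 2) x - k * flatr (k + 1) x)) (at x)"
    proof -
      have "((\<lambda>x. (1 / x) ^ k) has_real_derivative (- k * (1 / x) ^ Suc k)) (at x)"
      proof (cases k)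
        case (Suc m)
        have "((\<lambda>x. 1 / x) has_real_derivative (- ((1 / x) ^ 2))) (at x)"
          using 1 by (auto intro!: derivative_eq_intros simp: field_simps power2_eq_square)
        from DERIV_power[OF this, of k] show ?thesis
          unfolding Suc by (rule DERIV_cong)
            (simp add: power2_eq_square algebra_simps add_divide_distrib diff_divide_distrib)
      qed simp
      moreover have "((\<lambda>x. exp (- (1 / x))) has_real_derivative ((1 / x) ^ 2 * exp (- (1 / x)))) (at x)"
        using 1 by (auto intro!: derivative_eq_intros simp: field_simps power2_eq_square)
      ultimately have "((\<lambda>x. (1 / x) ^ k * exp (- (1 / x))) has_real_derivative
          (- k * (1 / x) ^ Suc k) * exp (- (1 / x)) + (1 / x) ^ 2 * exp (- (1 / x)) * (1 / x) ^ k) (at x)"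
        by (rule DERIV_mult)
      then show ?thesis using 1 by (simp add: flatr_def power2_eq_square algebra_simps)
    qed
    then show ?thesis
      by (rule has_field_derivative_transform_within_open[where S = "{0<..}"])
        (use 1 in \<open>auto simp: flatr_def\<close>)
  next
    case 2
    have "((\<lambda>x. 0) has_real_derivative (flatr (k + 2) x - k * flatr (k + 1) x)) (at x)"
      using 2 by (auto simp: flatr_def)
    then show ?thesis
      by (rule has_field_derivative_transform_within_open[where S = "{..<0}"])
        (use 2 in \<open>auto simp: flatr_def\<close>)
  next
    case 3
    \<comment> \<open>The right difference quotient at 0 is \<open>flatr (Suc k)\<close>, which
      tends to 0; the left one is constantly 0.\<close>
    have "((\<lambda>y. (flatr k y - flatr k 0) / (y - 0)) \<longlongrightarrow> 0) (at_right 0)"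
      by (rule Lim_transform_eventually[OF flatr_tendsto_0[of "Suc k"]])
        (auto simp: eventually_at_filter flatr_def)
    moreover have "((\<lambda>y. (flatr k y - flatr k 0) / (y - 0)) \<longlongrightarrow> 0) (at_left 0)"
      by (rule Lim_transform_eventually[OF tendsto_const])
        (auto simp: eventually_at_filter flatr_def)
    ultimately have "((\<lambda>y. (flatr k y - flatr k 0) / (y - 0)) \<longlongrightarrow> 0) (at 0)"
      by (simp add: filterlim_split_at)
    then have "(flatr k has_real_derivative 0) (at 0)"
      by (simp add: has_field_derivative_iff)
    then show ?thesis using 3 by (simp add: flatr_def)
  qed
qed

lemma smooth1_flat: "smooth1 (flat k)"
proof -
  have "Ck n (flat k)" for n
  proof (induction n arbitrary: k)
    case (Suc n)
    have "(flat k has_vector_derivative (flat (k + 2) x + (- of_nat k) * flat (k + 1) x)) (at x)" for x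
      using has_vector_derivative_of_real[OF DERIV_flatr[of k x]]
      by simp
    moreover have "Ck n (\<lambda>x. flat (k + 2) x + (- of_nat k) * flat (k + 1) x)"
      by (intro Ck_add Ck_mult Ck_const Suc.IH)
    ultimately show ?case
      unfolding Ck.simps by (intro exI conjI allI)
  qed simp
  then show ?thesis by (simp add: smooth1_def)
qed

lemma flatr_bounds: "0 \<le> flatr 0 x" "flatr 0 x \<le> 1" "0 < x \<Longrightarrow> 0 < flatr 0 x" "x \<le> 0 \<Longrightarrow> flatr 0 x = 0"
  by (auto simp: flatr_def)

lemma flatr_mono: "x \<le> y \<Longrightarrow> flatr 0 x \<le> flatr 0 y"
  by (auto simp: flatr_def field_simps)

text \<open>The parameter \<open>n\<close> steepens the flanks, so that the limit is the indicator function of the open interval.\<close>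

definition bump :: "real \<Rightarrow> real \<Rightarrow> real \<Rightarrow> real \<Rightarrow> real" where
  "bump n a b t = flatr 0 (n * (t - a)) * flatr 0 (n * (b - t))"

lemma smooth1_bump: "smooth1 (\<lambda>t. complex_of_real (bump n a b t))"
proof -
  have "smooth1 (\<lambda>t. flat 0 (n * t + (- n * a)) * flat 0 ((- n) * t + n * b))"
    by (intro smooth1_intros smooth1_intros(4)[OF smooth1_flat])
  then show ?thesis by (simp add: bump_def algebra_simps)
qed

lemma bump_bounds: "0 \<le> bump n a b t" "bump n a b t \<le> 1"
  by (auto simp: bump_def flatr_bounds mult_le_one)

lemma bump_pos: "n > 0 \<Longrightarrow> a < t \<Longrightarrow> t < b \<Longrightarrow> 0 < bump n a b t"
  by (auto simp: bump_def flatr_bounds)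

lemma bump_eq_0: "n > 0 \<Longrightarrow> \<not> (a < t \<and> t < b) \<Longrightarrow> bump n a b t = 0"
  by (auto simp: bump_def flatr_bounds not_less mult_nonneg_nonpos)

text \<open>Inside the interval each factor is exp(-1/(nc)) with c > 0. The limit later recovers the
  measures of open boxes from integrals of test functions.\<close>

lemma bump_tendsto: "(\<lambda>n. bump (Suc n) a b t) \<longlonglongrightarrow> indicator {a<..<b} t"
proof (cases "a < t \<and> t < b")
  case True
  have *: "(\<lambda>n. flatr 0 (real (Suc n) * c)) \<longlonglongrightarrow> 1" if "c > 0" for c
  proof -
    have "(\<lambda>n. exp (- (inverse (real (Suc n)) * (1 / c)))) \<longlonglongrightarrow> exp (- (0 * (1 / c)))"
      by (intro tendsto_intros LIMSEQ_inverse_real_of_nat)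
    moreover have "0 < c + c * real n" for n using that by (simp add: add_pos_nonneg)
    ultimately show ?thesis using that by (simp add: flatr_def field_simps)
  qed
  show ?thesis unfolding bump_def
    using tendsto_mult[OF *[of "t - a"] *[of "b - t"]] True by simp
qed (simp add: bump_eq_0)

section \<open>Test functions and Schwartz functions of one variable\<close>

definition test1 :: "(real \<Rightarrow> complex) \<Rightarrow> bool" where
  "test1 f \<longleftrightarrow> smooth1 f \<and> (\<exists>R>0. \<forall>x. R < \<bar>x\<bar> \<longrightarrow> f x = 0)"

text \<open>The weight has base \<open>1 + \<bar>t\<bar>\<close>, not \<open>\<bar>t\<bar>\<close>,
  because the product of such weights over all coordinates dominates the power of the norm in
  \<open>schwartz\<close>.\<close>

definition schwartz1 :: "(real \<Rightarrow> complex) \<Rightarrow> bool" where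
  "schwartz1 f \<longleftrightarrow> smooth1 f \<and> (\<forall>k j. \<exists>C. \<forall>t. (1 + \<bar>t\<bar>) ^ k * norm ((vderiv ^^ j) f t) \<le> C)"

lemma test1_smooth1: "test1 f \<Longrightarrow> smooth1 f"
  by (simp add: test1_def)

lemma schwartz1_smooth1: "schwartz1 f \<Longrightarrow> smooth1 f"
  by (simp add: schwartz1_def)

lemma schwartz1_vderiv: "schwartz1 f \<Longrightarrow> schwartz1 (vderiv f)"
  unfolding schwartz1_def by (metis funpow_Suc_right o_apply smooth1_vderiv(2))

lemma vderiv_eq_0_outside: "(\<And>x. R < \<bar>x\<bar> \<Longrightarrow> f x = 0) \<Longrightarrow> R < \<bar>x\<bar> \<Longrightarrow> vderiv f x = 0"
proof -
  assume f: "\<And>x. R < \<bar>x\<bar> \<Longrightarrow> f x = 0" and x: "R < \<bar>x\<bar>"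
  have "open {x::real. R < \<bar>x\<bar>}"
    by (intro open_Collect_less continuous_intros)
  then have "(f has_vector_derivative 0) (at x)"
    using has_vector_derivative_transform_within_open[of "\<lambda>x. 0" 0 x "{x. R < \<bar>x\<bar>}" f] f x
    by auto
  then show ?thesis by (auto simp: vderiv_def intro: vector_derivative_at)
qed

lemma test1_vderiv: "test1 f \<Longrightarrow> test1 (vderiv f)"
  unfolding test1_def using smooth1_vderiv(2) vderiv_eq_0_outside by metis

lemma test1_mult: "smooth1 f \<Longrightarrow> test1 g \<Longrightarrow> test1 (\<lambda>x. f x * g x)"
  unfolding test1_def by (auto intro: smooth1_intros)

lemma test1_bounded: "test1 f \<Longrightarrow> \<exists>C. \<forall>x. norm (f x) \<le> C"
proof -
  assume f: "test1 f"
  then obtain R where R: "R > 0" "\<And>x. R < \<bar>x\<bar> \<Longrightarrow> f x = 0"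
    by (auto simp: test1_def)
  have "compact (f ` {-R..R})"
    by (intro compact_continuous_image smooth1_continuous test1_smooth1 f) auto
  then obtain C where C: "\<And>x. x \<in> {-R..R} \<Longrightarrow> norm (f x) \<le> C"
    by (meson bounded_iff compact_imp_bounded image_eqI)
  have "norm (f x) \<le> max C 0" for x
  proof (cases "R < \<bar>x\<bar>")
    case False
    then have "x \<in> {-R..R}" by auto
    then show ?thesis using C[of x] by simp
  qed (use R(2) in simp)
  then show ?thesis by blast
qed

lemma test1_pow_vderiv: "test1 f \<Longrightarrow> test1 ((vderiv ^^ j) f)"
  by (induction j) (auto intro: test1_vderiv)

lemma test1_schwartz1: "test1 f \<Longrightarrow> schwartz1 f"
  unfolding schwartz1_def
proof (intro conjI allI)
  assume f: "test1 f"
  then show "smooth1 f" by (rule test1_smooth1)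
  fix k j
  have g: "test1 ((vderiv ^^ j) f)" by (rule test1_pow_vderiv[OF f])
  then obtain R where R: "R > 0" "\<And>x. R < \<bar>x\<bar> \<Longrightarrow> (vderiv ^^ j) f x = 0"
    by (auto simp: test1_def)
  obtain C where C: "\<And>x. norm ((vderiv ^^ j) f x) \<le> C"
    using test1_bounded[OF g] by blast
  have "C \<ge> 0" using C[of 0] norm_ge_zero order_trans by blast
  have "(1 + \<bar>t\<bar>) ^ k * norm ((vderiv ^^ j) f t) \<le> (1 + R) ^ k * C" for t
  proof (cases "R < \<bar>t\<bar>")
    case True
    then show ?thesis using R \<open>C \<ge> 0\<close> by simp
  next
    case False
    then show ?thesis
      using C[of t] by (intro mult_mono power_mono) (use R in auto)
  qed
  then show "\<exists>C. \<forall>t. (1 + \<bar>t\<bar>) ^ k * norm ((vderiv ^^ j) f t) \<le> C" by blast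
qed

lemma test1_bump: "n > 0 \<Longrightarrow> test1 (\<lambda>t. complex_of_real (bump n a b t))"
  unfolding test1_def
proof (intro conjI exI allI impI)
  fix t :: real assume "n > 0" "max \<bar>a\<bar> \<bar>b\<bar> + 1 < \<bar>t\<bar>"
  then have "\<not> (a < t \<and> t < b)" by linarith
  then show "complex_of_real (bump n a b t) = 0"
    using bump_eq_0[of n] \<open>n > 0\<close> by simp
qed (auto simp: smooth1_bump)

lemma test1_affine: "test1 f \<Longrightarrow> a \<noteq> 0 \<Longrightarrow> test1 (\<lambda>x. f (a * x + b))"
  unfolding test1_def
proof (elim conjE exE, intro conjI)
  fix R assume R: "0 < R" "\<forall>x. R < \<bar>x\<bar> \<longrightarrow> f x = 0" and a: "a \<noteq> 0"
  have "f (a * x + b) = 0" if "(R + \<bar>b\<bar>) / \<bar>a\<bar> < \<bar>x\<bar>" for x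
  proof -
    have "R + \<bar>b\<bar> < \<bar>a * x\<bar>" using that a by (simp add: field_simps abs_mult)
    then have "R < \<bar>a * x + b\<bar>" by linarith
    then show ?thesis using R by blast
  qed
  moreover have "(R + \<bar>b\<bar>) / \<bar>a\<bar> > 0" using R(1) a by simp
  ultimately show "\<exists>R>0. \<forall>x. R < \<bar>x\<bar> \<longrightarrow> f (a * x + b) = 0" by blast
qed (auto intro: smooth1_intros)

text \<open>A single product rule under \<open>j\<close> further derivatives. Both terms on the
  right have the original shape, with \<open>f\<close> or \<theta> replaced by its derivative, so
  inductions on \<open>j\<close> can use this in place of the Leibniz formula.\<close>

lemma pow_vderiv_cutoff:
  assumes f: "smooth1 f" and \<theta>: "smooth1 \<theta>"
  shows "(vderiv ^^ Suc j) (\<lambda>t. f t * \<theta> (t / R)) t =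
     (vderiv ^^ j) (\<lambda>t. vderiv f t * \<theta> (t / R)) t + of_real (1 / R) * (vderiv ^^ j) (\<lambda>t. f t * vderiv \<theta> (t / R)) t"
proof -
  have s: "smooth1 (\<lambda>t. g (t / R))" if "smooth1 g" for g
    using smooth1_intros(4)[OF that, of "1 / R" 0] by simp
  note f' = smooth1_vderiv(2)[OF f] and \<theta>' = smooth1_vderiv(2)[OF \<theta>]
  have "vderiv (\<lambda>t. \<theta> (t / R)) = (\<lambda>t. of_real (1 / R) * vderiv \<theta> (t / R))"
    using vderiv_scale[OF \<theta>, of "1 / R" 0] by simp
  then have "vderiv (\<lambda>t. f t * \<theta> (t / R)) = (\<lambda>t. vderiv f t * \<theta> (t / R) + of_real (1 / R) * (f t * vderiv \<theta> (t / R)))"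
    by (simp add: vderiv_mult[OF f s[OF \<theta>]] mult.left_commute)
  then have "(vderiv ^^ Suc j) (\<lambda>t. f t * \<theta> (t / R)) t =
     (vderiv ^^ j) (\<lambda>t. vderiv f t * \<theta> (t / R) + of_real (1 / R) * (f t * vderiv \<theta> (t / R))) t"
    by (simp only: funpow_Suc_right o_apply)
  also have "\<dots> = (vderiv ^^ j) (\<lambda>t. vderiv f t * \<theta> (t / R)) t + (vderiv ^^ j) (\<lambda>t. of_real (1 / R) * (f t * vderiv \<theta> (t / R))) t"
    by (subst pow_vderiv_add) (rule smooth1_intros(3) smooth1_intros(1) f f' s \<theta> \<theta>' refl)+
  also have "(vderiv ^^ j) (\<lambda>t. of_real (1 / R) * (f t * vderiv \<theta> (t / R))) t = of_real (1 / R) * (vderiv ^^ j) (\<lambda>t. f t * vderiv \<theta> (t / R)) t"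
    by (subst pow_vderiv_cmult) (rule smooth1_intros(3) f s \<theta>' refl)+
  finally show ?thesis .
qed

text \<open>What matters is uniformity in \<open>R\<close>. Both functions vary in the induction
  since a derivative may fall on either factor.\<close>

lemma cutoff_bound:
  assumes "schwartz1 f" "test1 \<theta>"
  shows "\<exists>C. \<forall>R\<ge>1. \<forall>t. (1 + \<bar>t\<bar>) ^ k * norm ((vderiv ^^ j) (\<lambda>t. f t * \<theta> (t / R)) t) \<le> C"
  using assms
proof (induction j arbitrary: f \<theta>)
  case 0
  obtain C where C: "\<And>t. (1 + \<bar>t\<bar>) ^ k * norm ((vderiv ^^ 0) f t) \<le> C"
    using 0(1) unfolding schwartz1_def by blast
  obtain D where D: "\<And>t. norm (\<theta> t) \<le> D"
    using test1_bounded[OF 0(2)] by blast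
  have "0 \<le> (1 + \<bar>0::real\<bar>) ^ k * norm ((vderiv ^^ 0) f 0)" by simp
  then have "C \<ge> 0" using C[of 0] by linarith
  then have "((1 + \<bar>t\<bar>) ^ k * norm (f t)) * norm (\<theta> (t / R)) \<le> C * D" for t R
    using C[of t] D[of "t / R"] by (intro mult_mono) auto
  then show ?case by (auto simp: norm_mult mult.assoc)
next
  case (Suc j)
  note f = schwartz1_smooth1[OF Suc.prems(1)] and \<theta> = test1_smooth1[OF Suc.prems(2)]
  note f' = schwartz1_vderiv[OF Suc.prems(1)]
  obtain C1 where C1: "\<And>R t. R \<ge> 1 \<Longrightarrow>
      (1 + \<bar>t\<bar>) ^ k * norm ((vderiv ^^ j) (\<lambda>t. vderiv f t * \<theta> (t / R)) t) \<le> C1"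
    using Suc.IH[OF f' Suc.prems(2)] by blast
  obtain C2 where C2: "\<And>R t. R \<ge> 1 \<Longrightarrow>
      (1 + \<bar>t\<bar>) ^ k * norm ((vderiv ^^ j) (\<lambda>t. f t * vderiv \<theta> (t / R)) t) \<le> C2"
    using Suc.IH[OF Suc.prems(1) test1_vderiv[OF Suc.prems(2)]] by blast
  have "(1 + \<bar>t\<bar>) ^ k * norm ((vderiv ^^ Suc j) (\<lambda>t. f t * \<theta> (t / R)) t) \<le> C1 + C2" if R: "R \<ge> 1" for R t
  proof -
    have "norm ((vderiv ^^ Suc j) (\<lambda>t. f t * \<theta> (t / R)) t) \<le> norm ((vderiv ^^ j) (\<lambda>t. vderiv f t * \<theta> (t / R)) t) + 1 * norm ((vderiv ^^ j) (\<lambda>t. f t * vderiv \<theta> (t / R)) t)"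
      unfolding pow_vderiv_cutoff[OF f \<theta>]
    proof (intro order_trans[OF norm_triangle_ineq] add_left_mono)
      have "norm (complex_of_real (1 / R)) \<le> 1" using R by (simp add: norm_divide)
      then show "norm (of_real (1 / R) * (vderiv ^^ j) (\<lambda>t. f t * vderiv \<theta> (t / R)) t)
          \<le> 1 * norm ((vderiv ^^ j) (\<lambda>t. f t * vderiv \<theta> (t / R)) t)"
        unfolding norm_mult by (rule mult_right_mono) simp
    qed
    then have "(1 + \<bar>t\<bar>) ^ k * norm ((vderiv ^^ Suc j) (\<lambda>t. f t * \<theta> (t / R)) t)
       \<le> (1 + \<bar>t\<bar>) ^ k * (norm ((vderiv ^^ j) (\<lambda>t. vderiv f t * \<theta> (t / R)) t) + 1 * norm ((vderiv ^^ j) (\<lambda>t. f t * vderiv \<theta> (t / R)) t))"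
      by (rule mult_left_mono) simp
    also have "\<dots> \<le> C1 + C2"
      using C1[OF R, of t] C2[OF R, of t] by (simp add: distrib_left)
    finally show ?thesis .
  qed
  then show ?case by blast
qed

lemma test1_lipschitz: "test1 f \<Longrightarrow> \<exists>D\<ge>0. \<forall>x y. norm (f x - f y) \<le> D * \<bar>x - y\<bar>"
proof -
  assume f: "test1 f"
  obtain D where D: "\<And>x. norm (vderiv f x) \<le> D"
    using test1_bounded[OF test1_vderiv[OF f]] by blast
  have "norm (f x - f y) \<le> D * norm (x - y)" for x y
  proof (rule differentiable_bound[where S = UNIV and f' = "\<lambda>x h. h *\<^sub>R vderiv f x"])
    fix x :: real
    show "(f has_derivative (\<lambda>h. h *\<^sub>R vderiv f x)) (at x within UNIV)"
      using smooth1_vderiv(1)[OF test1_smooth1[OF f]] by (simp add: has_vector_derivative_def)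
    show "onorm (\<lambda>h. h *\<^sub>R vderiv f x) \<le> D"
      by (rule onorm_le) (use D in \<open>auto simp: mult.commute[of D] intro: mult_left_mono\<close>)
  qed auto
  moreover have "D \<ge> 0" using D[of 0] norm_ge_zero order_trans by blast
  ultimately show ?thesis by auto
qed

text \<open>If no derivative falls on the cut-off, the Lipschitz bound D|t|/R for \<theta>(t/R) -
  \<theta>(0) supplies 1/R, and the extra |t| is paid for by decay of one order more. A derivative
  falling on the cut-off brings 1/R by itself; the rest is left to \<open>cutoff_bound\<close>,
  which does not ask for the value 1 at 0 that the derivative of \<theta> may lack.\<close>

lemma cutoff_diff:
  assumes "schwartz1 f" "test1 \<theta>" "\<theta> 0 = 1"
  shows "\<exists>C. \<forall>R\<ge>1. \<forall>t. (1 + \<bar>t\<bar>) ^ k * norm ((vderiv ^^ j) (\<lambda>t. f t * \<theta> (t / R)) t - (vderiv ^^ j) f t) \<le> C / R"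
  using assms
proof (induction j arbitrary: f)
  case 0
  obtain C where C: "\<And>t. (1 + \<bar>t\<bar>) ^ Suc k * norm ((vderiv ^^ 0) f t) \<le> C"
    using 0(1) unfolding schwartz1_def by blast
  obtain D where D: "D \<ge> 0" "\<And>s t. norm (\<theta> s - \<theta> t) \<le> D * \<bar>s - t\<bar>"
    using test1_lipschitz[OF 0(2)] by blast
  have "(1 + \<bar>t\<bar>) ^ k * norm (f t * \<theta> (t / R) - f t) \<le> (C * D) / R" if "R \<ge> 1" for t R
  proof -
    have "f t * \<theta> (t / R) - f t = f t * (\<theta> (t / R) - \<theta> 0)"
      using 0 by (simp add: algebra_simps)
    then have "(1 + \<bar>t\<bar>) ^ k * norm (f t * \<theta> (t / R) - f t) = ((1 + \<bar>t\<bar>) ^ k * norm (f t)) * norm (\<theta> (t / R) - \<theta> 0)"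
      by (simp add: norm_mult)
    also have "\<dots> \<le> ((1 + \<bar>t\<bar>) ^ k * norm (f t)) * (D * ((1 + \<bar>t\<bar>) / R))"
      using that by (intro mult_left_mono order_trans[OF D(2)] D(1)) (auto simp: divide_right_mono)
    also have "\<dots> = ((1 + \<bar>t\<bar>) ^ Suc k * norm (f t)) * (D / R)"
      by simp
    also have "\<dots> \<le> C * (D / R)"
      using C[of t] D that by (intro mult_right_mono) auto
    finally show ?thesis by simp
  qed
  then show ?case by auto
next
  case (Suc j)
  note f = schwartz1_smooth1[OF Suc.prems(1)] and \<theta> = test1_smooth1[OF Suc.prems(2)]
  note f' = schwartz1_vderiv[OF Suc.prems(1)]
  obtain C1 where C1: "\<And>R t. R \<ge> 1 \<Longrightarrow>
      (1 + \<bar>t\<bar>) ^ k * norm ((vderiv ^^ j) (\<lambda>t. vderiv f t * \<theta> (t / R)) t - (vderiv ^^ j) (vderiv f) t) \<le> C1 / R"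
    using Suc.IH[OF f' Suc.prems(2,3)] by blast
  obtain C2 where C2: "\<And>R t. R \<ge> 1 \<Longrightarrow>
      (1 + \<bar>t\<bar>) ^ k * norm ((vderiv ^^ j) (\<lambda>t. f t * vderiv \<theta> (t / R)) t) \<le> C2"
    using cutoff_bound[OF Suc.prems(1) test1_vderiv[OF Suc.prems(2)]] by blast
  have "(1 + \<bar>t\<bar>) ^ k * norm ((vderiv ^^ Suc j) (\<lambda>t. f t * \<theta> (t / R)) t - (vderiv ^^ Suc j) f t) \<le> (C1 + C2) / R"
    if R: "R \<ge> 1" for R t
  proof -
    have eq: "(vderiv ^^ Suc j) (\<lambda>t. f t * \<theta> (t / R)) t - (vderiv ^^ Suc j) f t =
       ((vderiv ^^ j) (\<lambda>t. vderiv f t * \<theta> (t / R)) t - (vderiv ^^ j) (vderiv f) t) + of_real (1 / R) * (vderiv ^^ j) (\<lambda>t. f t * vderiv \<theta> (t / R)) t"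
      unfolding pow_vderiv_cutoff[OF f \<theta>] by (simp add: funpow_Suc_right del: funpow.simps)
    have "norm ((vderiv ^^ Suc j) (\<lambda>t. f t * \<theta> (t / R)) t - (vderiv ^^ Suc j) f t) \<le> norm ((vderiv ^^ j) (\<lambda>t. vderiv f t * \<theta> (t / R)) t - (vderiv ^^ j) (vderiv f) t)
        + (1 / R) * norm ((vderiv ^^ j) (\<lambda>t. f t * vderiv \<theta> (t / R)) t)"
      unfolding eq
      using R by (intro order_trans[OF norm_triangle_ineq] add_left_mono)
        (auto simp: norm_mult norm_divide)
    then have "(1 + \<bar>t\<bar>) ^ k * norm ((vderiv ^^ Suc j) (\<lambda>t. f t * \<theta> (t / R)) t - (vderiv ^^ Suc j) f t)
       \<le> (1 + \<bar>t\<bar>) ^ k * (norm ((vderiv ^^ j) (\<lambda>t. vderiv f t * \<theta> (t / R)) t - (vderiv ^^ j) (vderiv f) t)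
          + (1 / R) * norm ((vderiv ^^ j) (\<lambda>t. f t * vderiv \<theta> (t / R)) t))"
      by (rule mult_left_mono) simp
    also have "\<dots> \<le> C1 / R + C2 / R"
      using C1[OF R, of t] divide_right_mono[OF C2[OF R, of t], of R] R by (simp add: distrib_left)
    finally show ?thesis by (simp add: add_divide_distrib)
  qed
  then show ?case by blast
qed

subsection \<open>The Fourier transform on the line\<close>

lemma has_vector_derivative_exp_linear:
  "((\<lambda>t. exp (- 2 * pi * \<i> * of_real (t * y))) has_vector_derivative
     exp (- 2 * pi * \<i> * of_real (t * y)) * (- 2 * pi * \<i> * of_real y)) (at t)"
proof -
  have 1: "((\<lambda>t. - 2 * pi * \<i> * of_real (t * y)) has_vector_derivative (- 2 * pi * \<i> * of_real y)) (at t)"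
    by (auto intro!: derivative_eq_intros simp: has_vector_derivative_def scaleR_conv_of_real)
  show ?thesis
    using field_vector_diff_chain_at[OF 1 DERIV_exp] by (simp add: o_def mult_ac)
qed

definition ft :: "(real \<Rightarrow> complex) \<Rightarrow> real \<Rightarrow> complex" where
  "ft h y = (LINT x|lborel. h x * exp (- 2 * pi * \<i> * of_real (x * y)))"

lemma test1_integrable_mult:
  assumes "test1 h" "continuous_on UNIV e"
  shows "integrable lborel (\<lambda>x. h x * e x)"
proof -
  obtain R where R: "R > 0" "\<And>x. R < \<bar>x\<bar> \<Longrightarrow> h x = 0"
    using assms by (auto simp: test1_def)
  have "integrable lborel (\<lambda>x. indicator {-R..R} x *\<^sub>R (h x * e x))"
    by (intro borel_integrable_compact continuous_intros smooth1_continuous test1_smooth1 assms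
          continuous_on_subset[OF assms(2)]) auto
  moreover have "(\<lambda>x. indicator {-R..R} x *\<^sub>R (h x * e x)) = (\<lambda>x. h x * e x)"
    using R(2) by (auto simp: indicator_def fun_eq_iff)
  ultimately show ?thesis by simp
qed

lemma test1_integrable: "test1 h \<Longrightarrow> integrable lborel h"
  using test1_integrable_mult[of h "\<lambda>x. 1"] by simp

text \<open>Over a compact interval and with the gauge integral, differentiation under the integral
  and the fundamental theorem of calculus are available.\<close>

lemma ft_eq_integral:
  assumes "test1 h" "\<And>x. R < \<bar>x\<bar> \<Longrightarrow> h x = 0"
  shows "ft h y = integral (cbox (-R) R) (\<lambda>x. h x * exp (- 2 * pi * \<i> * of_real (x * y)))"
proof -
  have "ft h y = integral UNIV (\<lambda>x. h x * exp (- 2 * pi * \<i> * of_real (x * y)))"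
    unfolding ft_def
    by (intro integral_lborel[symmetric] test1_integrable_mult assms continuous_intros)
  also have "\<dots> = integral (cbox (-R) R) (\<lambda>x. h x * exp (- 2 * pi * \<i> * of_real (x * y)))"
  proof (intro integral_spike_set)
    have "h x = 0" if "x \<notin> cbox (-R) R" for x
      using that by (intro assms(2)) auto
    then have "{x \<in> UNIV - cbox (- R) R. h x * exp (- 2 * pi * \<i> * of_real (x * y)) \<noteq> 0} = {}"
      by auto
    then show "negligible {x \<in> UNIV - cbox (- R) R. h x * exp (- 2 * pi * \<i> * of_real (x * y)) \<noteq> 0}"
      by (simp only: negligible_empty)
  qed auto
  finally show ?thesis .
qed

text \<open>The factor that differentiating \<open>ft h\<close> brings under the integral. As
  \<open>mul1\<close> preserves test functions, all derivatives of \<open>ft h\<close> are again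
  transforms of test functions.\<close>

definition mul1 :: "(real \<Rightarrow> complex) \<Rightarrow> real \<Rightarrow> complex" where
  "mul1 h x = (- 2 * pi * \<i> * of_real x) * h x"

lemma test1_mul1: "test1 h \<Longrightarrow> test1 (mul1 h)"
  unfolding mul1_def by (intro test1_mult smooth1_intros)

lemma ft_has_derivative:
  assumes "test1 h"
  shows "(ft h has_vector_derivative ft (mul1 h) y) (at y)"
proof -
  obtain R where R: "R > 0" "\<And>x. R < \<bar>x\<bar> \<Longrightarrow> h x = 0"
    using assms by (auto simp: test1_def)
  have R': "\<And>x. R < \<bar>x\<bar> \<Longrightarrow> mul1 h x = 0" using R by (simp add: mul1_def)
  let ?f = "\<lambda>y x. h x * exp (- 2 * pi * \<i> * of_real (x * y))"
  let ?fx = "\<lambda>y x. mul1 h x * exp (- 2 * pi * \<i> * of_real (x * y))"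
  note cont = smooth1_continuous[OF test1_smooth1[OF assms]]
     smooth1_continuous[OF test1_smooth1[OF test1_mul1[OF assms]]]
  have "((\<lambda>y. integral (cbox (-R) R) (?f y)) has_vector_derivative integral (cbox (-R) R) (?fx y)) (at y within UNIV)"
  proof (rule leibniz_rule_vector_derivative)
    fix y x :: real
    from has_vector_derivative_mult_right[OF has_vector_derivative_exp_linear[of x y], of "h x"]
    show "((\<lambda>y. ?f y x) has_vector_derivative ?fx y x) (at y within UNIV)"
      by (simp add: mul1_def mult_ac)
  next
    fix y :: real
    show "?f y integrable_on cbox (- R) R"
      by (intro integrable_continuous continuous_intros cont)
  next
    show "continuous_on (UNIV \<times> cbox (- R) R) (\<lambda>(y, x). ?fx y x)"
      unfolding split_beta
      by (intro continuous_intros continuous_on_compose2[OF cont(2)[of UNIV]]) auto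
  qed auto
  moreover have "ft h = (\<lambda>y. integral (cbox (-R) R) (?f y))"
    using ft_eq_integral[OF assms R(2)] by auto
  moreover have "ft (mul1 h) y = integral (cbox (-R) R) (?fx y)"
    by (rule ft_eq_integral[OF test1_mul1[OF assms] R'])
  ultimately show ?thesis by simp
qed

lemma vderiv_ft: "test1 h \<Longrightarrow> vderiv (ft h) = ft (mul1 h)"
  by (intro vderiv_eqI ft_has_derivative)

lemma pow_vderiv_ft: "test1 h \<Longrightarrow> \<exists>g. test1 g \<and> (vderiv ^^ j) (ft h) = ft g"
proof (induction j)
  case (Suc j)
  then obtain g where "test1 g" "(vderiv ^^ j) (ft h) = ft g" by blast
  then show ?case
    by (auto intro!: exI[of _ "mul1 g"] simp: test1_mul1 vderiv_ft)
qed auto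

lemma smooth1_ft: "test1 h \<Longrightarrow> smooth1 (ft h)"
proof -
  have "\<forall>h. test1 h \<longrightarrow> Ck n (ft h)" for n
  proof (induction n)
    case (Suc n)
    show ?case
    proof (intro allI impI)
      fix h assume h: "test1 h"
      then show "Ck (Suc n) (ft h)"
        unfolding Ck.simps using Suc test1_mul1[OF h] ft_has_derivative[OF h] by blast
    qed
  qed simp
  then show "test1 h \<Longrightarrow> smooth1 (ft h)" by (simp add: smooth1_def)
qed

lemma ft_vderiv:
  assumes "test1 h"
  shows "ft (vderiv h) y = 2 * pi * \<i> * of_real y * ft h y"
proof -
  obtain R where R: "R > 0" "\<And>x. R < \<bar>x\<bar> \<Longrightarrow> h x = 0"
    using assms by (auto simp: test1_def)
  obtain R1 where R1: "R1 > 0" "\<And>x. R1 < \<bar>x\<bar> \<Longrightarrow> vderiv h x = 0"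
    using test1_vderiv[OF assms] by (auto simp: test1_def)
  define S where "S = max R R1 + 1"
  have S: "R < S" "R1 < S" "S > 0" using R R1 by (auto simp: S_def)
  let ?e = "\<lambda>x. exp (- 2 * pi * \<i> * of_real (x * y))"
  have "((\<lambda>x. h x * (?e x * (- 2 * pi * \<i> * of_real y)) + vderiv h x * ?e x)
          has_integral (h S * ?e S - h (-S) * ?e (-S))) {-S..S}"
  proof (rule fundamental_theorem_of_calculus)
    fix x :: real
    show "((\<lambda>x. h x * ?e x) has_vector_derivative
        h x * (?e x * (- 2 * pi * \<i> * of_real y)) + vderiv h x * ?e x) (at x within {-S..S})"
      using has_vector_derivative_mult[OF smooth1_vderiv(1)[OF test1_smooth1[OF assms]] has_vector_derivative_exp_linear]
      by (rule has_vector_derivative_at_within)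
  qed (use S in auto)
  then have 0: "integral {-S..S} (\<lambda>x. h x * (?e x * (- 2 * pi * \<i> * of_real y)) + vderiv h x * ?e x) = 0"
    using R S by (simp add: integral_unique)
  note cont = smooth1_continuous[OF test1_smooth1[OF assms]]
     smooth1_continuous[OF test1_smooth1[OF test1_vderiv[OF assms]]]
  have "integral {-S..S} (\<lambda>x. (- 2 * pi * \<i> * of_real y) * (h x * ?e x) + vderiv h x * ?e x) =
     integral {-S..S} (\<lambda>x. (- 2 * pi * \<i> * of_real y) * (h x * ?e x)) + integral {-S..S} (\<lambda>x. vderiv h x * ?e x)"
    by (intro Henstock_Kurzweil_Integration.integral_add integrable_continuous_interval continuous_intros cont)
  also have "\<dots> = (- 2 * pi * \<i> * of_real y) * integral {-S..S} (\<lambda>x. h x * ?e x) + integral {-S..S} (\<lambda>x. vderiv h x * ?e x)"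
    by simp
  also have "integral {-S..S} (\<lambda>x. h x * ?e x) = ft h y"
    using ft_eq_integral[OF assms, of S y] S R by auto
  also have "integral {-S..S} (\<lambda>x. vderiv h x * ?e x) = ft (vderiv h) y"
    using ft_eq_integral[OF test1_vderiv[OF assms], of S y] S R1 by auto
  finally show ?thesis using 0 by (simp add: mult_ac)
qed

text \<open>Integration by parts trades one power of |t| for one derivative of \<open>h\<close>;
  hence the induction with \<open>h\<close> arbitrary.\<close>

lemma ft_decay: "test1 h \<Longrightarrow> \<exists>C. \<forall>t. (1 + \<bar>t\<bar>) ^ k * norm (ft h t) \<le> C"
proof (induction k arbitrary: h)
  case 0
  have "norm (ft h t) \<le> (LINT x|lborel. norm (h x))" for t
    unfolding ft_def by (rule order_trans[OF integral_norm_bound]) (simp add: norm_mult)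
  then show ?case by auto
next
  case (Suc k)
  obtain C where C: "\<And>t. (1 + \<bar>t\<bar>) ^ k * norm (ft h t) \<le> C"
    using Suc by blast
  obtain C' where C': "\<And>t. (1 + \<bar>t\<bar>) ^ k * norm (ft (vderiv h) t) \<le> C'"
    using Suc.IH[OF test1_vderiv[OF Suc.prems]] by blast
  have "(1 + \<bar>t\<bar>) ^ Suc k * norm (ft h t) \<le> C + C'" for t
  proof -
    have "\<bar>t\<bar> * norm (ft h t) \<le> norm (ft (vderiv h) t)"
    proof -
      have "1 * (\<bar>t\<bar> * norm (ft h t)) \<le> (2 * pi) * (\<bar>t\<bar> * norm (ft h t))"
        using pi_ge_two by (intro mult_right_mono) auto
      then show ?thesis by (simp add: ft_vderiv[OF Suc.prems] norm_mult mult.assoc)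
    qed
    then have "(1 + \<bar>t\<bar>) ^ k * (\<bar>t\<bar> * norm (ft h t)) \<le> (1 + \<bar>t\<bar>) ^ k * norm (ft (vderiv h) t)"
      by (intro mult_left_mono) auto
    then have "(1 + \<bar>t\<bar>) ^ k * norm (ft h t) + (1 + \<bar>t\<bar>) ^ k * (\<bar>t\<bar> * norm (ft h t)) \<le> C + C'"
      using C[of t] C'[of t] by linarith
    then show ?thesis by (simp add: algebra_simps)
  qed
  then show ?case by blast
qed

lemma schwartz1_ft: "test1 h \<Longrightarrow> schwartz1 (ft h)"
  unfolding schwartz1_def using smooth1_ft pow_vderiv_ft ft_decay by metis

lemma ft_translate: "ft (\<lambda>t. h (t - a)) s = exp (- 2 * pi * \<i> * of_real (a * s)) * ft h s"
proof -
  have "ft (\<lambda>t. h (t - a)) s = (LINT x|lborel. h x * exp (- 2 * pi * \<i> * of_real ((a + x) * s)))"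
    unfolding ft_def
    using lborel_integral_real_affine[of 1 "\<lambda>x. h (x - a) * exp (- 2 * pi * \<i> * of_real (x * s))" a]
    by simp
  also have "\<dots> = (LINT x|lborel. exp (- 2 * pi * \<i> * of_real (a * s)) * (h x * exp (- 2 * pi * \<i> * of_real (x * s))))"
    by (intro Bochner_Integration.integral_cong) (auto simp: exp_add[symmetric] algebra_simps)
  also have "\<dots> = exp (- 2 * pi * \<i> * of_real (a * s)) * ft h s"
    by (simp add: ft_def)
  finally show ?thesis .
qed

text \<open>The modulation moves the frequency \<open>s\<close> to 0, where the transform is the
  integral of a bump that is positive on an interval.\<close>

lemma ft_modulated_bump_nonzero:
  "ft (\<lambda>t. exp (\<i> * of_real (2 * pi * s * t)) * of_real (bump 1 (-e) e t)) s \<noteq> 0" if "e > 0"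
proof -
  have int: "integrable lborel (bump 1 (-e) e)"
  proof -
    have "integrable lborel (\<lambda>t. complex_of_real (bump 1 (-e) e t))"
      by (intro test1_integrable test1_bump) simp
    then show ?thesis using integrable_Re by fastforce
  qed
  have "ft (\<lambda>t. exp (\<i> * of_real (2 * pi * s * t)) * of_real (bump 1 (-e) e t)) s
     = (LINT x|lborel. of_real (bump 1 (-e) e x))"
    unfolding ft_def
  proof (intro Bochner_Integration.integral_cong refl)
    fix x :: real
    have 1: "exp (\<i> * complex_of_real (2 * pi * s * x)) * exp (- 2 * pi * \<i> * of_real (x * s)) = 1"
      by (simp add: exp_add[symmetric])
    have comm: "a * b * c = a * c * b" for a b c :: complex by simp
    show "exp (\<i> * complex_of_real (2 * pi * s * x)) * complex_of_real (bump 1 (- e) e x) *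
         exp (complex_of_real (- 2 * pi) * \<i> * complex_of_real (x * s)) = complex_of_real (bump 1 (- e) e x)"
      by (subst comm) (simp only: 1 mult_1_left)
  qed
  also have "\<dots> = of_real (LINT x|lborel. bump 1 (-e) e x)" by simp
  also have "\<dots> \<noteq> 0"
  proof
    assume "complex_of_real (LINT x|lborel. bump 1 (-e) e x) = 0"
    then have "AE x in lborel. bump 1 (-e) e x = 0"
      using integral_nonneg_eq_0_iff_AE[OF int] by (simp add: bump_bounds)
    then have "AE x in lborel. x \<notin> {-e<..<e}"
      by eventually_elim (use bump_pos[of 1 "-e" _ e] in force)
    then have "emeasure lborel {-e<..<e} = 0"
      by (subst (asm) AE_iff_measurable[of "{-e<..<e}"]) auto
    then show False using that by simp
  qed
  finally show ?thesis .
qed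

section \<open>Tensor products\<close>

definition tensor :: "('d \<Rightarrow> real \<Rightarrow> complex) \<Rightarrow> real^'d \<Rightarrow> complex" where
  "tensor H x = (\<Prod>i\<in>UNIV. H i (x $ i))"

lemma tensor_has_partial:
  fixes H :: "'d::finite \<Rightarrow> real \<Rightarrow> complex"
  assumes "\<And>i. smooth1 (H i)"
  shows "((\<lambda>t. tensor H (x + t *\<^sub>R axis i 1)) has_vector_derivative tensor (H(i := vderiv (H i))) x) (at 0)"
proof -
  have 1: "tensor K y = K i (y $ i) * (\<Prod>j\<in>UNIV - {i}. K j (y $ j))" for K :: "'d \<Rightarrow> real \<Rightarrow> complex" and y
    unfolding tensor_def by (rule prod.remove) auto
  have "((\<lambda>t. H i (1 * t + x $ i)) has_vector_derivative of_real 1 * vderiv (H i) (x $ i)) (at 0)"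
    using smooth1_vderiv(1)[OF smooth1_intros(4)[OF assms, of i 1 "x $ i"], of 0]
    by (simp only: vderiv_scale[OF assms]) simp
  then have "((\<lambda>t. H i (t + x $ i)) has_vector_derivative vderiv (H i) (x $ i)) (at 0)"
    by simp
  from has_vector_derivative_mult_left[OF this, of "\<Prod>j\<in>UNIV - {i}. H j (x $ j)"]
  show ?thesis
    by (simp add: 1 axis_def add.commute if_distrib cong: if_cong)
qed

lemma partial_deriv_tensor:
  "(\<And>i. smooth1 (H i)) \<Longrightarrow> partial_deriv i (tensor H) = tensor (H(i := vderiv (H i)))"
  unfolding partial_deriv_def fun_eq_iff
  by (auto intro!: vector_derivative_at tensor_has_partial)

lemma iter_partial_tensor:
  assumes "\<And>i. smooth1 (H i)"
  shows "iter_partial is (tensor H) = tensor (\<lambda>i. (vderiv ^^ count_list is i) (H i))"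
proof (induction "is")
  case (Cons a "is")
  have "iter_partial (a # is) (tensor H) = partial_deriv a (tensor (\<lambda>i. (vderiv ^^ count_list is i) (H i)))"
    using Cons by simp
  also have "\<dots> = tensor ((\<lambda>i. (vderiv ^^ count_list is i) (H i))(a := vderiv ((vderiv ^^ count_list is a) (H a))))"
    by (rule partial_deriv_tensor) (auto intro: smooth1_pow_vderiv assms)
  also have "((\<lambda>i. (vderiv ^^ count_list is i) (H i))(a := vderiv ((vderiv ^^ count_list is a) (H a)))) =
      (\<lambda>i. (vderiv ^^ count_list (a # is) i) (H i))"
    by auto
  finally show ?case .
qed simp

text \<open>A difference of tensors need not be a tensor, but the Schwartz distance between a tensor
  and its cut-off is a seminorm of such a difference.\<close>

lemma iter_partial_tensor_diff:
  assumes "\<And>i. smooth1 (H i)" "\<And>i. smooth1 (K i)"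
  shows "iter_partial is (\<lambda>x. tensor H x - tensor K x) =
    (\<lambda>x. iter_partial is (tensor H) x - iter_partial is (tensor K) x)"
proof (induction "is")
  case (Cons a "is")
  have "iter_partial (a # is) (\<lambda>x. tensor H x - tensor K x) =
     partial_deriv a (\<lambda>x. iter_partial is (tensor H) x - iter_partial is (tensor K) x)"
    by (simp add: Cons)
  also have "\<dots> = (\<lambda>x. partial_deriv a (iter_partial is (tensor H)) x - partial_deriv a (iter_partial is (tensor K)) x)"
    unfolding iter_partial_tensor[OF assms(1)] iter_partial_tensor[OF assms(2)] fun_eq_iff partial_deriv_def
    using assms
    by (auto intro!: vector_derivative_at vector_derivative_diff_at
        has_vector_derivative_diff vector_derivative_works[THEN iffD1]
        differentiableI_vector[OF tensor_has_partial] smooth1_pow_vderiv)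
  finally show ?case by simp
qed simp

lemma differentiable_tensor:
  fixes H :: "'d::finite \<Rightarrow> real \<Rightarrow> complex"
  assumes "\<And>i. smooth1 (H i)"
  shows "tensor H differentiable (at x)"
proof -
  have "((\<lambda>x. H i (x $ i)) has_derivative (\<lambda>h. (h $ i) *\<^sub>R vderiv (H i) (x $ i))) (at x)" for i
  proof -
    have "((\<lambda>x. x $ i) has_derivative (\<lambda>h. h $ i)) (at x)"
      by (rule bounded_linear_imp_has_derivative[OF bounded_linear_vec_nth])
    moreover have "(H i has_derivative (\<lambda>h. h *\<^sub>R vderiv (H i) (x $ i))) (at (x $ i))"
      using smooth1_vderiv(1)[OF assms] by (simp add: has_vector_derivative_def)
    ultimately show ?thesis
      using diff_chain_at by (fastforce simp: o_def)
  qed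
  then have "((\<lambda>x. \<Prod>i\<in>UNIV. H i (x $ i)) has_derivative
     (\<lambda>y. \<Sum>i\<in>UNIV. ((y $ i) *\<^sub>R vderiv (H i) (x $ i)) * (\<Prod>j\<in>UNIV - {i}. H j (x $ j)))) (at x)"
    by (rule has_derivative_prod)
  then show ?thesis
    unfolding tensor_def[abs_def] differentiable_def by blast
qed

lemma smooth_tensor: "(\<And>i. smooth1 (H i)) \<Longrightarrow> smooth (tensor H)"
  unfolding smooth_def by (auto simp: iter_partial_tensor intro!: differentiable_tensor smooth1_pow_vderiv)

lemma ex_count_list: "\<exists>is. \<forall>i. count_list is i = (j :: 'd::finite \<Rightarrow> nat) i"
proof -
  have "finite S \<Longrightarrow> \<exists>is. \<forall>i. count_list is i = (if i \<in> S then j i else 0)" for S :: "'d set"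
  proof (induction rule: finite_induct)
    case (insert a S)
    then obtain "is" where "\<forall>i. count_list is i = (if i \<in> S then j i else 0)" by blast
    moreover have "count_list (replicate n a) i = (if i = a then n else 0)" for n i
      by (induction n) auto
    ultimately show ?case using insert
      by (auto intro!: exI[of _ "replicate (j a) a @ is"])
  qed (auto intro: exI[of _ "[]"])
  from this[of UNIV] show ?thesis by simp
qed

text \<open>The list chosen inside \<open>deriv_multi\<close> depends on \<open>j\<close> alone, so
  one list serves all functions at once.\<close>

lemma deriv_multi_eq:
  fixes j :: "'d::finite \<Rightarrow> nat"
  shows "\<exists>is. (\<forall>i. count_list is i = j i) \<and> (\<forall>f. deriv_multi j f = iter_partial is f)"
  using someI_ex[OF ex_count_list[of j]] unfolding deriv_multi_def by blast

lemma deriv_multi_tensor: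
  assumes "\<And>i. smooth1 (H i)"
  shows "deriv_multi j (tensor H) = tensor (\<lambda>i. (vderiv ^^ j i) (H i))"
proof -
  obtain "is" where "\<forall>i. count_list is i = j i" "\<forall>f. deriv_multi j f = iter_partial is f"
    using deriv_multi_eq by blast
  then show ?thesis by (simp add: iter_partial_tensor assms)
qed

lemma deriv_multi_tensor_diff:
  assumes "\<And>i. smooth1 (H i)" "\<And>i. smooth1 (K i)"
  shows "deriv_multi j (\<lambda>x. tensor H x - tensor K x) =
    (\<lambda>x. tensor (\<lambda>i. (vderiv ^^ j i) (H i)) x - tensor (\<lambda>i. (vderiv ^^ j i) (K i)) x)"
proof -
  obtain "is" where "\<forall>i. count_list is i = j i" "\<forall>f. deriv_multi j f = iter_partial is f"
    using deriv_multi_eq by blast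
  then show ?thesis by (simp add: iter_partial_tensor_diff iter_partial_tensor assms)
qed

lemma deriv_multi_0: "deriv_multi (\<lambda>i::'d::finite. 0) f = f"
proof -
  obtain "is" :: "'d list" where "\<forall>i. count_list is i = 0" "\<forall>f. deriv_multi (\<lambda>i. 0) f = iter_partial is f"
    using deriv_multi_eq[of "\<lambda>i. 0"] by auto
  moreover from this(1) have "is = []" by (cases "is") (auto split: if_splits)
  ultimately show ?thesis by simp
qed

text \<open>The expanded product contains the l1 norm, and its other terms are nonnegative. This
  distributes a weight in the norm over the coordinates.\<close>

lemma norm_le_prod: "norm (x :: real^'d) \<le> (\<Prod>i\<in>UNIV. 1 + \<bar>x $ i\<bar>)"
proof -
  have "finite S \<Longrightarrow> 1 + (\<Sum>i\<in>S. \<bar>x $ i\<bar>) \<le> (\<Prod>i\<in>S. 1 + \<bar>x $ i\<bar>)" for S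
  proof (induction rule: finite_induct)
    case (insert a S)
    have "1 + (\<Sum>i\<in>insert a S. \<bar>x $ i\<bar>) \<le> (1 + \<bar>x $ a\<bar>) * (1 + (\<Sum>i\<in>S. \<bar>x $ i\<bar>))"
      using insert by (simp add: algebra_simps sum_nonneg)
    also have "\<dots> \<le> (1 + \<bar>x $ a\<bar>) * (\<Prod>i\<in>S. 1 + \<bar>x $ i\<bar>)"
      by (intro mult_left_mono insert.IH) auto
    finally show ?case using insert by simp
  qed simp
  from this[of UNIV] norm_le_l1_cart[of x] show ?thesis by simp
qed

lemma norm_pow_le_prod: "norm (x :: real^'d) ^ k \<le> (\<Prod>i\<in>UNIV. (1 + \<bar>x $ i\<bar>) ^ k)"
  using power_mono[OF norm_le_prod norm_ge_zero, of x k] by (simp add: prod_power_distrib)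

lemma schwartz_tensor:
  fixes H :: "'d::finite \<Rightarrow> real \<Rightarrow> complex"
  assumes "\<And>i. schwartz1 (H i)"
  shows "tensor H \<in> schwartz"
  unfolding schwartz_def
proof (safe)
  note sm = schwartz1_smooth1[OF assms]
  show "smooth (tensor H)" by (rule smooth_tensor[OF sm])
  fix k :: nat and j :: "'d \<Rightarrow> nat"
  have "\<exists>C. \<forall>t. (1 + \<bar>t\<bar>) ^ k * norm ((vderiv ^^ j i) (H i) t) \<le> C" for i
    using assms[of i] by (simp add: schwartz1_def)
  then obtain C where C: "\<And>i t. (1 + \<bar>t\<bar>) ^ k * norm ((vderiv ^^ j i) (H i) t) \<le> C i"
    by metis
  have "norm x ^ k * norm (deriv_multi j (tensor H) x) \<le> (\<Prod>i\<in>UNIV. C i)" for x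
  proof -
    have "norm x ^ k * norm (deriv_multi j (tensor H) x) \<le>
        (\<Prod>i\<in>UNIV. (1 + \<bar>x $ i\<bar>) ^ k) * norm (deriv_multi j (tensor H) x)"
      by (intro mult_right_mono norm_pow_le_prod) auto
    also have "\<dots> = (\<Prod>i\<in>UNIV. (1 + \<bar>x $ i\<bar>) ^ k * norm ((vderiv ^^ j i) (H i) (x $ i)))"
      by (simp add: deriv_multi_tensor sm tensor_def prod.distrib prod_norm)
    also have "\<dots> \<le> (\<Prod>i\<in>UNIV. C i)"
      by (intro prod_mono) (auto intro: C)
    finally show ?thesis .
  qed
  then show "bounded (range (\<lambda>x. norm x ^ k * norm (deriv_multi j (tensor H) x)))"
    by (intro boundedI[where B = "\<Prod>i\<in>UNIV. C i"]) (auto simp: abs_mult)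
qed

lemma test_functions_tensor:
  fixes H :: "'d::finite \<Rightarrow> real \<Rightarrow> complex"
  assumes "\<And>i. test1 (H i)"
  shows "tensor H \<in> test_functions"
proof -
  have "\<exists>R>0. \<forall>t. R < \<bar>t\<bar> \<longrightarrow> H i t = 0" for i
    using assms[of i] by (simp add: test1_def)
  then obtain R where R: "\<And>i. R i > 0" "\<And>i t. R i < \<bar>t\<bar> \<Longrightarrow> H i t = 0" by metis
  have "{x. tensor H x \<noteq> 0} \<subseteq> cbox (\<chi> i. - R i) (\<chi> i. R i)"
  proof
    fix x assume "x \<in> {x. tensor H x \<noteq> 0}"
    then have "\<bar>x $ i\<bar> \<le> R i" for i
      using R(2)[of i "x $ i"] by (force simp: tensor_def)
    then show "x \<in> cbox (\<chi> i. - R i) (\<chi> i. R i)"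
      by (auto simp: mem_box_cart abs_le_iff) (smt (verit))
  qed
  then have "compact (closure {x. tensor H x \<noteq> 0})"
    using bounded_cbox bounded_subset compact_closure by blast
  then show ?thesis
    by (auto simp: test_functions_def intro!: smooth_tensor test1_smooth1 assms)
qed

lemma continuous_tensor: "(\<And>i. smooth1 (H i)) \<Longrightarrow> continuous_on S (tensor H)"
  by (meson continuous_at_imp_continuous_on differentiable_imp_continuous_within differentiable_tensor)

lemma norm_tensor_diff_le:
  fixes F H :: "'d::finite \<Rightarrow> real \<Rightarrow> complex" and C \<epsilon> :: real
  assumes F: "\<And>i t. (1 + \<bar>t\<bar>) ^ k * norm (F i t) \<le> C"
    and H: "\<And>i t. (1 + \<bar>t\<bar>) ^ k * norm (H i t) \<le> C"
    and D: "\<And>i t. (1 + \<bar>t\<bar>) ^ k * norm (F i t - H i t) \<le> \<epsilon>"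
    and C: "C \<ge> 1"
  shows "norm x ^ k * norm (tensor F x - tensor H x) \<le> C ^ CARD('d) * (CARD('d) * \<epsilon>)"
proof -
  \<comment> \<open>The division by \<open>C\<close> brings all weighted factors into the unit disc,
    where a difference of two products is at most the sum of the differences of the factors.\<close>
  define w :: "'d \<Rightarrow> complex" where "w i = of_real ((1 + \<bar>x $ i\<bar>) ^ k / C)" for i
  have w: "norm (w i) = (1 + \<bar>x $ i\<bar>) ^ k / C" for i
    using C by (simp add: w_def norm_divide norm_power del: of_real_divide of_real_power of_real_add)
  have "norm ((\<Prod>i\<in>UNIV. w i * F i (x $ i)) - (\<Prod>i\<in>UNIV. w i * H i (x $ i)))
     \<le> (\<Sum>i\<in>UNIV. norm (w i * F i (x $ i) - w i * H i (x $ i)))"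
    by (intro norm_prod_diff) (use F H C in \<open>auto simp: norm_mult w divide_le_eq\<close>)
  also have "\<dots> \<le> (\<Sum>i\<in>(UNIV::'d set). \<epsilon>)"
  proof (rule sum_mono)
    fix i
    have "norm (w i * F i (x $ i) - w i * H i (x $ i)) = ((1 + \<bar>x $ i\<bar>) ^ k * norm (F i (x $ i) - H i (x $ i))) / C"
      by (simp add: right_diff_distrib[symmetric] norm_mult w)
    also have "\<dots> \<le> \<epsilon> / 1"
    proof -
      have "0 \<le> (1 + \<bar>x $ i\<bar>) ^ k * norm (F i (x $ i) - H i (x $ i))" by simp
      then have "0 \<le> \<epsilon>" using D[of "x $ i" i] by linarith
      then show ?thesis using D C by (intro frac_le) auto
    qed
    finally show "norm (w i * F i (x $ i) - w i * H i (x $ i)) \<le> \<epsilon>" by simp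
  qed
  finally have 1: "norm ((\<Prod>i\<in>UNIV. w i * F i (x $ i)) - (\<Prod>i\<in>UNIV. w i * H i (x $ i))) \<le> CARD('d) * \<epsilon>"
    by simp
  have "norm x ^ k * norm (tensor F x - tensor H x) \<le>
        (\<Prod>i\<in>UNIV. (1 + \<bar>x $ i\<bar>) ^ k) * norm (tensor F x - tensor H x)"
    by (intro mult_right_mono norm_pow_le_prod) auto
  also have "(\<Prod>i\<in>UNIV. (1 + \<bar>x $ i\<bar>) ^ k) = C ^ CARD('d) * norm (\<Prod>i\<in>UNIV. w i)"
    using C by (simp add: prod_norm[symmetric] w prod_dividef)
  also have "C ^ CARD('d) * norm (\<Prod>i\<in>UNIV. w i) * norm (tensor F x - tensor H x)
     = C ^ CARD('d) * norm ((\<Prod>i\<in>UNIV. w i * F i (x $ i)) - (\<Prod>i\<in>UNIV. w i * H i (x $ i)))"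
    by (simp add: tensor_def prod.distrib norm_mult[symmetric] right_diff_distrib[symmetric])
  also have "\<dots> \<le> C ^ CARD('d) * (CARD('d) * \<epsilon>)"
    using 1 C by (intro mult_left_mono) auto
  finally show ?thesis .
qed

text \<open>Merges the constants of the finitely many one-variable factors;
  \<open>norm_tensor_diff_le\<close> wants a constant that is at least 1.\<close>

lemma uniform_bound:
  fixes P :: "'d::finite \<Rightarrow> real \<Rightarrow> bool"
  assumes "\<And>i. \<exists>C. P i C" "\<And>i C D. P i C \<Longrightarrow> C \<le> D \<Longrightarrow> P i D"
  obtains C where "C \<ge> 1" "\<And>i. P i C"
proof -
  obtain c where "\<And>i. P i (c i)" using assms(1) by metis
  then have "P i (max 1 (Max (range c)))" for i
    by (rule assms(2)) (simp add: le_max_iff_disj)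
  then show thesis by (intro that[of "max 1 (Max (range c))"]) auto
qed

lemma seminorm_cutoff_tendsto:
  fixes H :: "'d::finite \<Rightarrow> real \<Rightarrow> complex"
  assumes "\<And>i. schwartz1 (H i)" "test1 \<theta>" "\<theta> 0 = 1" "\<epsilon> > 0"
  shows "\<forall>\<^sub>F n in sequentially. schwartz_seminorm k j
     (\<lambda>x. tensor (\<lambda>i t. H i t * \<theta> (t / real (Suc n))) x - tensor H x) < \<epsilon>"
proof -
  note sm = schwartz1_smooth1[OF assms(1)]
  have sm': "smooth1 (\<lambda>t. H i t * \<theta> (t / real (Suc n)))" for i n
    using smooth1_intros(3)[OF sm smooth1_intros(4)[OF test1_smooth1[OF assms(2)], of "1 / real (Suc n)" 0]] by simp
  let ?F = "\<lambda>n i t. H i t * \<theta> (t / real (Suc n))"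
  obtain C1 where C1: "C1 \<ge> 1" "\<And>i. \<forall>R\<ge>1. \<forall>t. (1 + \<bar>t\<bar>) ^ k * norm ((vderiv ^^ j i) (\<lambda>t. H i t * \<theta> (t / R)) t) \<le> C1"
    by (rule uniform_bound[of "\<lambda>i C. \<forall>R\<ge>1. \<forall>t. (1 + \<bar>t\<bar>) ^ k * norm ((vderiv ^^ j i) (\<lambda>t. H i t * \<theta> (t / R)) t) \<le> C"])
      (use cutoff_bound[OF assms(1,2)] in blast, meson order_trans, blast)
  obtain C2 where C2: "C2 \<ge> 1" "\<And>i. \<forall>R\<ge>1. \<forall>t. (1 + \<bar>t\<bar>) ^ k * norm ((vderiv ^^ j i) (\<lambda>t. H i t * \<theta> (t / R)) t - (vderiv ^^ j i) (H i) t) \<le> C2 / R"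
    by (rule uniform_bound[of "\<lambda>i C. \<forall>R\<ge>1. \<forall>t. (1 + \<bar>t\<bar>) ^ k * norm ((vderiv ^^ j i) (\<lambda>t. H i t * \<theta> (t / R)) t - (vderiv ^^ j i) (H i) t) \<le> C / R"])
      (use cutoff_diff[OF assms(1,2,3)] in blast,
        meson order_trans divide_right_mono zero_le_one, blast)
  obtain C3 where C3: "C3 \<ge> 1" "\<And>i. \<forall>t. (1 + \<bar>t\<bar>) ^ k * norm ((vderiv ^^ j i) (H i) t) \<le> C3"
    by (rule uniform_bound[of "\<lambda>i C. \<forall>t. (1 + \<bar>t\<bar>) ^ k * norm ((vderiv ^^ j i) (H i) t) \<le> C"])
      (use assms(1) in \<open>simp add: schwartz1_def\<close>, meson order_trans, blast)
  define C where "C = max C1 C3"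
  have le: "schwartz_seminorm k j (\<lambda>x. tensor (?F n) x - tensor H x) \<le> C ^ CARD('d) * (CARD('d) * (C2 / real (Suc n)))" for n
    unfolding schwartz_seminorm_def deriv_multi_tensor_diff[OF sm' sm]
  proof (rule cSUP_least)
    fix x :: "real^'d"
    have R: "real (Suc n) \<ge> 1" by simp
    show "norm x ^ k * norm (tensor (\<lambda>i. (vderiv ^^ j i) (?F n i)) x - tensor (\<lambda>i. (vderiv ^^ j i) (H i)) x)
       \<le> C ^ CARD('d) * (CARD('d) * (C2 / real (Suc n)))"
    proof (rule norm_tensor_diff_le)
      fix i t
      show "(1 + \<bar>t\<bar>) ^ k * norm ((vderiv ^^ j i) (?F n i) t) \<le> C"
        using C1(2)[of i, rule_format, OF R, of t] unfolding C_def by linarith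
      show "(1 + \<bar>t\<bar>) ^ k * norm ((vderiv ^^ j i) (H i) t) \<le> C"
        using C3(2)[of i, rule_format, of t] unfolding C_def by linarith
      show "(1 + \<bar>t\<bar>) ^ k * norm ((vderiv ^^ j i) (?F n i) t - (vderiv ^^ j i) (H i) t) \<le> C2 / real (Suc n)"
        by (rule C2(2)[rule_format, OF R])
    qed (use C1(1) in \<open>auto simp: C_def\<close>)
  qed simp
  have "(\<lambda>n. C ^ CARD('d) * (CARD('d) * (C2 / real (Suc n)))) \<longlonglongrightarrow> C ^ CARD('d) * (real CARD('d) * 0)"
    by (intro tendsto_intros LIMSEQ_Suc[OF lim_const_over_n])
  then have "\<forall>\<^sub>F n in sequentially. C ^ CARD('d) * (CARD('d) * (C2 / real (Suc n))) < \<epsilon>"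
    using \<open>\<epsilon> > 0\<close> by (intro order_tendstoD) auto
  then show ?thesis
    by eventually_elim (use le in \<open>auto intro: order_le_less_trans\<close>)
qed

subsection \<open>Fourier transform of tensor products\<close>

text \<open>Lebesgue measure is the image of a product measure indexed by \<open>Basis\<close>, to
  which Fubini applies; \<open>axis_index\<close> translates basis vectors into coordinates.\<close>

lemma integral_tensor:
  fixes g :: "'d::finite \<Rightarrow> real \<Rightarrow> complex"
  assumes "\<And>i. integrable lborel (g i)"
  shows "(LINT x|lborel. (\<Prod>i\<in>UNIV. g i (x $ i))) = (\<Prod>i\<in>UNIV. (LINT t|lborel. g i t))"
proof -
  have B: "(Basis :: (real^'d) set) = range (\<lambda>i. axis i 1)"
    by (auto simp: Basis_vec_def)
  have inj: "inj (\<lambda>i::'d. axis i (1::real))"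
    by (auto simp: inj_def axis_eq_axis)
  let ?S = "\<lambda>f. \<Sum>b\<in>(Basis :: (real^'d) set). f b *\<^sub>R b"
  interpret product_sigma_finite "\<lambda>b::real^'d. lborel" ..
  have meas: "(\<lambda>x::real^'d. \<Prod>i\<in>UNIV. g i (x $ i)) \<in> borel_measurable borel"
    using assms by (intro borel_measurable_prod measurable_compose[OF _ borel_measurable_integrable[OF assms, unfolded measurable_lborel1]]) auto
  have "(LINT x|lborel. (\<Prod>i\<in>UNIV. g i (x $ i))) =
      (LINT f|(\<Pi>\<^sub>M b\<in>(Basis :: (real^'d) set). lborel). (\<Prod>i\<in>UNIV. g i (?S f $ i)))"
    by (subst lborel_eq, rule integral_distr) (use meas in auto)
  also have "\<dots> = (LINT f|(\<Pi>\<^sub>M b\<in>(Basis :: (real^'d) set). lborel). (\<Prod>b\<in>Basis. g (axis_index b) (f b)))"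
  proof (intro Bochner_Integration.integral_cong refl)
    fix f :: "real^'d \<Rightarrow> real"
    have "?S f $ i = f (axis i 1)" for i
    proof -
      have "?S f \<bullet> axis i 1 = f (axis i 1)"
        by (rule inner_sum_left_Basis) (auto simp: B)
      then show ?thesis by (simp add: inner_axis)
    qed
    then show "(\<Prod>i\<in>UNIV. g i (?S f $ i)) = (\<Prod>b\<in>Basis. g (axis_index b) (f b))"
      unfolding B by (subst prod.reindex[OF inj]) simp
  qed
  also have "\<dots> = (\<Prod>b\<in>(Basis :: (real^'d) set). (LINT t|lborel. g (axis_index b) t))"
    by (rule product_integral_prod) (auto intro: assms)
  also have "\<dots> = (\<Prod>i\<in>UNIV. (LINT t|lborel. g i t))"
    unfolding B by (subst prod.reindex[OF inj]) simp
  finally show ?thesis .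
qed

lemma fourier_tensor:
  fixes H :: "'d::finite \<Rightarrow> real \<Rightarrow> complex"
  assumes "\<And>i. test1 (H i)"
  shows "fourier (tensor H) = tensor (\<lambda>i. ft (H i))"
proof
  fix y :: "real^'d"
  have "fourier (tensor H) y = (LINT x|lborel. (\<Prod>i\<in>UNIV. H i (x $ i) * exp (- 2 * pi * \<i> * of_real (x $ i * y $ i))))"
    unfolding fourier_def tensor_def
    by (intro Bochner_Integration.integral_cong refl)
      (simp add: prod.distrib exp_sum[symmetric] inner_vec_def sum_distrib_left)
  also have "\<dots> = (\<Prod>i\<in>UNIV. (LINT t|lborel. H i t * exp (- 2 * pi * \<i> * of_real (t * y $ i))))"
    by (rule integral_tensor[of "\<lambda>i t. H i t * exp (- 2 * pi * \<i> * of_real (t * y $ i))"])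
      (intro test1_integrable_mult assms continuous_intros)
  finally show "fourier (tensor H) y = tensor (\<lambda>i. ft (H i)) y"
    by (simp add: tensor_def ft_def)
qed

section \<open>Translates of tensor products\<close>

definition shift :: "real^'d \<Rightarrow> ('d \<Rightarrow> real \<Rightarrow> complex) \<Rightarrow> 'd \<Rightarrow> real \<Rightarrow> complex" where
  "shift y H i t = H i (t - y $ i)"

lemma tensor_shift: "tensor (shift y H) u = tensor H (u - y)"
  by (simp add: tensor_def shift_def)

lemma test1_shift: "test1 (H i) \<Longrightarrow> test1 (shift y H i)"
  using test1_affine[of "H i" 1 "- y $ i"] by (simp add: shift_def[abs_def])

lemma pow_vderiv_shift:
  assumes "smooth1 (H i)" shows "(vderiv ^^ n) (shift y H i) = shift y (\<lambda>i. (vderiv ^^ n) (H i)) i"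
  using pow_vderiv_scale[OF assms, of n 1 "- y $ i"] by (simp add: shift_def[abs_def])

lemma deriv_multi_tensor_shift:
  assumes "\<And>i. test1 (H i)"
  shows "deriv_multi j (tensor (shift y H)) u = tensor (\<lambda>i. (vderiv ^^ j i) (H i)) (u - y)"
  using assms
  by (subst deriv_multi_tensor) (auto simp: pow_vderiv_shift test1_smooth1 test1_shift tensor_def shift_def)

lemma fourier_tensor_shift:
  fixes H :: "'d::finite \<Rightarrow> real \<Rightarrow> complex"
  assumes "\<And>i. test1 (H i)"
  shows "fourier (tensor (shift y H)) s = exp (- 2 * pi * \<i> * (y \<bullet> s)) * fourier (tensor H) s"
proof -
  have "ft (shift y H i) (s $ i) = exp (- 2 * pi * \<i> * of_real (y $ i * s $ i)) * ft (H i) (s $ i)" for i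
    unfolding shift_def[abs_def] by (rule ft_translate)
  then have "fourier (tensor (shift y H)) s = (\<Prod>i\<in>UNIV. exp (- 2 * pi * \<i> * of_real (y $ i * s $ i)) * ft (H i) (s $ i))"
    using fourier_tensor[of "shift y H", OF test1_shift, OF assms] by (simp add: tensor_def)
  then show ?thesis
    by (simp add: prod.distrib exp_sum[symmetric] inner_vec_def sum_distrib_left fourier_tensor assms tensor_def)
qed

section \<open>Radon measures and their integrals\<close>

lemma has_sum_nat_imp_sums:
  fixes f :: "nat \<Rightarrow> 'a::{comm_monoid_add, topological_space}"
  assumes "(f has_sum S) UNIV" shows "f sums S"
  using assms filterlim_compose[OF _ filterlim_lessThan_at_top, of "sum f"]
  by (simp add: has_sum_def sums_def)

lemma has_sum_minus:
  fixes f g :: "'b \<Rightarrow> complex"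
  assumes "(f has_sum a) A" "(g has_sum b) A"
  shows "((\<lambda>x. f x - g x) has_sum (a - b)) A"
  using has_sum_add[OF assms(1) has_sum_cmult_right[OF assms(2), of "-1"]] by simp

section \<open>Real set functions and their upper variation\<close>

definition sigma_additive :: "('a::euclidean_space set \<Rightarrow> real) \<Rightarrow> bool" where
  "sigma_additive \<kappa> \<longleftrightarrow> (\<forall>A :: nat \<Rightarrow> 'a set.
     range A \<subseteq> bounded_borel \<longrightarrow> disjoint_family A \<longrightarrow> bounded (\<Union>i. A i) \<longrightarrow>
     (\<lambda>i. \<kappa> (A i)) sums \<kappa> (\<Union>i. A i))"

lemma sigma_additive_radon:
  assumes "radon \<rho>"
  shows "sigma_additive (\<lambda>B. Re (\<rho> B))" "sigma_additive (\<lambda>B. - Re (\<rho> B))"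
    "sigma_additive (\<lambda>B. Im (\<rho> B))" "sigma_additive (\<lambda>B. - Im (\<rho> B))"
  using assms unfolding radon_def sigma_additive_def by (auto intro!: sums_minus sums_Re sums_Im)

lemma bounded_borel_intros:
  "{} \<in> bounded_borel"
  "A \<in> bounded_borel \<Longrightarrow> B \<in> bounded_borel \<Longrightarrow> A \<union> B \<in> bounded_borel"
  "A \<in> bounded_borel \<Longrightarrow> B \<in> sets borel \<Longrightarrow> A \<inter> B \<in> bounded_borel"
  "A \<in> bounded_borel \<Longrightarrow> B \<in> sets borel \<Longrightarrow> A - B \<in> bounded_borel"
  "{s} \<in> bounded_borel"
  by (auto simp: bounded_borel_def bounded_Int bounded_diff)

lemma bounded_borel_borel: "A \<in> bounded_borel \<Longrightarrow> A \<in> sets borel"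
  by (simp add: bounded_borel_def)

lemma bounded_borel_subset: "A \<in> bounded_borel \<Longrightarrow> B \<in> sets borel \<Longrightarrow> B \<subseteq> A \<Longrightarrow> B \<in> bounded_borel"
  by (auto simp: bounded_borel_def intro: bounded_subset)

definition upper_set :: "('a::euclidean_space set \<Rightarrow> real) \<Rightarrow> 'a set \<Rightarrow> ennreal" where
  "upper_set \<kappa> B = (SUP X\<in>{X \<in> bounded_borel. X \<subseteq> B}. ennreal (\<kappa> X))"

lemma upper_set_upper: "X \<in> bounded_borel \<Longrightarrow> X \<subseteq> B \<Longrightarrow> ennreal (\<kappa> X) \<le> upper_set \<kappa> B"
  unfolding upper_set_def by (intro SUP_upper) auto

context
  fixes \<kappa> :: "'a::euclidean_space set \<Rightarrow> real"
  assumes \<kappa>: "sigma_additive \<kappa>"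
begin

lemma sigma_additive_sums:
  "range A \<subseteq> bounded_borel \<Longrightarrow> disjoint_family A \<Longrightarrow> bounded (\<Union>i. A i) \<Longrightarrow> (\<lambda>i. \<kappa> (A i)) sums \<kappa> (\<Union>i::nat. A i)"
  using \<kappa> by (auto simp: sigma_additive_def)

lemma sigma_additive_empty: "\<kappa> {} = 0"
proof -
  have "(\<lambda>i::nat. \<kappa> {}) sums \<kappa> (\<Union>i::nat. {})"
    by (rule sigma_additive_sums) (auto simp: bounded_borel_intros disjoint_family_on_def)
  then show ?thesis by (auto simp: sums_iff summable_const_iff)
qed

lemma sigma_additive_Un:
  assumes "A \<in> bounded_borel" "B \<in> bounded_borel" "A \<inter> B = {}"
  shows "\<kappa> (A \<union> B) = \<kappa> A + \<kappa> B"
proof -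
  have "(\<lambda>i. \<kappa> (binaryset A B i)) sums \<kappa> (\<Union>i. binaryset A B i)"
    using assms
    by (intro sigma_additive_sums)
      (auto simp: range_binaryset_eq bounded_borel_intros UN_binaryset_eq disjoint_family_on_def
        binaryset_def bounded_borel_def)
  moreover have "(\<lambda>i. \<kappa> (binaryset A B i)) sums (\<kappa> A + \<kappa> B)"
    by (rule binaryset_sums) (rule sigma_additive_empty)
  ultimately show ?thesis by (simp add: UN_binaryset_eq sums_unique2)
qed

lemma sigma_additive_diff:
  assumes "A \<in> bounded_borel" "X \<in> bounded_borel" "X \<subseteq> A"
  shows "\<kappa> (A - X) = \<kappa> A - \<kappa> X"
proof -
  have "\<kappa> (X \<union> (A - X)) = \<kappa> X + \<kappa> (A - X)"
    using assms by (intro sigma_additive_Un) (auto intro: bounded_borel_intros bounded_borel_borel)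
  moreover have "X \<union> (A - X) = A" using assms by auto
  ultimately show ?thesis by simp
qed

text \<open>If \<kappa> takes arbitrarily large values inside a set, that set splits into two
  pieces, each of |\<kappa>| at least 1, one of which has the same defect. Iteration yields a
  decreasing sequence whose successive differences are disjoint with |\<kappa>| at least 1, against
  convergence of the series.\<close>

lemma sigma_additive_bounded:
  assumes B: "B \<in> bounded_borel"
  shows "\<exists>K. \<forall>X\<in>bounded_borel. X \<subseteq> B \<longrightarrow> \<kappa> X \<le> K"
proof (rule ccontr)
  define U where "U B \<longleftrightarrow> B \<in> bounded_borel \<and> (\<forall>K. \<exists>X\<in>bounded_borel. X \<subseteq> B \<and> \<kappa> X > K)" for B
  assume "\<not> ?thesis"
  then have UB: "U B" using B by (auto simp: U_def not_le)
  have step: "\<exists>B'. U B' \<and> B' \<subseteq> B \<and> \<bar>\<kappa> (B - B')\<bar> \<ge> 1" if "U B" for B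
  proof -
    \<comment> \<open>This size makes both pieces heavy, as |\<kappa> (B - X)| = |\<kappa> B -
      \<kappa> X| > 1; so either piece may be kept.\<close>
    obtain X where X: "X \<in> bounded_borel" "X \<subseteq> B" "\<kappa> X > \<bar>\<kappa> B\<bar> + 1"
      using \<open>U B\<close> unfolding U_def by blast
    have B: "B \<in> bounded_borel" using that by (simp add: U_def)
    have BX: "B - X \<in> bounded_borel" using B X by (auto intro: bounded_borel_intros bounded_borel_borel)
    have d: "\<kappa> (B - X) = \<kappa> B - \<kappa> X" using B X by (intro sigma_additive_diff)
    have "U X \<or> U (B - X)"
    proof (rule ccontr)
      assume "\<not> ?thesis"
      then obtain K1 K2 where K: "\<And>Y. Y \<in> bounded_borel \<Longrightarrow> Y \<subseteq> X \<Longrightarrow> \<kappa> Y \<le> K1"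
        "\<And>Y. Y \<in> bounded_borel \<Longrightarrow> Y \<subseteq> B - X \<Longrightarrow> \<kappa> Y \<le> K2"
        using X(1) BX unfolding U_def by (meson not_le)
      obtain Y where Y: "Y \<in> bounded_borel" "Y \<subseteq> B" "\<kappa> Y > K1 + K2"
        using \<open>U B\<close> unfolding U_def by blast
      have *: "Y \<inter> X \<in> bounded_borel" "Y - X \<in> bounded_borel"
        using X Y by (auto intro: bounded_borel_intros bounded_borel_borel)
      have "\<kappa> ((Y \<inter> X) \<union> (Y - X)) = \<kappa> (Y \<inter> X) + \<kappa> (Y - X)"
        using * by (intro sigma_additive_Un) auto
      moreover have "(Y \<inter> X) \<union> (Y - X) = Y" by auto
      moreover have "\<kappa> (Y \<inter> X) \<le> K1" "\<kappa> (Y - X) \<le> K2"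
        using * Y by (auto intro!: K)
      ultimately show False using Y(3) by simp
    qed
    then show ?thesis
    proof
      assume "U X"
      then show ?thesis using X d by (intro exI[of _ X]) auto
    next
      assume "U (B - X)"
      moreover have "B - (B - X) = X" using X by auto
      ultimately show ?thesis using X by (intro exI[of _ "B - X"]) auto
    qed
  qed
  obtain F where F: "\<And>n::nat. U (F n)" "\<And>n. F (Suc n) \<subseteq> F n \<and> \<bar>\<kappa> (F n - F (Suc n))\<bar> \<ge> 1"
    using dependent_nat_choice[of "\<lambda>_. U" "\<lambda>_ B B'. B' \<subseteq> B \<and> \<bar>\<kappa> (B - B')\<bar> \<ge> 1"] UB step by metis
  have dec: "F n \<subseteq> F m" if "m \<le> n" for m n
    using that F(2) by (induction rule: dec_induct) auto
  define D where "D n = F n - F (Suc n)" for n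
  have D: "D n \<in> bounded_borel" for n
    using F(1)[of n] F(1)[of "Suc n"] by (auto simp: D_def U_def intro: bounded_borel_intros bounded_borel_borel)
  have "D m \<inter> D n = {}" if "m < n" for m n
    using dec[of "Suc m" n] that by (auto simp: D_def)
  then have disj: "disjoint_family D"
    unfolding disjoint_family_on_def by (metis Int_commute linorder_neqE_nat)
  have "(\<Union>n. D n) \<subseteq> F 0" using dec[of 0] by (force simp: D_def)
  moreover have "bounded (F 0)" using F(1)[of 0] by (simp add: U_def bounded_borel_def)
  ultimately have "bounded (\<Union>n. D n)" by (rule bounded_subset[rotated])
  then have "(\<lambda>n. \<kappa> (D n)) sums \<kappa> (\<Union>n. D n)"
    using D disj by (intro sigma_additive_sums) auto
  then have "(\<lambda>n. \<kappa> (D n)) \<longlonglongrightarrow> 0" by (intro summable_LIMSEQ_zero) (auto simp: sums_iff)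
  then have "\<forall>\<^sub>F n in sequentially. \<bar>\<kappa> (D n)\<bar> < 1"
    by (auto dest: tendstoD[of _ _ _ 1])
  then show False using F(2) by (auto simp: D_def eventually_sequentially not_less[symmetric])
qed

lemma upper_set_superadd:
  assumes "A \<inter> B = {}"
  shows "upper_set \<kappa> A + upper_set \<kappa> B \<le> upper_set \<kappa> (A \<union> B)"
proof -
  have ne: "{X \<in> bounded_borel. X \<subseteq> C} \<noteq> {}" for C :: "'a set"
    using bounded_borel_intros(1) by auto
  have *: "ennreal (\<kappa> X) + ennreal (\<kappa> Y) \<le> upper_set \<kappa> (A \<union> B)"
    if XY: "X \<in> bounded_borel" "X \<subseteq> A" "Y \<in> bounded_borel" "Y \<subseteq> B" for X Y
  proof -
    \<comment> \<open>\<open>ennreal\<close> truncates at 0, so additivity helps only if both values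
      are nonnegative; otherwise one summand is 0.\<close>
    consider "\<kappa> X < 0" | "\<kappa> Y < 0" | "\<kappa> X \<ge> 0" "\<kappa> Y \<ge> 0" by linarith
    then show ?thesis
    proof cases
      case 1
      then show ?thesis using upper_set_upper[of Y "A \<union> B" \<kappa>] that by (auto simp: ennreal_neg)
    next
      case 2
      then show ?thesis using upper_set_upper[of X "A \<union> B" \<kappa>] that by (auto simp: ennreal_neg)
    next
      case 3
      then have "ennreal (\<kappa> X) + ennreal (\<kappa> Y) = ennreal (\<kappa> (X \<union> Y))"
        using XY assms by (subst sigma_additive_Un) auto
      also have "\<dots> \<le> upper_set \<kappa> (A \<union> B)"
        using XY by (intro upper_set_upper bounded_borel_intros) auto
      finally show ?thesis .
    qed
  qed
  have **: "upper_set \<kappa> A + ennreal (\<kappa> Y) \<le> upper_set \<kappa> (A \<union> B)"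
    if Y: "Y \<in> bounded_borel" "Y \<subseteq> B" for Y
  proof -
    have "upper_set \<kappa> A + ennreal (\<kappa> Y) = (SUP X\<in>{X \<in> bounded_borel. X \<subseteq> A}. ennreal (\<kappa> X) + ennreal (\<kappa> Y))"
      unfolding upper_set_def by (rule ennreal_SUP_add_left[OF ne, symmetric])
    also have "\<dots> \<le> upper_set \<kappa> (A \<union> B)"
      by (rule SUP_least) (use * Y in auto)
    finally show ?thesis .
  qed
  have "upper_set \<kappa> A + upper_set \<kappa> B = (SUP Y\<in>{Y \<in> bounded_borel. Y \<subseteq> B}. upper_set \<kappa> A + ennreal (\<kappa> Y))"
    unfolding upper_set_def[of \<kappa> B] by (rule ennreal_SUP_add_right[OF ne])
  also have "\<dots> \<le> upper_set \<kappa> (A \<union> B)"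
    by (rule SUP_least) (use ** in auto)
  finally show ?thesis .
qed

text \<open>Superadditivity on finite unions gives one inequality. For the other, a set
  \<open>X\<close> inside the union is cut along the pieces and the \<sigma>-additivity of \<kappa>
  is applied to \<open>X\<close>.\<close>

lemma upper_set_countably_additive: "countably_additive (sets borel) (upper_set \<kappa>)"
proof (rule countably_additiveI)
  fix A :: "nat \<Rightarrow> 'a set"
  assume A: "range A \<subseteq> sets borel" "disjoint_family A" "\<Union>(range A) \<in> sets borel"
  show "(\<Sum>i. upper_set \<kappa> (A i)) = upper_set \<kappa> (\<Union>(range A))"
  proof (rule antisym)
    show "(\<Sum>i. upper_set \<kappa> (A i)) \<le> upper_set \<kappa> (\<Union>(range A))"
    proof (rule suminf_le_const)
      fix n
      have "(\<Sum>i<n. upper_set \<kappa> (A i)) \<le> upper_set \<kappa> (\<Union>i<n. A i)"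
      proof (induction n)
        case (Suc n)
        have "(\<Sum>i<Suc n. upper_set \<kappa> (A i)) \<le> upper_set \<kappa> (\<Union>i<n. A i) + upper_set \<kappa> (A n)"
          using Suc by (simp add: add_mono)
        also have "\<dots> \<le> upper_set \<kappa> ((\<Union>i<n. A i) \<union> A n)"
        proof (rule upper_set_superadd)
          have "A i \<inter> A n = {}" if "i < n" for i
            using A(2) that by (intro disjoint_family_onD[of A UNIV]) auto
          then show "(\<Union>i<n. A i) \<inter> A n = {}" by blast
        qed
        also have "(\<Union>i<n. A i) \<union> A n = (\<Union>i<Suc n. A i)" by (auto simp: lessThan_Suc)
        finally show ?case .
      qed simp
      also have "\<dots> \<le> upper_set \<kappa> (\<Union>(range A))"
        unfolding upper_set_def by (intro SUP_subset_mono) auto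
      finally show "(\<Sum>i<n. upper_set \<kappa> (A i)) \<le> upper_set \<kappa> (\<Union>(range A))" .
    qed simp
    show "upper_set \<kappa> (\<Union>(range A)) \<le> (\<Sum>i. upper_set \<kappa> (A i))"
      unfolding upper_set_def[of \<kappa> "\<Union>(range A)"]
    proof (rule SUP_least)
      fix X assume X: "X \<in> {X \<in> bounded_borel. X \<subseteq> \<Union>(range A)}"
      have m: "X \<inter> A i \<in> bounded_borel" for i
        using X A by (auto intro: bounded_borel_intros)
      have "(\<lambda>i. \<kappa> (X \<inter> A i)) sums \<kappa> (\<Union>i. X \<inter> A i)"
      proof (rule sigma_additive_sums)
        show "bounded (\<Union>i. X \<inter> A i)"
          using X by (auto simp: bounded_borel_def intro: bounded_subset)
      qed (use m A(2) in \<open>auto simp: disjoint_family_on_def\<close>)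
      moreover have "(\<Union>i. X \<inter> A i) = X" using X by auto
      ultimately have "(\<lambda>n. \<Sum>i<n. \<kappa> (X \<inter> A i)) \<longlonglongrightarrow> \<kappa> X" by (simp add: sums_def)
      then have "(\<lambda>n. ennreal (\<Sum>i<n. \<kappa> (X \<inter> A i))) \<longlonglongrightarrow> ennreal (\<kappa> X)"
        by (rule tendsto_ennrealI)
      then show "ennreal (\<kappa> X) \<le> (\<Sum>i. upper_set \<kappa> (A i))"
      proof (rule LIMSEQ_le_const2, intro exI allI impI)
        fix n
        \<comment> \<open>Negative terms are raised to 0 because \<open>ennreal\<close> commutes
          with sums of nonnegative reals only.\<close>
        have "ennreal (\<Sum>i<n. \<kappa> (X \<inter> A i)) \<le> ennreal (\<Sum>i<n. max 0 (\<kappa> (X \<inter> A i)))"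
          by (intro ennreal_leI sum_mono) auto
        also have "\<dots> = (\<Sum>i<n. ennreal (\<kappa> (X \<inter> A i)))"
          by (subst sum_ennreal[symmetric]) (simp_all add: ennreal_max_0)
        also have "\<dots> \<le> (\<Sum>i<n. upper_set \<kappa> (A i))"
          using m by (intro sum_mono upper_set_upper) auto
        also have "\<dots> \<le> (\<Sum>i. upper_set \<kappa> (A i))"
          by (intro sum_le_suminf) auto
        finally show "ennreal (\<Sum>i<n. \<kappa> (X \<inter> A i)) \<le> (\<Sum>i. upper_set \<kappa> (A i))" .
      qed
    qed
  qed
qed

lemma sets_upper_variation: "sets (upper_variation \<kappa>) = sets borel"
  and space_upper_variation: "space (upper_variation \<kappa>) = UNIV"
  unfolding upper_variation_def using sets.sigma_sets_eq[of borel] by (auto simp: space_measure_of_conv)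

lemma emeasure_upper_variation:
  assumes "B \<in> sets borel"
  shows "emeasure (upper_variation \<kappa>) B = upper_set \<kappa> B"
proof (rule emeasure_measure_of[OF upper_variation_def[of \<kappa>, folded upper_set_def]])
  show "positive (sets (upper_variation \<kappa>)) (upper_set \<kappa>)"
    using sigma_additive_empty by (auto simp: positive_def upper_set_def bot_ennreal intro!: SUP_eqI)
  show "countably_additive (sets (upper_variation \<kappa>)) (upper_set \<kappa>)"
    unfolding sets_upper_variation by (rule upper_set_countably_additive)
qed (use assms in \<open>auto simp: sets_upper_variation\<close>)

lemma emeasure_upper_variation_finite:
  assumes "B \<in> bounded_borel"
  shows "emeasure (upper_variation \<kappa>) B < \<infinity>"
proof -
  obtain K where "\<And>X. X \<in> bounded_borel \<Longrightarrow> X \<subseteq> B \<Longrightarrow> \<kappa> X \<le> K"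
    using sigma_additive_bounded[OF assms] by blast
  then have "upper_set \<kappa> B \<le> ennreal K"
    unfolding upper_set_def by (intro SUP_least ennreal_leI) auto
  then show ?thesis
    using assms by (auto simp: emeasure_upper_variation bounded_borel_borel less_top[symmetric] top_unique)
qed

lemma measure_upper_variation_ge:
  assumes "B \<in> bounded_borel" "X \<in> bounded_borel" "X \<subseteq> B"
  shows "\<kappa> X \<le> measure (upper_variation \<kappa>) B"
proof -
  have "ennreal (\<kappa> X) \<le> emeasure (upper_variation \<kappa>) B"
    using assms by (simp add: emeasure_upper_variation bounded_borel_borel upper_set_upper)
  also have "\<dots> = ennreal (measure (upper_variation \<kappa>) B)"
    using emeasure_upper_variation_finite[OF assms(1)] by (intro emeasure_eq_ennreal_measure) auto
  finally show ?thesis by (simp add: ennreal_le_iff)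
qed

lemma measure_upper_variation_le:
  assumes "B \<in> bounded_borel" "\<And>X. X \<in> bounded_borel \<Longrightarrow> X \<subseteq> B \<Longrightarrow> \<kappa> X \<le> c"
  shows "measure (upper_variation \<kappa>) B \<le> c"
proof -
  have "0 \<le> c" using assms(2)[of "{}"] sigma_additive_empty by (simp add: bounded_borel_intros)
  have "emeasure (upper_variation \<kappa>) B \<le> ennreal c"
    using assms unfolding emeasure_upper_variation[OF bounded_borel_borel[OF assms(1)]] upper_set_def
    by (intro SUP_least ennreal_leI) auto
  then show ?thesis using \<open>0 \<le> c\<close> by (simp add: measure_def enn2real_leI)
qed

end

text \<open>For \<open>X\<close> inside \<open>B\<close>, \<kappa> X = \<kappa> B - \<kappa> (B - X)
  is at most \<kappa> B plus the variation of -\<kappa>. The supremum over \<open>X\<close> gives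
  one inequality, the same argument for -\<kappa> the other.\<close>

lemma jordan_decomposition:
  assumes \<kappa>: "sigma_additive \<kappa>" "sigma_additive (\<lambda>B. - \<kappa> B)" and B: "B \<in> bounded_borel"
  shows "\<kappa> B = measure (upper_variation \<kappa>) B - measure (upper_variation (\<lambda>B. - \<kappa> B)) B"
proof (rule antisym)
  let ?P = "measure (upper_variation \<kappa>) B" and ?Q = "measure (upper_variation (\<lambda>B. - \<kappa> B)) B"
  have "?P \<le> \<kappa> B + ?Q"
  proof (rule measure_upper_variation_le[OF \<kappa>(1) B])
    fix X assume X: "X \<in> bounded_borel" "X \<subseteq> B"
    then have "- \<kappa> (B - X) \<le> ?Q"
      using B by (intro measure_upper_variation_ge[OF \<kappa>(2)]) (auto intro: bounded_borel_intros bounded_borel_borel)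
    then show "\<kappa> X \<le> \<kappa> B + ?Q" using sigma_additive_diff[OF \<kappa>(1) B X] by simp
  qed
  then show "?P - ?Q \<le> \<kappa> B" by simp
  have "?Q \<le> - \<kappa> B + ?P"
  proof (rule measure_upper_variation_le[OF \<kappa>(2) B])
    fix X assume X: "X \<in> bounded_borel" "X \<subseteq> B"
    then have "\<kappa> (B - X) \<le> ?P"
      using B by (intro measure_upper_variation_ge[OF \<kappa>(1)]) (auto intro: bounded_borel_intros bounded_borel_borel)
    then show "- \<kappa> X \<le> - \<kappa> B + ?P" using sigma_additive_diff[OF \<kappa>(1) B X] by simp
  qed
  then show "\<kappa> B \<le> ?P - ?Q" by simp
qed

section \<open>Integration against upper variations\<close>

lemma integrable_upper_variation:
  fixes f :: "'a::euclidean_space \<Rightarrow> complex"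
  assumes \<kappa>: "sigma_additive \<kappa>" and f: "f \<in> borel_measurable borel" "\<And>x. norm (f x) \<le> C"
    and S: "S \<in> bounded_borel" "\<And>x. x \<notin> S \<Longrightarrow> f x = 0"
  shows "integrable (upper_variation \<kappa>) f"
proof (rule integrableI_bounded_set)
  show "S \<in> sets (upper_variation \<kappa>)" using S by (simp add: sets_upper_variation[OF \<kappa>] bounded_borel_borel)
  show "f \<in> borel_measurable (upper_variation \<kappa>)"
    using f(1) by (simp add: measurable_cong_sets[OF sets_upper_variation[OF \<kappa>] refl])
  show "emeasure (upper_variation \<kappa>) S < \<infinity>" by (rule emeasure_upper_variation_finite[OF \<kappa> S(1)])
qed (use f S in auto)

text \<open>The upper variation does not charge the complement of the countable set
  \<open>A\<close>, so it is a weighted counting measure on \<open>A\<close>, against which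
  integrals are absolutely convergent sums.\<close>

lemma integral_upper_variation_concentrated:
  fixes f :: "'a::euclidean_space \<Rightarrow> complex"
  assumes \<kappa>: "sigma_additive \<kappa>" and f: "f \<in> borel_measurable borel" "\<And>x. norm (f x) \<le> C"
    and S: "S \<in> bounded_borel" "\<And>x. x \<notin> S \<Longrightarrow> f x = 0"
    and A: "countable A" "\<And>X. X \<in> bounded_borel \<Longrightarrow> X \<inter> A = {} \<Longrightarrow> \<kappa> X = 0"
  shows "((\<lambda>s. measure (upper_variation \<kappa>) {s} *\<^sub>R f s) has_sum (LINT x|upper_variation \<kappa>. f x)) A"
proof -
  let ?V = "upper_variation \<kappa>"
  let ?N = "density (count_space A) (\<lambda>s. ennreal (measure ?V {s}))"
  have Ab: "A \<in> sets borel" by (rule sets.countable[OF _ A(1)]) auto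
  have "emeasure ?V (- A) = 0"
  proof -
    have "upper_set \<kappa> (- A) = 0"
    proof -
      have "ennreal (\<kappa> X) \<le> 0" if "X \<in> bounded_borel" "X \<subseteq> - A" for X
      proof -
        have "X \<inter> A = {}" using that by auto
        then show ?thesis using A(2) that by simp
      qed
      then have "upper_set \<kappa> (- A) \<le> 0"
        unfolding upper_set_def by (intro SUP_least) auto
      then show ?thesis by simp
    qed
    then show ?thesis using Ab by (simp add: emeasure_upper_variation[OF \<kappa>])
  qed
  have fin: "ennreal (measure ?V {s}) = emeasure ?V {s}" for s
    using emeasure_upper_variation_finite[OF \<kappa> bounded_borel_intros(5)[of s]]
    by (intro emeasure_eq_ennreal_measure[symmetric]) auto
  \<comment> \<open>\<open>?N\<close> lives on all subsets of \<open>A\<close>; its image under the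
    identity lives on the Borel sets.\<close>
  have V: "?V = distr ?N borel (\<lambda>x. x)"
  proof (rule measure_eqI)
    fix B assume "B \<in> sets ?V"
    then have B: "B \<in> sets borel" by (simp add: sets_upper_variation[OF \<kappa>])
    have "emeasure ?V B = emeasure ?V (A \<inter> B) + emeasure ?V (B - A)"
      using B Ab by (subst plus_emeasure) (auto simp: sets_upper_variation[OF \<kappa>] intro!: arg_cong2[where f = emeasure])
    also have "emeasure ?V (B - A) = 0"
    proof -
      have "emeasure ?V (B - A) \<le> emeasure ?V (- A)"
        using Ab by (intro emeasure_mono) (auto simp: sets_upper_variation[OF \<kappa>])
      then show ?thesis using \<open>emeasure ?V (- A) = 0\<close> by simp
    qed
    also have "emeasure ?V (A \<inter> B) = (\<integral>\<^sup>+s. emeasure ?V {s} \<partial>count_space (A \<inter> B))"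
      using A(1) by (intro emeasure_countable_singleton) (auto simp: sets_upper_variation[OF \<kappa>])
    also have "\<dots> = (\<integral>\<^sup>+s. emeasure ?V {s} * indicator B s \<partial>count_space A)"
      by (subst (1 2) nn_integral_count_space_indicator) (auto intro!: nn_integral_cong split: split_indicator)
    also have "\<dots> = emeasure ?N (A \<inter> B)"
      by (subst emeasure_density) (auto intro!: nn_integral_cong simp: fin split: split_indicator)
    also have "\<dots> = emeasure (distr ?N borel (\<lambda>x. x)) B"
      using B by (subst emeasure_distr) (auto intro!: arg_cong2[where f = emeasure])
    finally show "emeasure ?V B = emeasure (distr ?N borel (\<lambda>x. x)) B" by simp
  qed (simp add: sets_upper_variation[OF \<kappa>])
  have int: "integrable ?V f" by (rule integrable_upper_variation[OF \<kappa> f S])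
  then have "integrable ?N f" by (subst (asm) V, subst (asm) integrable_distr_eq) (use f in auto)
  then have "integrable (count_space A) (\<lambda>s. measure ?V {s} *\<^sub>R f s)"
    by (subst (asm) integrable_density) auto
  then have abs: "Infinite_Set_Sum.abs_summable_on (\<lambda>s. measure ?V {s} *\<^sub>R f s) A"
    by (simp add: Infinite_Set_Sum.abs_summable_on_def)
  have "(LINT x|?V. f x) = (LINT x|?N. f x)"
    by (subst V, subst integral_distr) (use f in auto)
  also have "\<dots> = infsetsum (\<lambda>s. measure ?V {s} *\<^sub>R f s) A"
    unfolding infsetsum_def by (subst integral_density) auto
  also have "\<dots> = infsum (\<lambda>s. measure ?V {s} *\<^sub>R f s) A"
    by (rule infsetsum_infsum[OF abs])
  finally show ?thesis
    using abs by (simp add: abs_summable_equivalent[symmetric] abs_summable_summable)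
qed

lemma radon_integral_concentrated:
  fixes f :: "'a::euclidean_space \<Rightarrow> complex"
  assumes \<rho>: "radon \<rho>" and f: "f \<in> borel_measurable borel" "\<And>x. norm (f x) \<le> C"
    and S: "S \<in> bounded_borel" "\<And>x. x \<notin> S \<Longrightarrow> f x = 0"
    and A: "countable A" "\<And>X. X \<in> bounded_borel \<Longrightarrow> X \<inter> A = {} \<Longrightarrow> \<rho> X = 0"
  shows "((\<lambda>s. \<rho> {s} * f s) has_sum radon_integral \<rho> f) A"
proof -
  note sg = sigma_additive_radon[OF \<rho>]
  have *: "((\<lambda>s. measure (upper_variation \<kappa>) {s} *\<^sub>R f s) has_sum (LINT x|upper_variation \<kappa>. f x)) A"
    if "sigma_additive \<kappa>" "\<And>X. \<rho> X = 0 \<Longrightarrow> \<kappa> X = 0" for \<kappa>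
    using that(2)[OF A(2)] by (intro integral_upper_variation_concentrated[OF that(1) f S A(1)])
  have "((\<lambda>s. measure (upper_variation (\<lambda>B. Re (\<rho> B))) {s} *\<^sub>R f s - measure (upper_variation (\<lambda>B. - Re (\<rho> B))) {s} *\<^sub>R f s
     + \<i> * (measure (upper_variation (\<lambda>B. Im (\<rho> B))) {s} *\<^sub>R f s - measure (upper_variation (\<lambda>B. - Im (\<rho> B))) {s} *\<^sub>R f s))
     has_sum radon_integral \<rho> f) A"
    unfolding radon_integral_def
    by (intro has_sum_add has_sum_minus has_sum_cmult_right * sg) auto
  also have "(\<lambda>s. measure (upper_variation (\<lambda>B. Re (\<rho> B))) {s} *\<^sub>R f s - measure (upper_variation (\<lambda>B. - Re (\<rho> B))) {s} *\<^sub>R f s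
     + \<i> * (measure (upper_variation (\<lambda>B. Im (\<rho> B))) {s} *\<^sub>R f s - measure (upper_variation (\<lambda>B. - Im (\<rho> B))) {s} *\<^sub>R f s))
     = (\<lambda>s. \<rho> {s} * f s)"
  proof
    fix s
    have "\<rho> {s} = of_real (Re (\<rho> {s})) + \<i> * of_real (Im (\<rho> {s}))"
      by (simp add: complex_eq)
    also have "\<dots> * f s = of_real (measure (upper_variation (\<lambda>B. Re (\<rho> B))) {s} - measure (upper_variation (\<lambda>B. - Re (\<rho> B))) {s}) * f s
       + \<i> * of_real (measure (upper_variation (\<lambda>B. Im (\<rho> B))) {s} - measure (upper_variation (\<lambda>B. - Im (\<rho> B))) {s}) * f s"
      by (simp only: jordan_decomposition[OF sg(1,2) bounded_borel_intros(5)]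
            jordan_decomposition[OF sg(3,4) bounded_borel_intros(5)] distrib_right)
    finally show "measure (upper_variation (\<lambda>B. Re (\<rho> B))) {s} *\<^sub>R f s - measure (upper_variation (\<lambda>B. - Re (\<rho> B))) {s} *\<^sub>R f s
     + \<i> * (measure (upper_variation (\<lambda>B. Im (\<rho> B))) {s} *\<^sub>R f s - measure (upper_variation (\<lambda>B. - Im (\<rho> B))) {s} *\<^sub>R f s)
     = \<rho> {s} * f s"
      by (simp add: scaleR_conv_of_real algebra_simps)
  qed
  finally show ?thesis .
qed

subsection \<open>Atomic measures\<close>

text \<open>Evaluation on singletons identifies the coefficients in \<open>atomic\<close> with the
  masses of the points, so they need not be carried along.\<close>

lemma atomic_has_sum:
  assumes "atomic \<mu>"
  obtains A where "countable A" "\<And>B. B \<in> bounded_borel \<Longrightarrow> ((\<lambda>s. \<mu> {s}) has_sum \<mu> B) (A \<inter> B)"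
proof -
  obtain A a where A: "countable A" "\<And>B. B \<in> bounded_borel \<Longrightarrow> (a has_sum \<mu> B) (A \<inter> B)"
    using assms by (auto simp: atomic_def)
  have "\<mu> {s} = a s" if "s \<in> A" for s
  proof -
    have "A \<inter> {s} = {s}" using that by auto
    then have "(a has_sum \<mu> {s}) {s}" using A(2)[of "{s}"] by (simp add: bounded_borel_intros)
    moreover have "(a has_sum (\<Sum>s\<in>{s}. a s)) {s}" by (rule has_sum_finite) simp
    ultimately show ?thesis using has_sum_unique by fastforce
  qed
  then have "((\<lambda>s. \<mu> {s}) has_sum \<mu> B) (A \<inter> B)" if "B \<in> bounded_borel" for B
    using A(2)[OF that] by (subst has_sum_cong[where g = a]) auto
  with A(1) show thesis by (rule that)
qed

lemma atomic_total_variation: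
  fixes \<mu> :: "'a::euclidean_space set \<Rightarrow> complex"
  assumes A: "countable A" "\<And>B. B \<in> bounded_borel \<Longrightarrow> ((\<lambda>s. \<mu> {s}) has_sum \<mu> B) (A \<inter> B)"
    and B: "B \<in> bounded_borel"
  shows "((\<lambda>s. complex_of_real (norm (\<mu> {s}))) has_sum total_variation \<mu> B) (A \<inter> B)"
proof -
  have abs: "(\<lambda>s. norm (\<mu> {s})) summable_on (A \<inter> B)" if "B \<in> bounded_borel" for B
    using A(2)[OF that] summable_on_iff_abs_summable_on_complex[of "\<lambda>s. \<mu> {s}" "A \<inter> B"]
    by (auto simp: summable_on_def)
  define I where "I = infsum (\<lambda>s. norm (\<mu> {s})) (A \<inter> B)"
  let ?P = "{P. finite P \<and> disjoint P \<and> P \<subseteq> sets borel \<and> \<Union>P = B}"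
  have upper: "(\<Sum>X\<in>P. norm (\<mu> X)) \<le> I" if P: "P \<in> ?P" for P
  proof -
    have X: "X \<in> bounded_borel" if "X \<in> P" for X
      using P that by (auto intro!: bounded_borel_subset[OF B])
    have "(\<Sum>X\<in>P. norm (\<mu> X)) \<le> (\<Sum>X\<in>P. infsum (\<lambda>s. norm (\<mu> {s})) (A \<inter> X))"
    proof (rule sum_mono)
      fix X assume "X \<in> P"
      then show "norm (\<mu> X) \<le> infsum (\<lambda>s. norm (\<mu> {s})) (A \<inter> X)"
        by (intro norm_has_sum_bound[OF has_sum_infsum[OF abs]] A X)
    qed
    also have "\<dots> = infsum (\<lambda>s. norm (\<mu> {s})) (\<Union>X\<in>P. A \<inter> X)"
    proof (rule sum_infsum)
      show "(\<lambda>s. norm (\<mu> {s})) summable_on A \<inter> X" if "X \<in> P" for X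
        by (rule abs[OF X[OF that]])
      show "(A \<inter> X) \<inter> (A \<inter> Y) = {}" if "X \<in> P" "Y \<in> P" "X \<noteq> Y" for X Y
        using P that by (auto simp: disjoint_def)
    qed (use P in auto)
    also have "(\<Union>X\<in>P. A \<inter> X) = A \<inter> B" using P by auto
    finally show ?thesis by (simp add: I_def)
  qed
  have "(SUP P\<in>?P. \<Sum>X\<in>P. norm (\<mu> X)) = I"
  proof (rule antisym)
    have "{B} \<in> ?P" using B by (auto simp: disjoint_def bounded_borel_borel)
    then show "(SUP P\<in>?P. \<Sum>X\<in>P. norm (\<mu> X)) \<le> I"
      by (intro cSUP_least upper) auto
    show "I \<le> (SUP P\<in>?P. \<Sum>X\<in>P. norm (\<mu> X))"
      unfolding I_def
    proof (rule infsum_le_finite_sums[OF abs[OF B]])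
      fix F assume F: "finite F" "F \<subseteq> A \<inter> B"
      \<comment> \<open>The partition that isolates the points of \<open>F\<close>; the remainder
        contributes a nonnegative term.\<close>
      let ?Q = "insert (B - F) ((\<lambda>s. {s}) ` F)"
      have "F \<in> sets borel" by (intro borel_closed finite_imp_closed F)
      then have Q: "?Q \<in> ?P"
        using F B by (auto simp: disjoint_def bounded_borel_borel)
      have "(\<Sum>s\<in>F. norm (\<mu> {s})) = (\<Sum>X\<in>(\<lambda>s. {s}) ` F. norm (\<mu> X))"
        by (subst sum.reindex) auto
      also have "\<dots> \<le> (\<Sum>X\<in>?Q. norm (\<mu> X))"
        using F by (intro sum_mono2) auto
      also have "\<dots> \<le> (SUP P\<in>?P. \<Sum>X\<in>P. norm (\<mu> X))"
        using upper by (intro cSUP_upper Q bdd_aboveI2[where M = I]) auto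
      finally show "(\<Sum>s\<in>F. norm (\<mu> {s})) \<le> (SUP P\<in>?P. \<Sum>X\<in>P. norm (\<mu> X))" .
    qed
  qed
  moreover have "((\<lambda>s. norm (\<mu> {s})) has_sum I) (A \<inter> B)"
    unfolding I_def by (rule has_sum_infsum[OF abs[OF B]])
  ultimately show ?thesis
    unfolding total_variation_def by (simp add: has_sum_of_real_iff)
qed

text \<open>A regrouping of an absolutely convergent sum: as the pieces are disjoint, the atoms in
  their union correspond to pairs of a piece and an atom in it.\<close>

lemma radon_total_variation:
  fixes \<mu> :: "'a::euclidean_space set \<Rightarrow> complex"
  assumes A: "countable A" "\<And>B. B \<in> bounded_borel \<Longrightarrow> ((\<lambda>s. \<mu> {s}) has_sum \<mu> B) (A \<inter> B)"
  shows "radon (total_variation \<mu>)"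
  unfolding radon_def
proof (intro allI impI)
  fix B :: "nat \<Rightarrow> 'a set"
  assume B: "range B \<subseteq> bounded_borel" "disjoint_family B" "bounded (\<Union>i. B i)"
  let ?c = "\<lambda>s. complex_of_real (norm (\<mu> {s}))"
  have "(\<Union>i. B i) \<in> bounded_borel"
    using B by (auto simp: bounded_borel_def)
  from atomic_total_variation[OF A this]
  have "(?c has_sum total_variation \<mu> (\<Union>i. B i)) (A \<inter> (\<Union>i. B i))"
    by simp
  also have "A \<inter> (\<Union>i. B i) = snd ` (SIGMA i:UNIV. A \<inter> B i)" by force
  finally have "((?c \<circ> snd) has_sum total_variation \<mu> (\<Union>i. B i)) (SIGMA i:UNIV. A \<inter> B i)"
    using B(2) by (subst (asm) has_sum_reindex) (auto simp: inj_on_def disjoint_family_on_def)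
  then have "((\<lambda>i. total_variation \<mu> (B i)) has_sum total_variation \<mu> (\<Union>i. B i)) UNIV"
  proof (rule has_sum_SigmaD)
    fix i
    have "B i \<in> bounded_borel" using B(1) by auto
    from atomic_total_variation[OF A this]
    show "((\<lambda>y. (?c \<circ> snd) (i, y)) has_sum total_variation \<mu> (B i)) (A \<inter> B i)"
      by (simp add: o_def)
  qed
  then show "(\<lambda>i. total_variation \<mu> (B i)) sums total_variation \<mu> (\<Union>i. B i)"
    by (rule has_sum_nat_imp_sums)
qed

section \<open>Tempered distributions\<close>

lemma finite_multi_norm_le: "finite {j :: 'd::finite \<Rightarrow> nat. multi_norm j \<le> m}"
proof (rule finite_subset)
  show "{j :: 'd \<Rightarrow> nat. multi_norm j \<le> m} \<subseteq> (\<Pi>\<^sub>E i\<in>UNIV. {..m})"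
    by (auto simp: multi_norm_def PiE_def Pi_def)
  show "finite (\<Pi>\<^sub>E i\<in>(UNIV :: 'd set). {..m})"
    by (rule finite_PiE) auto
qed

text \<open>A neighbourhood in the Schwartz topology involves only finitely many seminorms, so for a
  sequence it is enough to check each seminorm separately.\<close>

lemma tempered_tendsto:
  fixes f :: "real^'d \<Rightarrow> complex"
  assumes T: "tempered T" and f: "f \<in> schwartz" and g: "\<And>n. g n \<in> schwartz"
    and lim: "\<And>k j \<epsilon>. \<epsilon> > 0 \<Longrightarrow> \<forall>\<^sub>F n in sequentially. schwartz_seminorm k j (\<lambda>x. g n x - f x) < \<epsilon>"
  shows "(\<lambda>n. T (g n)) \<longlonglongrightarrow> T f"
proof (rule tendstoI)
  fix e :: real assume "e > 0"
  define U where "U = {h \<in> topspace schwartz_topology. T h \<in> ball (T f) e}"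
  have "openin schwartz_topology U"
    using openin_continuous_map_preimage[of schwartz_topology euclidean T "ball (T f) e"] T
    by (simp add: tempered_def U_def)
  moreover have "f \<in> U" using f \<open>e > 0\<close> by (simp add: U_def topspace_schwartz_topology)
  ultimately obtain m \<epsilon> where m: "\<epsilon> > 0" "\<forall>g\<in>schwartz.
        (\<forall>k j. k \<le> m \<longrightarrow> multi_norm j \<le> m \<longrightarrow> schwartz_seminorm k j (\<lambda>x. g x - f x) < \<epsilon>) \<longrightarrow> g \<in> U"
    unfolding openin_schwartz_topology by blast
  have "\<forall>\<^sub>F n in sequentially. \<forall>k\<in>{..m}. \<forall>j\<in>{j. multi_norm j \<le> m}. schwartz_seminorm k j (\<lambda>x. g n x - f x) < \<epsilon>"
    by (intro eventually_ball_finite finite_multi_norm_le finite_atMost ballI lim m(1))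
  then show "\<forall>\<^sub>F n in sequentially. dist (T (g n)) (T f) < e"
  proof eventually_elim
    case (elim n)
    then have "g n \<in> U" using m(2) g by auto
    then show ?case by (simp add: U_def dist_commute)
  qed
qed

lemma test_functions_bounds:
  assumes "f \<in> test_functions"
  obtains C where "f \<in> borel_measurable borel" "\<And>x. norm (f x) \<le> C"
    "closure {x. f x \<noteq> 0} \<in> bounded_borel" "\<And>x. x \<notin> closure {x. f x \<noteq> 0} \<Longrightarrow> f x = 0"
proof -
  have d: "f differentiable (at x)" for x
    using assms spec[of "\<lambda>is. \<forall>x. iter_partial is f differentiable at x" "[]"]
    by (simp add: test_functions_def smooth_def)
  then have c: "continuous_on S f" for S
    by (meson continuous_at_imp_continuous_on differentiable_imp_continuous_within)
  have K: "compact (closure {x. f x \<noteq> 0})" using assms by (simp add: test_functions_def)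
  then have "bounded (f ` closure {x. f x \<noteq> 0})"
    by (intro compact_imp_bounded compact_continuous_image c)
  then obtain C where C: "\<And>x. x \<in> closure {x. f x \<noteq> 0} \<Longrightarrow> norm (f x) \<le> C"
    by (auto simp: bounded_iff)
  have z: "f x = 0" if "x \<notin> closure {x. f x \<noteq> 0}" for x
  proof (rule ccontr)
    assume "f x \<noteq> 0"
    then have "x \<in> closure {x. f x \<noteq> 0}" by (intro closure_subset[THEN subsetD]) simp
    then show False using that by simp
  qed
  show thesis
  proof (rule that[of "max C 0"])
    show "f \<in> borel_measurable borel" using c[of UNIV] by (rule borel_measurable_continuous_onI)
    show "norm (f x) \<le> max C 0" for x
      using C[of x] z[of x] by (cases "x \<in> closure {x. f x \<noteq> 0}") auto
    show "closure {x. f x \<noteq> 0} \<in> bounded_borel"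
      using K by (auto simp: bounded_borel_def compact_imp_bounded)
    show "f x = 0" if "x \<notin> closure {x. f x \<noteq> 0}" for x
      using that by (rule z)
  qed
qed

lemma schwartz_seminorm_tensor_le:
  fixes H :: "'d::finite \<Rightarrow> real \<Rightarrow> complex"
  assumes H: "\<And>i. smooth1 (H i)" and B: "\<And>i t. (1 + \<bar>t\<bar>) ^ k * norm ((vderiv ^^ j i) (H i) t) \<le> B"
  shows "schwartz_seminorm k j (tensor H) \<le> B ^ CARD('d)"
  unfolding schwartz_seminorm_def
proof (rule cSUP_least)
  fix x :: "real^'d"
  have "norm x ^ k * norm (deriv_multi j (tensor H) x) \<le>
      (\<Prod>i\<in>UNIV. (1 + \<bar>x $ i\<bar>) ^ k) * norm (deriv_multi j (tensor H) x)"
    by (intro mult_right_mono norm_pow_le_prod) auto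
  also have "\<dots> = (\<Prod>i\<in>UNIV. (1 + \<bar>x $ i\<bar>) ^ k * norm ((vderiv ^^ j i) (H i) (x $ i)))"
    by (simp add: deriv_multi_tensor H tensor_def prod.distrib prod_norm)
  also have "\<dots> \<le> (\<Prod>i\<in>(UNIV::'d set). B)"
    by (intro prod_mono) (auto intro: B)
  finally show "norm x ^ k * norm (deriv_multi j (tensor H) x) \<le> B ^ CARD('d)" by simp
qed simp

text \<open>Otherwise suitably scaled bumps would tend to \<open>0\<close> in the Schwartz space while their images
  under \<open>T\<close> would not.\<close>

lemma tempered_polynomial_growth:
  fixes A :: "(real^'d) set" and c :: "real^'d \<Rightarrow> real"
  assumes T: "tempered T" and c: "\<And>s. c s \<ge> 0"
    and Tc: "\<And>H. (\<And>i. test1 (H i)) \<Longrightarrow> ((\<lambda>s. of_real (c s) * tensor H s) has_sum T (tensor H)) A"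
  shows "\<exists>C K. \<forall>R\<ge>1. \<forall>F. finite F \<longrightarrow> F \<subseteq> A \<inter> cball 0 R \<longrightarrow> sum c F \<le> C * R ^ K"
proof (rule ccontr)
  let ?d = "CARD('d)"
  assume neg: "\<not> ?thesis"
  \<comment> \<open>The threshold is fitted to the scaling \<open>a n\<close> below: multiplied by
    \<open>(a n * b) ^ ?d\<close> it still equals \<open>(real (Suc n) * b) ^ ?d\<close>, which
    keeps the images away from 0.\<close>
  have "\<exists>R F. R \<ge> 1 \<and> finite F \<and> F \<subseteq> A \<inter> cball 0 R \<and> sum c F > real (Suc n) ^ (2 * ?d) * R ^ (n * ?d)" for n :: nat
    using neg by (meson not_le)
  then obtain R F where RF: "\<And>n::nat. R n \<ge> 1" "\<And>n. finite (F n)" "\<And>n. F n \<subseteq> A \<inter> cball 0 (R n)"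
    "\<And>n. sum c (F n) > real (Suc n) ^ (2 * ?d) * R n ^ (n * ?d)"
    by metis
  define \<phi> where "\<phi> = bump 1 (-2) 2"
  define \<psi> where "\<psi> t = complex_of_real (\<phi> t)" for t
  have \<psi>: "test1 \<psi>" unfolding \<psi>_def[abs_def] \<phi>_def by (rule test1_bump) simp
  \<comment> \<open>A lower bound of \<phi> on [-1, 1], where both factors of the bump have
    arguments at least 1.\<close>
  define b where "b = flatr 0 1 * flatr 0 1"
  have b: "b > 0" by (simp add: b_def flatr_bounds)
  have \<phi>b: "\<phi> t \<ge> b" if "\<bar>t\<bar> \<le> 1" for t
    unfolding \<phi>_def bump_def b_def by (intro mult_mono flatr_mono flatr_bounds) (use that in auto)
  \<comment> \<open>The power \<open>R n ^ n\<close> absorbs the weight \<open>R n ^ k\<close> of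
    any fixed seminorm once \<open>n\<close> reaches \<open>k\<close>; the factor
    \<open>Suc n\<close> then sends the seminorms to 0.\<close>
  define a where "a n = 1 / (real (Suc n) * R n ^ n)" for n
  have a: "a n > 0" for n using RF(1)[of n] by (auto simp: a_def intro!: mult_pos_pos)
  define H where "H n (i::'d) t = of_real (a n) * \<psi> (t / R n)" for n i t
  have Rn: "R n > 0" for n using RF(1)[of n] by linarith
  have \<psi>R: "test1 (\<lambda>t. \<psi> (t / R n))" for n
    using test1_affine[OF \<psi>, of "1 / R n" 0] Rn[of n] by simp
  have H: "test1 (H n i)" for n i
    unfolding H_def[abs_def] by (rule test1_mult[OF smooth1_intros(1) \<psi>R])
  have zero: "tensor (\<lambda>i::'d. \<lambda>t. 0) = (\<lambda>x. 0)" by (auto simp: tensor_def)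
  have z_schwartz: "(\<lambda>x::real^'d. 0 :: complex) \<in> schwartz"
    unfolding zero[symmetric]
    by (intro schwartz_tensor test1_schwartz1) (auto simp: test1_def smooth1_intros(1) intro: exI[of _ 1])
  have "(\<lambda>n. T (tensor (H n))) \<longlonglongrightarrow> T (\<lambda>x. 0)"
  proof (rule tempered_tendsto[OF T z_schwartz])
    show "tensor (H n) \<in> schwartz" for n by (intro schwartz_tensor test1_schwartz1 H)
    fix k and j :: "'d \<Rightarrow> nat" and \<epsilon> :: real assume "\<epsilon> > 0"
    obtain C where C: "C \<ge> 1" "\<And>i. \<forall>t. (1 + \<bar>t\<bar>) ^ k * norm ((vderiv ^^ j i) \<psi> t) \<le> C"
      by (rule uniform_bound[of "\<lambda>i C. \<forall>t. (1 + \<bar>t\<bar>) ^ k * norm ((vderiv ^^ j i) \<psi> t) \<le> C"])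
        (use test1_schwartz1[OF \<psi>] in \<open>simp add: schwartz1_def\<close>, meson order_trans, blast)
    have le: "schwartz_seminorm k j (tensor (H n)) \<le> (C / real (Suc n)) ^ ?d" if "n \<ge> k" for n
    proof (rule schwartz_seminorm_tensor_le)
      show "smooth1 (H n i)" for i by (rule test1_smooth1[OF H])
      fix i t
      have "(vderiv ^^ j i) (H n i) t = of_real (a n) * (of_real (1 / R n) ^ j i * (vderiv ^^ j i) \<psi> (t / R n))"
        unfolding H_def[abs_def]
        using pow_vderiv_cmult[OF test1_smooth1[OF \<psi>R], of "j i" "of_real (a n)" n]
           pow_vderiv_scale[OF test1_smooth1[OF \<psi>], of "j i" "1 / R n" 0] by simp
      then have "norm ((vderiv ^^ j i) (H n i) t) = a n * ((1 / R n) ^ j i * norm ((vderiv ^^ j i) \<psi> (t / R n)))"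
        using a[of n] Rn[of n] by (simp add: norm_mult norm_power norm_divide)
      also have "\<dots> \<le> a n * (1 * norm ((vderiv ^^ j i) \<psi> (t / R n)))"
        using a[of n] RF(1)[of n] by (intro mult_left_mono mult_right_mono power_le_one) auto
      finally have "(1 + \<bar>t\<bar>) ^ k * norm ((vderiv ^^ j i) (H n i) t)
         \<le> (1 + \<bar>t\<bar>) ^ k * (a n * norm ((vderiv ^^ j i) \<psi> (t / R n)))"
        by (intro mult_left_mono) auto
      also have "\<dots> \<le> (R n * (1 + \<bar>t / R n\<bar>)) ^ k * (a n * norm ((vderiv ^^ j i) \<psi> (t / R n)))"
        using a[of n] RF(1)[of n] by (intro mult_right_mono power_mono) (auto simp: distrib_left abs_divide)
      also have "\<dots> = (R n ^ k * a n) * ((1 + \<bar>t / R n\<bar>) ^ k * norm ((vderiv ^^ j i) \<psi> (t / R n)))"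
        by (simp add: power_mult_distrib)
      also have "\<dots> \<le> (R n ^ k * a n) * C"
        using a[of n] Rn[of n] C(2)[of i, rule_format, of "t / R n"] by (intro mult_left_mono) auto
      also have "\<dots> \<le> (1 / real (Suc n)) * C"
      proof (intro mult_right_mono)
        have "R n ^ k \<le> R n ^ n" using RF(1) that by (intro power_increasing) auto
        then have "R n ^ k * a n \<le> R n ^ n * a n" using a[of n] by (intro mult_right_mono) auto
        also have "\<dots> = 1 / real (Suc n)" using Rn[of n] by (simp add: a_def)
        finally show "R n ^ k * a n \<le> 1 / real (Suc n)" .
      qed (use C(1) in simp)
      finally show "(1 + \<bar>t\<bar>) ^ k * norm ((vderiv ^^ j i) (H n i) t) \<le> C / real (Suc n)" by simp
    qed
    have "(\<lambda>n. (C / real (Suc n)) ^ ?d) \<longlonglongrightarrow> 0 ^ ?d"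
      by (intro tendsto_intros LIMSEQ_Suc[OF lim_const_over_n])
    then have "(\<lambda>n. (C / real (Suc n)) ^ ?d) \<longlonglongrightarrow> 0"
      by (simp add: power_0_left del: of_nat_Suc)
    from order_tendstoD(2)[OF this \<open>\<epsilon> > 0\<close>]
    have "\<forall>\<^sub>F n in sequentially. (C / real (Suc n)) ^ ?d < \<epsilon>" .
    then show "\<forall>\<^sub>F n in sequentially. schwartz_seminorm k j (\<lambda>x. tensor (H n) x - 0) < \<epsilon>"
      using eventually_ge_at_top[of k]
      by eventually_elim (use le in \<open>auto intro: order_le_less_trans simp del: of_nat_Suc\<close>)
  qed
  moreover have "T (\<lambda>x. 0) = 0"
  proof -
    have "\<forall>c. \<forall>f\<in>schwartz. T (\<lambda>x. c * f x) = c * T f"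
      using T by (simp add: tempered_def)
    from this[rule_format, OF z_schwartz, of 0] show ?thesis by simp
  qed
  ultimately have "(\<lambda>n. norm (T (tensor (H n)))) \<longlonglongrightarrow> 0" by (simp add: tendsto_norm_zero_iff)
  then have "\<forall>\<^sub>F n in sequentially. norm (T (tensor (H n))) < b ^ ?d"
    using b by (intro order_tendstoD) auto
  moreover have "norm (T (tensor (H n))) \<ge> b ^ ?d" for n
  proof -
    have pos: "0 \<le> a n * \<phi> t" for t using a[of n] by (simp add: \<phi>_def bump_bounds)
    let ?h = "\<lambda>s::real^'d. \<Prod>i\<in>UNIV. a n * \<phi> (s $ i / R n)"
    have h: "tensor (H n) s = of_real (?h s)" for s
      by (simp add: tensor_def H_def \<psi>_def)
    have h0: "?h s \<ge> 0" for s using pos by (intro prod_nonneg) auto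
    have hb: "?h s \<ge> (a n * b) ^ ?d" if "s \<in> cball 0 (R n)" for s
    proof -
      have "(\<Prod>i\<in>(UNIV::'d set). a n * b) \<le> ?h s"
      proof (intro prod_mono conjI)
        fix i
        have "\<bar>s $ i\<bar> \<le> R n" using that component_le_norm_cart[of s i] by simp
        then have "\<bar>s $ i / R n\<bar> \<le> 1" using Rn[of n] by (simp add: abs_divide)
        then show "a n * b \<le> a n * \<phi> (s $ i / R n)"
          using \<phi>b a[of n] by (intro mult_left_mono) auto
        show "0 \<le> a n * b" using a[of n] b by simp
      qed
      then show ?thesis by simp
    qed
    have "((\<lambda>s. complex_of_real (c s * ?h s)) has_sum T (tensor (H n))) A"
      using Tc[of "H n", OF H] by (simp add: h)
    from has_sum_Re[OF this]
    have Re: "((\<lambda>s. c s * ?h s) has_sum Re (T (tensor (H n)))) A"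
      by (simp only: Re_complex_of_real)
    have "(\<Sum>s\<in>F n. c s * ?h s) \<le> Re (T (tensor (H n)))"
      using RF(2,3)[of n] c h0 by (intro finite_sum_le_has_sum[OF Re]) auto
    moreover have "(\<Sum>s\<in>F n. c s * (a n * b) ^ ?d) \<le> (\<Sum>s\<in>F n. c s * ?h s)"
      using RF(3)[of n] c hb by (intro sum_mono mult_left_mono) auto
    moreover have "b ^ ?d \<le> (\<Sum>s\<in>F n. c s * (a n * b) ^ ?d)"
    proof -
      have "(real (Suc n) ^ (2 * ?d) * R n ^ (n * ?d)) * (a n * b) ^ ?d \<le> sum c (F n) * (a n * b) ^ ?d"
        using RF(4)[of n] a[of n] b by (intro mult_right_mono) auto
      moreover have "(real (Suc n) ^ (2 * ?d) * R n ^ (n * ?d)) * (a n * b) ^ ?d = (real (Suc n) * b) ^ ?d"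
      proof -
        have "(real (Suc n) ^ (2 * ?d) * R n ^ (n * ?d)) * (a n * b) ^ ?d =
            (real (Suc n) ^ 2 * R n ^ n * (a n * b)) ^ ?d"
          by (simp add: power_mult power_mult_distrib)
        also have "real (Suc n) ^ 2 * R n ^ n * (a n * b) = real (Suc n) * b"
        proof -
          have "q ^ 2 * r * (1 / (q * r) * b) = q * b" if "q > 0" "r > 0" for q r :: real
            using that by (simp add: power2_eq_square)
          then show ?thesis unfolding a_def using Rn[of n] by simp
        qed
        finally show ?thesis .
      qed
      moreover have "b ^ ?d \<le> (real (Suc n) * b) ^ ?d"
        using b by (intro power_mono) (auto simp: algebra_simps)
      ultimately show ?thesis by (simp add: sum_distrib_right)
    qed
    ultimately have "b ^ ?d \<le> Re (T (tensor (H n)))" by linarith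
    then show ?thesis using complex_Re_le_cmod order_trans by blast
  qed
  ultimately show False by (auto simp: eventually_sequentially not_le[symmetric])
qed

text \<open>Points are grouped by the integer part n of their norm. Such a shell carries mass at
  most C (n+1)^K and the denominator is at least (n+1)^(K+2), which leaves the convergent series of
  1/(n+1)^2.\<close>

lemma polynomial_growth_summable:
  fixes A :: "('a::real_normed_vector) set" and c :: "'a \<Rightarrow> real"
  assumes c: "\<And>s. c s \<ge> 0"
    and C: "\<And>R F. R \<ge> 1 \<Longrightarrow> finite F \<Longrightarrow> F \<subseteq> A \<inter> cball 0 R \<Longrightarrow> sum c F \<le> C * R ^ K"
  shows "(\<lambda>s. c s / (1 + norm s) ^ (K + 2)) summable_on A"
proof (rule nonneg_bdd_above_summable_on)
  show "c s / (1 + norm s) ^ (K + 2) \<ge> 0" for s using c by simp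
  have C0: "C \<ge> 0" using C[of 1 "{}"] by simp
  have summ: "summable (\<lambda>n. 1 / real (Suc n) ^ 2)"
    using inverse_power_summable[of 2, where 'a = real] summable_Suc_iff[of "\<lambda>n. 1 / real n ^ 2"]
    by (simp add: inverse_eq_divide del: of_nat_Suc)
  define Z where "Z = (2 ^ K) * C * (\<Sum>n. 1 / real (Suc n) ^ 2)"
  show "bdd_above (sum (\<lambda>s. c s / (1 + norm s) ^ (K + 2)) ` {F. F \<subseteq> A \<and> finite F})"
  proof (rule bdd_aboveI2)
    fix F assume "F \<in> {F. F \<subseteq> A \<and> finite F}"
    then have F: "F \<subseteq> A" "finite F" by auto
    define g where "g s = nat \<lfloor>norm s\<rfloor>" for s :: 'a
    have g: "real (g s) \<le> norm s" "norm s \<le> real (g s) + 1" for s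
      by (auto simp: g_def)
    define M where "M = Suc (Max (insert 0 (g ` F)))"
    have "g s < M" if "s \<in> F" for s using that F by (auto simp: M_def less_Suc_eq_le)
    then have "(\<Sum>s\<in>F. c s / (1 + norm s) ^ (K + 2)) = (\<Sum>n<M. \<Sum>s\<in>{s\<in>F. g s = n}. c s / (1 + norm s) ^ (K + 2))"
      using F by (intro sum.group[symmetric]) auto
    also have "\<dots> \<le> (\<Sum>n<M. (2 ^ K) * C * (1 / real (Suc n) ^ 2))"
    proof (rule sum_mono)
      fix n
      have "(\<Sum>s\<in>{s\<in>F. g s = n}. c s / (1 + norm s) ^ (K + 2)) \<le> (\<Sum>s\<in>{s\<in>F. g s = n}. c s / real (Suc n) ^ (K + 2))"
        using c g(1) by (intro sum_mono divide_left_mono power_mono) (auto intro!: mult_pos_pos zero_less_power add_pos_nonneg)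
      also have "\<dots> = sum c {s\<in>F. g s = n} / real (Suc n) ^ (K + 2)"
        by (simp add: sum_divide_distrib)
      also have "sum c {s\<in>F. g s = n} \<le> C * (real (Suc n)) ^ K"
        using F g(2) by (intro C) (auto simp: add.commute)
      then have "sum c {s\<in>F. g s = n} / real (Suc n) ^ (K + 2) \<le> C * (real (Suc n)) ^ K / real (Suc n) ^ (K + 2)"
        by (intro divide_right_mono) auto
      also have "\<dots> = C * (1 / real (Suc n) ^ 2)"
        by (simp add: power_add power2_eq_square del: of_nat_Suc)
      also have "\<dots> \<le> (2 ^ K) * C * (1 / real (Suc n) ^ 2)"
        using C0 by (intro mult_right_mono) (auto simp: mult_le_cancel_right1)
      finally show "(\<Sum>s\<in>{s\<in>F. g s = n}. c s / (1 + norm s) ^ (K + 2)) \<le> (2 ^ K) * C * (1 / real (Suc n) ^ 2)" .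
    qed
    also have "\<dots> = (2 ^ K) * C * (\<Sum>n<M. 1 / real (Suc n) ^ 2)"
      by (simp add: sum_distrib_left)
    also have "\<dots> \<le> Z"
      unfolding Z_def using C0 by (intro mult_left_mono sum_le_suminf summ) auto
    finally show "(\<Sum>s\<in>F. c s / (1 + norm s) ^ (K + 2)) \<le> Z" .
  qed
qed

lemma one_plus_power_le: "x \<ge> 0 \<Longrightarrow> (1 + x) ^ K \<le> 2 ^ K * (1 + x ^ K)" for x :: real
proof -
  assume x: "x \<ge> 0"
  have "(1 + x) ^ K \<le> (2 * max 1 x) ^ K" using x by (intro power_mono) auto
  also have "\<dots> = 2 ^ K * max 1 x ^ K" by (simp add: power_mult_distrib)
  also have "max 1 x ^ K \<le> 1 + x ^ K" using x by (auto simp: max_def)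
  finally show ?thesis by simp
qed

lemma schwartz_decay:
  assumes "f \<in> schwartz"
  shows "bdd_above (range (\<lambda>x. norm x ^ k * norm (f x)))"
proof -
  have "bounded (range (\<lambda>x. norm x ^ k * norm (deriv_multi (\<lambda>i. 0) f x)))"
    using assms unfolding schwartz_def by blast
  then show ?thesis by (simp add: deriv_multi_0 bounded_imp_bdd_above)
qed

text \<open>The sum is at most a constant times the supremum of
  \<open>(1 + norm s) ^ K * norm (f s)\<close>, and this is controlled by the two seminorms of
  weights 0 and \<open>K\<close> without derivatives.\<close>

lemma tempered_weighted_sum:
  fixes A :: "(real^'d) set" and a :: "real^'d \<Rightarrow> complex"
  assumes W: "(\<lambda>s. norm (a s) / (1 + norm s) ^ K) summable_on A"
  defines "T \<equiv> \<lambda>f. infsum (\<lambda>s. a s * f s) A"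
  shows "tempered T" "\<And>f. f \<in> schwartz \<Longrightarrow> ((\<lambda>s. a s * f s) has_sum T f) A"
proof -
  define w where "w = infsum (\<lambda>s. norm (a s) / (1 + norm s) ^ K) A"
  have w0: "w \<ge> 0" unfolding w_def by (intro infsum_nonneg) auto
  have bound: "(\<lambda>s. norm (a s * f s)) summable_on A" "norm (T f) \<le> w * D"
    if D: "\<And>s. (1 + norm s) ^ K * norm (f s) \<le> D" for f D
  proof -
    have le: "norm (a s * f s) \<le> (norm (a s) / (1 + norm s) ^ K) * D" for s
    proof -
      define p where "p = (1 + norm s) ^ K"
      have p: "p > 0" unfolding p_def by (intro zero_less_power add_pos_nonneg) auto
      then have "norm (a s * f s) = (norm (a s) / p) * (p * norm (f s))"
        by (simp add: norm_mult)
      also have "\<dots> \<le> (norm (a s) / p) * D"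
        using p D[of s] by (intro mult_left_mono) (auto simp: p_def)
      finally show ?thesis by (simp add: p_def)
    qed
    have WD: "((\<lambda>s. (norm (a s) / (1 + norm s) ^ K) * D) has_sum w * D) A"
      unfolding w_def by (intro has_sum_cmult_left has_sum_infsum W)
    show abs: "(\<lambda>s. norm (a s * f s)) summable_on A"
      by (rule summable_on_comparison_test[of "\<lambda>s. (norm (a s) / (1 + norm s) ^ K) * D"])
        (use WD le in \<open>auto simp: summable_on_def\<close>)
    have "norm (T f) \<le> infsum (\<lambda>s. norm (a s * f s)) A"
      unfolding T_def by (rule norm_infsum_bound[OF abs])
    also have "\<dots> \<le> w * D"
      using WD le abs by (intro has_sum_mono[OF has_sum_infsum[OF abs] WD]) auto
    finally show "norm (T f) \<le> w * D" .
  qed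
  have ex: "\<exists>D. \<forall>s. (1 + norm s) ^ K * norm (f s) \<le> D" if f: "f \<in> schwartz" for f :: "real^'d \<Rightarrow> complex"
  proof -
    obtain D0 DK where D: "\<And>s. norm s ^ 0 * norm (f s) \<le> D0" "\<And>s. norm s ^ K * norm (f s) \<le> DK"
      using schwartz_decay[OF f, of 0] schwartz_decay[OF f, of K] unfolding bdd_above_def by blast
    have "(1 + norm s) ^ K * norm (f s) \<le> 2 ^ K * (D0 + DK)" for s
    proof -
      have "(1 + norm s) ^ K * norm (f s) \<le> 2 ^ K * (1 + norm s ^ K) * norm (f s)"
        by (intro mult_right_mono one_plus_power_le) auto
      also have "\<dots> = 2 ^ K * (norm s ^ 0 * norm (f s) + norm s ^ K * norm (f s))"
        by (simp add: algebra_simps)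
      also have "\<dots> \<le> 2 ^ K * (D0 + DK)" by (intro mult_left_mono add_mono D) auto
      finally show ?thesis .
    qed
    then show ?thesis by blast
  qed
  show hs: "((\<lambda>s. a s * f s) has_sum T f) A" if "f \<in> schwartz" for f
    unfolding T_def using ex[OF that] bound(1) abs_summable_summable by (metis has_sum_infsum)
  have diff: "norm (T g - T f) \<le> w * (2 ^ K * (2 * \<epsilon>))"
    if fg: "f \<in> schwartz" "g \<in> schwartz" and e: "schwartz_seminorm 0 (\<lambda>i. 0) (\<lambda>x. g x - f x) < \<epsilon>"
      "schwartz_seminorm K (\<lambda>i. 0) (\<lambda>x. g x - f x) < \<epsilon>" for f g :: "real^'d \<Rightarrow> complex" and \<epsilon>
  proof -
    have le: "norm s ^ k * norm (g s - f s) \<le> schwartz_seminorm k (\<lambda>i. 0) (\<lambda>x. g x - f x)" for k s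
    proof -
      obtain D1 D2 where D: "\<And>s. norm s ^ k * norm (f s) \<le> D1" "\<And>s. norm s ^ k * norm (g s) \<le> D2"
        using schwartz_decay[OF fg(1), of k] schwartz_decay[OF fg(2), of k] unfolding bdd_above_def by blast
      have "norm s ^ k * norm (g s - f s) \<le> D2 + D1" for s
      proof -
        have "norm s ^ k * norm (g s - f s) \<le> norm s ^ k * (norm (g s) + norm (f s))"
          by (intro mult_left_mono norm_triangle_ineq4) auto
        also have "\<dots> \<le> D2 + D1" using D[of s] by (simp add: distrib_left)
        finally show ?thesis .
      qed
      then have "bdd_above (range (\<lambda>s. norm s ^ k * norm (g s - f s)))" by (rule bdd_aboveI2)
      then show ?thesis unfolding schwartz_seminorm_def deriv_multi_0 by (rule cSUP_upper[rotated]) simp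
    qed
    have "norm (T (\<lambda>x. g x - f x)) \<le> w * (2 ^ K * (2 * \<epsilon>))"
    proof (rule bound(2))
      fix s
      have "(1 + norm s) ^ K * norm (g s - f s) \<le> 2 ^ K * (1 + norm s ^ K) * norm (g s - f s)"
        by (intro mult_right_mono one_plus_power_le) auto
      also have "\<dots> = 2 ^ K * (norm s ^ 0 * norm (g s - f s) + norm s ^ K * norm (g s - f s))"
        by (simp add: algebra_simps)
      also have "\<dots> \<le> 2 ^ K * (\<epsilon> + \<epsilon>)"
        using le[of s 0] le[of s K] e by (intro mult_left_mono add_mono) auto
      finally show "(1 + norm s) ^ K * norm (g s - f s) \<le> 2 ^ K * (2 * \<epsilon>)" by simp
    qed
    moreover have "T (\<lambda>x. g x - f x) = T g - T f"
      using has_sum_minus[OF hs[OF fg(2)] hs[OF fg(1)]]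
      by (simp add: T_def right_diff_distrib infsumI)
    ultimately show ?thesis by simp
  qed
  show "tempered T"
    unfolding tempered_def
  proof (intro conjI ballI allI)
    fix f g :: "real^'d \<Rightarrow> complex" assume "f \<in> schwartz" "g \<in> schwartz"
    then show "T (\<lambda>x. f x + g x) = T f + T g"
      using has_sum_add[OF hs hs] by (simp add: T_def distrib_left infsumI)
  next
    fix c and f :: "real^'d \<Rightarrow> complex" assume "f \<in> schwartz"
    then show "T (\<lambda>x. c * f x) = c * T f"
      using has_sum_cmult_right[OF hs, of f c] by (simp add: T_def mult.left_commute infsumI)
  next
    show "continuous_map schwartz_topology euclidean T"
      unfolding continuous_map_def
    proof (intro conjI allI impI)
      fix U :: "complex set" assume "openin euclidean U"
      then have "open U" by simp
      show "openin schwartz_topology {f \<in> topspace schwartz_topology. T f \<in> U}"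
        unfolding openin_schwartz_topology topspace_schwartz_topology
      proof (intro conjI ballI)
        fix f assume f: "f \<in> {f \<in> schwartz. T f \<in> U}"
        then obtain e where e: "e > 0" "ball (T f) e \<subseteq> U" using \<open>open U\<close> open_contains_ball by blast
        \<comment> \<open>The summand 1 keeps \<open>q\<close> positive when \<open>w\<close> is
          0.\<close>
        define q where "q = w * (2 ^ K * 2) + 1"
        have pos: "q > 0" unfolding q_def using w0 by (intro add_nonneg_pos) auto
        define \<epsilon> where "\<epsilon> = e / (2 * q)"
        have \<epsilon>: "\<epsilon> > 0" "w * (2 ^ K * (2 * \<epsilon>)) < e"
        proof -
          show 0: "\<epsilon> > 0" using e pos by (simp add: \<epsilon>_def)
          have "w * (2 ^ K * (2 * \<epsilon>)) \<le> q * \<epsilon>" using 0 by (simp add: algebra_simps q_def)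
          also have "\<dots> = e / 2" using pos by (simp add: \<epsilon>_def)
          finally show "w * (2 ^ K * (2 * \<epsilon>)) < e" using e by simp
        qed
        have "g \<in> {f \<in> schwartz. T f \<in> U}" if g: "g \<in> schwartz" and
          s: "\<forall>k j. k \<le> K \<longrightarrow> multi_norm j \<le> K \<longrightarrow> schwartz_seminorm k j (\<lambda>x. g x - f x) < \<epsilon>" for g
        proof -
          have "multi_norm (\<lambda>i::'d. 0) \<le> K" by (simp add: multi_norm_def)
          then have "norm (T g - T f) \<le> w * (2 ^ K * (2 * \<epsilon>))"
            using s f g by (intro diff) auto
          then have "T g \<in> ball (T f) e" using \<epsilon>(2) by (simp add: dist_norm norm_minus_commute)
          then show ?thesis using e g by auto
        qed
        then show "\<exists>m. \<exists>\<epsilon>>0. \<forall>g\<in>schwartz. (\<forall>k j. k \<le> m \<longrightarrow> multi_norm j \<le> m \<longrightarrow>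
            schwartz_seminorm k j (\<lambda>x. g x - f x) < \<epsilon>) \<longrightarrow> g \<in> {f \<in> schwartz. T f \<in> U}"
          using \<epsilon>(1) by blast
      qed auto
    qed auto
  qed
qed

text \<open>\<open>tempered_ext\<close> is an arbitrary choice that is prescribed on test functions
  only. Density is needed just for tensors, by dilated cut-offs, because the transform of a test
  tensor is a Schwartz tensor.\<close>

lemma tempered_eq_on_tensor:
  fixes H :: "'d::finite \<Rightarrow> real \<Rightarrow> complex"
  assumes T: "tempered T" and S: "tempered S"
    and eq: "\<And>H. (\<And>i. test1 (H i)) \<Longrightarrow> T (tensor H) = S (tensor H)"
    and H: "\<And>i. schwartz1 (H i)"
  shows "T (tensor H) = S (tensor H)"
proof -
  define b where "b = bump 1 (-1) 1 0"
  have "b > 0" by (simp add: b_def bump_pos)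
  \<comment> \<open>Normalised to have the value 1 at 0, as \<open>seminorm_cutoff_tendsto\<close>
    requires.\<close>
  define \<theta> where "\<theta> t = of_real (1 / b) * complex_of_real (bump 1 (-1) 1 t)" for t
  have \<theta>: "test1 \<theta>" unfolding \<theta>_def[abs_def] by (intro test1_mult smooth1_intros test1_bump) simp
  have \<theta>0: "\<theta> 0 = 1" using \<open>b > 0\<close> by (simp add: \<theta>_def b_def)
  define F where "F n i t = H i t * \<theta> (t / real (Suc n))" for n i t
  have F: "test1 (F n i)" for n i
    unfolding F_def[abs_def] using test1_affine[OF \<theta>, of "1 / real (Suc n)" 0]
    by (intro test1_mult schwartz1_smooth1 H) simp
  have *: "(\<lambda>n. V (tensor (F n))) \<longlonglongrightarrow> V (tensor H)" if V: "tempered V" for V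
    using schwartz_tensor[OF H] schwartz_tensor[OF test1_schwartz1[OF F]]
  proof (rule tempered_tendsto[OF V])
    fix k j and \<epsilon> :: real assume "\<epsilon> > 0"
    then show "\<forall>\<^sub>F n in sequentially. schwartz_seminorm k j (\<lambda>x. tensor (F n) x - tensor H x) < \<epsilon>"
      using seminorm_cutoff_tendsto[OF H \<theta> \<theta>0, of \<epsilon> k j] by (simp add: F_def[abs_def])
  qed
  have "T (tensor (F n)) = S (tensor (F n))" for n by (rule eq[OF F])
  then show ?thesis using LIMSEQ_unique[OF *[OF T]] *[OF S] by simp
qed

text \<open>Polynomial growth of the total variation makes the sum over the atoms a tempered
  extension of \<mu>. Whichever extension \<open>tempered_ext\<close> has picked, it agrees with
  this sum on the transform of a test tensor.\<close>

theorem fourier_measure_tensor: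
  fixes \<mu> :: "(real^'d) set \<Rightarrow> complex"
  assumes A: "countable A" "\<And>B. B \<in> bounded_borel \<Longrightarrow> ((\<lambda>s. \<mu> {s}) has_sum \<mu> B) (A \<inter> B)"
    and \<mu>: "radon \<mu>" "tempered_measure (total_variation \<mu>)"
    and H: "\<And>i. test1 (H i)"
  shows "((\<lambda>s. \<mu> {s} * fourier (tensor H) s) has_sum fourier_measure \<mu> (tensor H)) A"
proof -
  obtain V where V: "tempered V" "dist_of_measure V (total_variation \<mu>)"
    using \<mu>(2) by (auto simp: tempered_measure_def)
  have conc: "\<mu> X = 0" if "X \<in> bounded_borel" "X \<inter> A = {}" for X
  proof -
    have "A \<inter> X = {}" using that(2) by auto
    then show ?thesis using A(2)[OF that(1)] has_sum_unique[OF _ has_sum_empty] by simp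
  qed
  have tv: "total_variation \<mu> X = 0" if "X \<in> bounded_borel" "X \<inter> A = {}" for X
  proof -
    have "A \<inter> X = {}" using that(2) by auto
    then show ?thesis
      using atomic_total_variation[OF A that(1)] has_sum_unique[OF _ has_sum_empty] by simp
  qed
  have int: "((\<lambda>s. \<rho> {s} * f s) has_sum radon_integral \<rho> f) A"
    if \<rho>: "radon \<rho>" "\<And>X. X \<in> bounded_borel \<Longrightarrow> X \<inter> A = {} \<Longrightarrow> \<rho> X = 0" and f: "f \<in> test_functions" for \<rho> f
    by (rule test_functions_bounds[OF f]) (rule radon_integral_concentrated[OF \<rho>(1) _ _ _ _ A(1) \<rho>(2)])
  have tvs: "total_variation \<mu> {s} * x = of_real (norm (\<mu> {s})) * x" if "s \<in> A" for s x
  proof -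
    have "A \<inter> {s} = {s}" using that by auto
    then have "((\<lambda>s. complex_of_real (norm (\<mu> {s}))) has_sum total_variation \<mu> {s}) {s}"
      using atomic_total_variation[OF A bounded_borel_intros(5)[of s]] by simp
    then have "total_variation \<mu> {s} = of_real (norm (\<mu> {s}))"
      using has_sum_unique[OF _ has_sum_finite[of "{s}"]] by fastforce
    then show ?thesis by simp
  qed
  have "\<exists>C K. \<forall>R\<ge>1. \<forall>F. finite F \<longrightarrow> F \<subseteq> A \<inter> cball 0 R \<longrightarrow> (\<Sum>s\<in>F. norm (\<mu> {s})) \<le> C * R ^ K"
  proof (rule tempered_polynomial_growth[OF V(1)])
    fix H :: "'d \<Rightarrow> real \<Rightarrow> complex" assume H: "\<And>i. test1 (H i)"
    have t: "tensor H \<in> test_functions" by (rule test_functions_tensor[OF H])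
    have "V (tensor H) = radon_integral (total_variation \<mu>) (tensor H)"
      using V(2) t unfolding dist_of_measure_def by blast
    with int[OF radon_total_variation[OF A] tv t]
    have "((\<lambda>s. total_variation \<mu> {s} * tensor H s) has_sum V (tensor H)) A"
      by (simp only:)
    moreover have "((\<lambda>s. total_variation \<mu> {s} * tensor H s) has_sum V (tensor H)) A \<longleftrightarrow>
        ((\<lambda>s. of_real (norm (\<mu> {s})) * tensor H s) has_sum V (tensor H)) A"
      by (rule has_sum_cong) (rule tvs)
    ultimately show "((\<lambda>s. of_real (norm (\<mu> {s})) * tensor H s) has_sum V (tensor H)) A"
      by blast
  qed simp
  then obtain C K where "\<forall>R\<ge>1. \<forall>F. finite F \<longrightarrow> F \<subseteq> A \<inter> cball 0 R \<longrightarrow> (\<Sum>s\<in>F. norm (\<mu> {s})) \<le> C * R ^ K"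
    by (elim exE)
  note CK = this[rule_format]
  have W: "(\<lambda>s. norm (\<mu> {s}) / (1 + norm s) ^ (K + 2)) summable_on A"
    by (rule polynomial_growth_summable[OF _ CK]) auto
  define T0 where "T0 f = infsum (\<lambda>s. \<mu> {s} * f s) A" for f
  have T0: "tempered T0" "\<And>f. f \<in> schwartz \<Longrightarrow> ((\<lambda>s. \<mu> {s} * f s) has_sum T0 f) A"
    using tempered_weighted_sum[OF W] by (auto simp: T0_def[abs_def])
  have "dist_of_measure T0 \<mu>"
    unfolding dist_of_measure_def T0_def using int[OF \<mu>(1) conc] by (auto simp: infsumI)
  then have "\<exists>T. tempered T \<and> dist_of_measure T \<mu>" using T0(1) by blast
  then have ext: "tempered (tempered_ext \<mu>)" "dist_of_measure (tempered_ext \<mu>) \<mu>"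
    unfolding tempered_ext_def by (metis (mono_tags, lifting) someI_ex)+
  have "tempered_ext \<mu> (tensor (\<lambda>i. ft (H i))) = T0 (tensor (\<lambda>i. ft (H i)))"
  proof (rule tempered_eq_on_tensor[OF ext(1) T0(1) _ schwartz1_ft[OF H]])
    fix H :: "'d \<Rightarrow> real \<Rightarrow> complex" assume "\<And>i. test1 (H i)"
    then show "tempered_ext \<mu> (tensor H) = T0 (tensor H)"
      using ext(2) \<open>dist_of_measure T0 \<mu>\<close> test_functions_tensor[of H] by (simp add: dist_of_measure_def)
  qed
  then show ?thesis
    using T0(2)[OF schwartz_tensor[OF schwartz1_ft[OF H]]]
    by (simp add: fourier_measure_def fourier_dist_def fourier_tensor[OF H])
qed

section \<open>Measures and the support of their distributions\<close>

lemma finite_Int_bounded_discrete: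
  fixes L :: "'a::heine_borel set"
  assumes "closed L" "discrete L" "bounded S"
  shows "finite (L \<inter> S)"
proof -
  have "finite (closure S \<inter> L)"
  proof (rule finite_not_islimpt_in_compact)
    show "compact (closure S)" using assms(3) by (simp add: compact_closure)
    show "\<not> z islimpt L" for z
      using assms(1,2) by (metis closed_limpt discreteD isolated_in_islimpt_iff)
  qed
  then show ?thesis by (rule rev_finite_subset) (use closure_subset in auto)
qed

lemma countable_closed_discrete:
  fixes L :: "'a::{heine_borel, real_normed_vector} set"
  assumes "closed L" "discrete L"
  shows "countable L"
proof -
  have "L = (\<Union>n::nat. L \<inter> ball 0 (real n))"
    using reals_Archimedean2 by (auto simp: dist_norm)
  moreover have "countable (L \<inter> ball 0 (real n))" for n
    by (rule countable_finite[OF finite_Int_bounded_discrete[OF assms bounded_ball]])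
  then have "countable (\<Union>n::nat. L \<inter> ball 0 (real n))" by blast
  ultimately show ?thesis by simp
qed

lemma closed_dist_support: "closed (dist_support T)"
  unfolding dist_support_def by (intro closed_Compl open_Union) auto

section \<open>Boxes and smooth approximations of their indicators\<close>

definition box_bump :: "nat \<Rightarrow> real^'d \<Rightarrow> real^'d \<Rightarrow> real^'d \<Rightarrow> real" where
  "box_bump n a b x = (\<Prod>i\<in>UNIV. bump (real (Suc n)) (a $ i) (b $ i) (x $ i))"

lemma box_bump_tensor:
  "(\<lambda>x. complex_of_real (box_bump n a b x)) =
     tensor (\<lambda>i t. complex_of_real (bump (real (Suc n)) (a $ i) (b $ i) t))"
  unfolding tensor_def box_bump_def by (rule ext, rule of_real_prod)

lemma box_bump_test: "(\<lambda>x. complex_of_real (box_bump n a b x)) \<in> test_functions"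
  unfolding box_bump_tensor by (intro test_functions_tensor test1_bump) simp

lemma box_bump_bounds: "0 \<le> box_bump n a b x" "box_bump n a b x \<le> 1"
  unfolding box_bump_def by (auto intro!: prod_nonneg prod_le_1 simp: bump_bounds)

lemma box_bump_eq_0: "x \<notin> box a b \<Longrightarrow> box_bump n a b x = 0"
proof -
  assume "x \<notin> box a b"
  then obtain i where "\<not> (a $ i < x $ i \<and> x $ i < b $ i)" by (auto simp: mem_box_cart)
  then have "bump (real (Suc n)) (a $ i) (b $ i) (x $ i) = 0" by (intro bump_eq_0) auto
  then show ?thesis unfolding box_bump_def by (intro prod_zero) auto
qed

lemma box_bump_tendsto: "(\<lambda>n. box_bump n a b x) \<longlonglongrightarrow> indicator (box a b) x"
proof -
  have "(\<lambda>n. box_bump n a b x) \<longlonglongrightarrow> (\<Prod>i\<in>UNIV. indicator {a $ i<..<b $ i} (x $ i))"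
    unfolding box_bump_def by (intro tendsto_prod bump_tendsto)
  also have "(\<Prod>i\<in>UNIV. indicator {a $ i<..<b $ i} (x $ i)) = (indicator (box a b) x :: real)"
    by (auto simp: indicator_def mem_box_cart prod_eq_1_iff intro!: prod_zero)
  finally show ?thesis .
qed

lemma box_bump_measurable: "box_bump n a b \<in> borel_measurable borel"
proof -
  have "smooth1 (\<lambda>t. complex_of_real (bump (real (Suc n)) (a $ i) (b $ i) t))" for i
    by (rule smooth1_bump)
  then have "continuous_on UNIV (\<lambda>x. complex_of_real (box_bump n a b x))"
    unfolding box_bump_tensor by (rule continuous_tensor)
  then have "continuous_on UNIV (\<lambda>x. Re (complex_of_real (box_bump n a b x)))"
    by (rule continuous_on_Re)
  then show ?thesis by (simp add: borel_measurable_continuous_onI)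
qed

lemma box_bounded_borel: "box a b \<in> bounded_borel"
  by (simp add: bounded_borel_def bounded_box)

lemma integral_box_bump_tendsto:
  assumes \<kappa>: "sigma_additive \<kappa>"
  shows "(\<lambda>n. LINT x|upper_variation \<kappa>. box_bump n a b x) \<longlonglongrightarrow> measure (upper_variation \<kappa>) (box a b)"
proof -
  let ?V = "upper_variation \<kappa>"
  have fin: "emeasure ?V (box a b) < \<infinity>"
    by (rule emeasure_upper_variation_finite[OF \<kappa> box_bounded_borel])
  have int: "integrable ?V (indicator (box a b) :: _ \<Rightarrow> real)"
    using fin by (simp add: sets_upper_variation[OF \<kappa>])
  have "(\<lambda>n. LINT x|?V. box_bump n a b x) \<longlonglongrightarrow> (LINT x|?V. indicator (box a b) x)"
  proof (rule integral_dominated_convergence[OF _ _ int])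
    show "AE x in ?V. norm (box_bump n a b x) \<le> indicator (box a b) x" for n
    proof (rule AE_I2)
      fix x show "norm (box_bump n a b x) \<le> indicator (box a b) x"
        using box_bump_bounds[of n a b x] box_bump_eq_0[of x a b n] by (simp add: indicator_def)
    qed
    show "box_bump n a b \<in> borel_measurable ?V" for n
      using box_bump_measurable by (simp add: measurable_cong_sets[OF sets_upper_variation[OF \<kappa>] refl])
  qed (use borel_measurable_integrable[OF int] in \<open>auto intro: box_bump_tendsto\<close>)
  then show ?thesis by (simp add: sets_upper_variation[OF \<kappa>] space_upper_variation[OF \<kappa>])
qed

text \<open>Integrals of bumps determine both variations on the open boxes inside
  \<open>box a b\<close>. Boxes are stable under intersection and generate the Borel sets, so the
  variations agree on Borel subsets of \<open>box a b\<close>, and \<kappa> is their difference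
  there.\<close>

lemma sigma_additive_eq_0_in_box:
  fixes a b :: "real^'d"
  assumes \<kappa>: "sigma_additive \<kappa>" "sigma_additive (\<lambda>B. - \<kappa> B)"
    and eq: "\<And>c d n. cbox c d \<subseteq> cbox a b \<Longrightarrow>
       (LINT x|upper_variation \<kappa>. box_bump n c d x) = (LINT x|upper_variation (\<lambda>B. - \<kappa> B). box_bump n c d x)"
    and X: "X \<in> sets borel" "X \<subseteq> box a b"
  shows "\<kappa> X = 0"
proof -
  let ?V = "upper_variation \<kappa>" and ?W = "upper_variation (\<lambda>B. - \<kappa> B)"
  note sV = sets_upper_variation[OF \<kappa>(1)] and sW = sets_upper_variation[OF \<kappa>(2)]
  have fV: "emeasure ?V B = ennreal (measure ?V B)" "emeasure ?W B = ennreal (measure ?W B)"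
    if "B \<in> bounded_borel" for B
    using emeasure_upper_variation_finite[OF \<kappa>(1) that] emeasure_upper_variation_finite[OF \<kappa>(2) that]
    by (auto intro!: emeasure_eq_ennreal_measure)
  have box: "emeasure ?V (box c d) = emeasure ?W (box c d)" if "box c d \<subseteq> box a b" for c d
  proof (cases "box c d = {}")
    case False
    then have "cbox c d \<subseteq> cbox a b"
      using that closure_mono[OF that] by (metis closure_box box_eq_empty(1) subset_empty)
    then have "(\<lambda>n. LINT x|?V. box_bump n c d x) \<longlonglongrightarrow> measure ?W (box c d)"
      using integral_box_bump_tendsto[OF \<kappa>(2), of c d] eq by simp
    with integral_box_bump_tendsto[OF \<kappa>(1)]
    have "measure ?V (box c d) = measure ?W (box c d)"
      by (rule LIMSEQ_unique)
    then show ?thesis using fV[OF box_bounded_borel] by simp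
  qed simp
  \<comment> \<open>Cutting down to \<open>box a b\<close> makes both measures finite and reduces
    arbitrary boxes to boxes inside \<open>box a b\<close>.\<close>
  let ?M = "density ?V (indicator (box a b))" and ?N = "density ?W (indicator (box a b))"
  have e: "emeasure ?M B = emeasure ?V (box a b \<inter> B)" "emeasure ?N B = emeasure ?W (box a b \<inter> B)"
    if "B \<in> sets borel" for B
    using that by (auto intro!: emeasure_restricted simp: sV sW)
  have "?M = ?N"
  proof (rule measure_eqI_generator_eq)
    let ?E = "range (\<lambda>(a, b). box a b::(real^'d) set)"
    show "Int_stable ?E" by (auto simp: Int_stable_def box_Int_box)
    show "?E \<subseteq> Pow UNIV" "sets ?M = sigma_sets UNIV ?E" "sets ?N = sigma_sets UNIV ?E"
      by (simp_all add: borel_eq_box sV sW)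
    let ?A = "\<lambda>n::nat. box (- (real n *\<^sub>R One)) (real n *\<^sub>R One) :: (real^'d) set"
    show "range ?A \<subseteq> ?E" "(\<Union>i. ?A i) = UNIV"
      unfolding UN_box_eq_UNIV by auto
    have "box a b \<inter> ?A i \<in> bounded_borel" for i
      by (intro bounded_borel_intros box_bounded_borel) auto
    then show "emeasure ?M (?A i) \<noteq> \<infinity>" for i
      using fV(1) by (simp add: e)
    show "emeasure ?M B = emeasure ?N B" if B: "B \<in> ?E" for B
    proof -
      obtain c d where cd: "B = box c d" using B by auto
      have "emeasure ?V (box a b \<inter> box c d) = emeasure ?W (box a b \<inter> box c d)"
        unfolding box_Int_box by (rule box) (auto simp: box_Int_box[symmetric])
      then show ?thesis using cd by (simp add: e)
    qed
  qed
  then have "emeasure ?M X = emeasure ?N X" by simp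
  moreover have "box a b \<inter> X = X" using X by auto
  ultimately have "emeasure ?V X = emeasure ?W X" using e[OF X(1)] by simp
  moreover have "X \<in> bounded_borel" by (rule bounded_borel_subset[OF box_bounded_borel X])
  ultimately show ?thesis
    using jordan_decomposition[OF \<kappa>] by (simp add: measure_def)
qed

lemma radon_eq_0_in_box:
  fixes a b :: "real^'d"
  assumes \<rho>: "radon \<rho>" "dist_of_measure T \<rho>"
    and U: "cbox a b \<subseteq> U" "\<And>f. f \<in> test_functions \<Longrightarrow> closure {x. f x \<noteq> 0} \<subseteq> U \<Longrightarrow> T f = 0"
    and X: "X \<in> sets borel" "X \<subseteq> box a b"
  shows "\<rho> X = 0"
proof -
  note sg = sigma_additive_radon[OF \<rho>(1)]
  have *: "(LINT x|upper_variation (\<lambda>B. Re (\<rho> B)). box_bump n c d x) = (LINT x|upper_variation (\<lambda>B. - Re (\<rho> B)). box_bump n c d x)"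
      "(LINT x|upper_variation (\<lambda>B. Im (\<rho> B)). box_bump n c d x) = (LINT x|upper_variation (\<lambda>B. - Im (\<rho> B)). box_bump n c d x)"
    if cd: "cbox c d \<subseteq> cbox a b" for c d n
  proof -
    let ?f = "\<lambda>x. complex_of_real (box_bump n c d x)"
    have "{x. ?f x \<noteq> 0} \<subseteq> cbox c d"
      using box_bump_eq_0[of _ c d n] box_subset_cbox by fastforce
    then have "closure {x. ?f x \<noteq> 0} \<subseteq> cbox c d" by (intro closure_minimal) auto
    then have "T ?f = 0" using U(1) cd by (intro U(2) box_bump_test) auto
    then have 0: "radon_integral \<rho> ?f = 0"
      using \<rho>(2) box_bump_test unfolding dist_of_measure_def by metis
    have "of_real (LINT x|upper_variation (\<lambda>B. Re (\<rho> B)). box_bump n c d x) - of_real (LINT x|upper_variation (\<lambda>B. - Re (\<rho> B)). box_bump n c d x)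
      + \<i> * (of_real (LINT x|upper_variation (\<lambda>B. Im (\<rho> B)). box_bump n c d x) - of_real (LINT x|upper_variation (\<lambda>B. - Im (\<rho> B)). box_bump n c d x)) = 0"
      using 0 unfolding radon_integral_def by (simp only: integral_complex_of_real)
    then show "(LINT x|upper_variation (\<lambda>B. Re (\<rho> B)). box_bump n c d x) = (LINT x|upper_variation (\<lambda>B. - Re (\<rho> B)). box_bump n c d x)"
      "(LINT x|upper_variation (\<lambda>B. Im (\<rho> B)). box_bump n c d x) = (LINT x|upper_variation (\<lambda>B. - Im (\<rho> B)). box_bump n c d x)"
      by (auto simp: complex_eq_iff)
  qed
  have "Re (\<rho> X) = 0" "Im (\<rho> X) = 0"
    using * by (auto intro!: sigma_additive_eq_0_in_box[OF sg(1,2) _ X] sigma_additive_eq_0_in_box[OF sg(3,4) _ X])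
  then show ?thesis by (simp add: complex_eq_iff)
qed

text \<open>By Lindelof the complement of the support is a countable union of boxes on which the
  measure vanishes, and countable additivity does the rest. Arguing with the measure instead of the
  distribution avoids a partition of unity.\<close>

lemma radon_eq_0_off_support:
  fixes X :: "(real^'d) set"
  assumes \<rho>: "radon \<rho>" "dist_of_measure T \<rho>"
    and X: "X \<in> bounded_borel" "X \<inter> dist_support T = {}"
  shows "\<rho> X = 0"
proof -
  define \<F> where "\<F> = {box a b | a b. \<exists>U. cbox a b \<subseteq> U \<and>
     (\<forall>f\<in>test_functions. closure {x. f x \<noteq> 0} \<subseteq> U \<longrightarrow> T f = 0)}"
  have "open S" if "S \<in> \<F>" for S using that by (auto simp: \<F>_def)
  then obtain \<F>' where F': "\<F>' \<subseteq> \<F>" "countable \<F>'" "\<Union>\<F>' = \<Union>\<F>"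
    by (rule Lindelof[of \<F>])
  have "X \<subseteq> \<Union>\<F>"
  proof
    fix x assume "x \<in> X"
    then have "x \<notin> dist_support T" using X(2) by auto
    then obtain U where U: "open U" "x \<in> U" "\<forall>f\<in>test_functions. closure {x. f x \<noteq> 0} \<subseteq> U \<longrightarrow> T f = 0"
      by (auto simp: dist_support_def)
    obtain a b where ab: "x \<in> box a b" "cbox a b \<subseteq> U"
      using U(1,2) by (metis open_contains_cbox)
    then show "x \<in> \<Union>\<F>" using U(3) unfolding \<F>_def by blast
  qed
  then have cover: "X \<subseteq> \<Union>\<F>'" using F'(3) by simp
  have zero: "\<rho> Y = 0" if "Y \<in> sets borel" "Y \<subseteq> Q" "Q \<in> \<F>'" for Y Q
  proof -
    obtain a b U where "Q = box a b" "cbox a b \<subseteq> U" "\<forall>f\<in>test_functions. closure {x. f x \<noteq> 0} \<subseteq> U \<longrightarrow> T f = 0"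
      using F'(1) \<open>Q \<in> \<F>'\<close> unfolding \<F>_def by blast
    then show ?thesis using radon_eq_0_in_box[OF \<rho>, of a b U Y] that by blast
  qed
  have op: "Q \<in> sets borel" if "Q \<in> \<F>'" for Q
    using that F'(1) by (auto simp: \<F>_def)
  show ?thesis
  proof (cases "\<F>' = {}")
    case True
    then have "X = {}" using cover by auto
    then have "Re (\<rho> X) = 0" "Im (\<rho> X) = 0"
      using sigma_additive_empty[OF sigma_additive_radon(1)[OF \<rho>(1)]]
        sigma_additive_empty[OF sigma_additive_radon(3)[OF \<rho>(1)]] by auto
    then show ?thesis by (simp add: complex_eq_iff)
  next
    case False
    define Q where "Q n = from_nat_into \<F>' n" for n
    have Q: "Q n \<in> \<F>'" for n unfolding Q_def by (rule from_nat_into[OF False])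
    have rQ: "(\<Union>n. Q n) = \<Union>\<F>'"
      unfolding Q_def using range_from_nat_into[OF False F'(2)] by auto
    define Y where "Y n = X \<inter> disjointed Q n" for n
    have dis: "disjointed Q n \<in> sets borel" for n
      using sets.range_disjointed_sets[of Q borel] op Q by auto
    have "(\<Union>n. Y n) = X" unfolding Y_def using cover rQ UN_disjointed_eq[of Q] by auto
    moreover have "(\<lambda>n. \<rho> (Y n)) sums \<rho> (\<Union>n. Y n)"
    proof -
      have "range Y \<subseteq> bounded_borel" unfolding Y_def using X(1) dis by (auto intro: bounded_borel_intros)
      moreover have "disjoint_family Y"
        using disjoint_family_disjointed[of Q] by (auto simp: Y_def disjoint_family_on_def)
      moreover have "bounded (\<Union>n. Y n)"
        using X(1) \<open>(\<Union>n. Y n) = X\<close> by (simp add: bounded_borel_def)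
      ultimately show ?thesis using \<rho>(1) unfolding radon_def by blast
    qed
    moreover have "\<rho> (Y n) = 0" for n
    proof (rule zero[OF _ _ Q])
      show "Y n \<in> sets borel" unfolding Y_def using X(1) dis by (auto simp: bounded_borel_borel)
      show "Y n \<subseteq> Q n" using disjointed_subset[of Q n] by (auto simp: Y_def)
    qed
    ultimately have "(\<lambda>n. 0) sums \<rho> X" by (simp only:)
    then show ?thesis using sums_unique2[OF sums_zero] by metis
  qed
qed

lemma radon_eq_sum:
  fixes \<rho> :: "'a::euclidean_space set \<Rightarrow> complex"
  assumes \<rho>: "radon \<rho>" and F: "finite F"
  shows "\<rho> F = (\<Sum>s\<in>F. \<rho> {s})"
  using F
proof (induction rule: finite_induct)
  case empty
  have "Re (\<rho> {}) = 0" "Im (\<rho> {}) = 0"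
    using sigma_additive_empty[OF sigma_additive_radon(1)[OF \<rho>]]
      sigma_additive_empty[OF sigma_additive_radon(3)[OF \<rho>]] by auto
  then show ?case by (simp add: complex_eq_iff)
next
  case (insert s F)
  have F: "F \<in> bounded_borel" using insert(1)
    by (auto simp: bounded_borel_def finite_imp_bounded intro: borel_closed finite_imp_closed)
  have "\<kappa> ({s} \<union> F) = \<kappa> {s} + \<kappa> F" if "sigma_additive \<kappa>" for \<kappa> :: "'a set \<Rightarrow> real"
    using insert(2) F by (intro sigma_additive_Un[OF that]) (auto simp: bounded_borel_intros)
  from this[OF sigma_additive_radon(1)[OF \<rho>]] this[OF sigma_additive_radon(3)[OF \<rho>]]
  have "\<rho> ({s} \<union> F) = \<rho> {s} + \<rho> F" by (simp add: complex_eq_iff)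
  then show ?case using insert by simp
qed

section \<open>Absolutely convergent exponential sums\<close>

text \<open>\<open>y\<close> is the variable, \<open>s\<close> the frequency.\<close>

definition wave :: "'a::real_inner \<Rightarrow> 'a \<Rightarrow> complex" where
  "wave y s = exp (- 2 * pi * \<i> * of_real (y \<bullet> s))"

definition exp_sum_of :: "('a::real_inner \<Rightarrow> complex) \<Rightarrow> 'a set \<Rightarrow> ('a \<Rightarrow> complex) \<Rightarrow> bool" where
  "exp_sum_of b A G \<longleftrightarrow> (\<lambda>s. norm (b s)) summable_on A \<and> (\<forall>y. ((\<lambda>s. b s * wave y s) has_sum G y) A)"

lemma norm_wave [simp]: "norm (wave y s) = 1"
  unfolding wave_def norm_exp_eq_Re by simp

lemma wave_add: "wave (y + z) s = wave y s * wave z s"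
  by (simp add: wave_def exp_add[symmetric] inner_add_left algebra_simps)

text \<open>At \<open>y = 0\<close> all waves are 1, and a summable family of complex numbers is
  absolutely summable.\<close>

lemma exp_sum_ofI:
  assumes "\<And>y. ((\<lambda>s. b s * wave y s) has_sum G y) A"
  shows "exp_sum_of b A G"
proof -
  have "((\<lambda>s. b s * wave 0 s) has_sum G 0) A" by (rule assms)
  then have "b summable_on A" by (auto simp: wave_def summable_on_def)
  then show ?thesis
    using assms by (auto simp: exp_sum_of_def summable_on_iff_abs_summable_on_complex)
qed

lemma exp_sum_of_bounded:
  assumes "exp_sum_of b A G"
  shows "norm (G y) \<le> infsum (\<lambda>s. norm (b s)) A"
proof (rule norm_infsum_le)
  show "((\<lambda>s. b s * wave y s) has_sum G y) A" using assms by (simp add: exp_sum_of_def)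
  show "((\<lambda>s. norm (b s)) has_sum infsum (\<lambda>s. norm (b s)) A) A"
    using assms by (intro has_sum_infsum) (simp add: exp_sum_of_def)
qed (simp add: norm_mult)

text \<open>To eliminate a frequency \<open>s1\<close>, average over two points at distance \<open>v\<close>, where
  \<open>(s0 - s1) \<bullet> v = 1/2\<close>, after multiplication by the wave with frequency \<open>- s0\<close>.\<close>

lemma coefficient_bound:
  fixes s0 :: "'a::real_inner"
  assumes "finite F" "s0 \<notin> F"
  shows "\<exists>R\<ge>0. \<forall>b A G M y. exp_sum_of b A G \<longrightarrow> s0 \<in> A \<longrightarrow> (\<forall>u\<in>cball y R. norm (G u) \<le> M) \<longrightarrow>
     norm (b s0) \<le> M + infsum (\<lambda>s. norm (b s)) (A - insert s0 F)"
  using assms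
proof (induction rule: finite_induct)
  case empty
  have "norm (b s0) \<le> M + infsum (\<lambda>s. norm (b s)) (A - {s0})"
    if e: "exp_sum_of b A G" and s0: "s0 \<in> A" and M: "\<forall>u\<in>cball y 0. norm (G u) \<le> M"
    for b A M y and G :: "'a \<Rightarrow> complex"
  proof -
    have 1: "((\<lambda>s. b s * wave y s) has_sum G y) A" using e by (simp add: exp_sum_of_def)
    have "((\<lambda>s. b s * wave y s) has_sum (b s0 * wave y s0)) {s0}"
      by (rule has_sum_finiteI) simp_all
    with 1 have "((\<lambda>s. b s * wave y s) has_sum (G y - b s0 * wave y s0)) (A - {s0})"
      by (rule has_sum_Diff) (use s0 in simp)
    moreover have "((\<lambda>s. norm (b s)) has_sum infsum (\<lambda>s. norm (b s)) (A - {s0})) (A - {s0})"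
      using e unfolding exp_sum_of_def by (blast intro: has_sum_infsum summable_on_subset_banach)
    ultimately have "norm (G y - b s0 * wave y s0) \<le> infsum (\<lambda>s. norm (b s)) (A - {s0})"
      by (rule norm_infsum_le) (simp add: norm_mult)
    moreover have "norm (b s0) = norm (b s0 * wave y s0)" by (simp add: norm_mult)
    moreover have "norm (b s0 * wave y s0) \<le> norm (G y) + norm (G y - b s0 * wave y s0)"
      by (metis norm_minus_commute norm_triangle_sub)
    moreover have "norm (G y) \<le> M" using M by simp
    ultimately show ?thesis by linarith
  qed
  then show ?case by (intro exI[of _ 0]) auto
next
  case (insert s1 F)
  have "s0 \<notin> F" using insert by simp
  \<comment> \<open>\<open>R\<close> precedes \<open>b\<close>, \<open>A\<close>, \<open>G\<close>
    and \<open>M\<close>. Hence the induction hypothesis applies to the modified coefficients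
    \<open>b s * c s\<close>, and the radius can be fixed before a window is known.\<close>
  from insert.IH[OF this] obtain R where R: "R \<ge> 0"
    and "\<forall>b A G M y. exp_sum_of b A G \<longrightarrow> s0 \<in> A \<longrightarrow> (\<forall>u\<in>cball y R. norm (G u) \<le> M) \<longrightarrow>
      norm (b s0) \<le> M + infsum (\<lambda>s. norm (b s)) (A - insert s0 F)"
    by (elim exE conjE)
  note IH = this(2)[THEN spec, THEN spec, THEN spec, THEN spec, THEN spec, THEN mp, THEN mp, THEN mp]
  have ne: "s0 - s1 \<noteq> 0" using insert by auto
  \<comment> \<open>Parallel to \<open>s0 - s1\<close>, of the length for which the wave with
    frequency \<open>s1 - s0\<close> equals -1 at \<open>v\<close>.\<close>
  define v where "v = (1 / (2 * ((s0 - s1) \<bullet> (s0 - s1)))) *\<^sub>R (s0 - s1)"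
  have v: "v \<bullet> (s1 - s0) = - 1 / 2"
  proof -
    have "(s0 - s1) \<bullet> (s1 - s0) = - ((s0 - s1) \<bullet> (s0 - s1))"
      by (metis inner_minus_right minus_diff_eq)
    then have "v \<bullet> (s1 - s0) = - (1 / (2 * ((s0 - s1) \<bullet> (s0 - s1))) * ((s0 - s1) \<bullet> (s0 - s1)))"
      unfolding v_def inner_scaleR_left by (simp only: mult_minus_right)
    also have "\<dots> = - 1 / 2"
    proof -
      have "(s0 - s1) \<bullet> (s0 - s1) \<noteq> 0" using ne by simp
      then show ?thesis by (simp only: field_simps) simp
    qed
    finally show ?thesis .
  qed
  \<comment> \<open>The multiplier that the averaging applies to the coefficient at
    \<open>s\<close>.\<close>
  define c where "c s = (1 + wave v (s - s0)) / 2" for s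
  have c0: "c s0 = 1" by (simp add: c_def wave_def)
  have c1: "c s1 = 0"
  proof -
    have "wave v (s1 - s0) = exp (of_real pi * \<i>)" unfolding wave_def v by simp
    then have "wave v (s1 - s0) = - 1" by (simp only: exp_pi_i)
    then show ?thesis unfolding c_def by simp
  qed
  have cle: "norm (c s) \<le> 1" for s
    using norm_triangle_ineq[of 1 "wave v (s - s0)"] by (simp add: c_def norm_divide)
  have "norm (b s0) \<le> M + infsum (\<lambda>s. norm (b s)) (A - insert s0 (insert s1 F))"
    if e: "exp_sum_of b A G" and s0: "s0 \<in> A" and M: "\<forall>u\<in>cball y (R + norm v). norm (G u) \<le> M"
    for b A M y and G :: "'a \<Rightarrow> complex"
  proof -
    define G' where "G' u = (G u + wave (- v) s0 * G (u + v)) / 2" for u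
    have abs: "(\<lambda>s. norm (b s)) summable_on A" using e by (simp add: exp_sum_of_def)
    have "exp_sum_of (\<lambda>s. b s * c s) A G'"
    proof (rule exp_sum_ofI)
      fix u
      have "((\<lambda>s. b s * wave u s + wave (- v) s0 * (b s * wave (u + v) s)) has_sum (G u + wave (- v) s0 * G (u + v))) A"
        using e by (intro has_sum_add has_sum_cmult_right) (auto simp: exp_sum_of_def)
      from has_sum_cmult_right[OF this, of "1/2"]
      have "((\<lambda>s. 1 / 2 * (b s * wave u s + wave (- v) s0 * (b s * wave (u + v) s))) has_sum G' u) A"
        by (simp add: G'_def)
      moreover have "1 / 2 * (b s * wave u s + wave (- v) s0 * (b s * wave (u + v) s)) = b s * c s * wave u s" for s
      proof -
        have "wave (- v) s0 * wave v s = wave v (s - s0)"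
          by (simp add: wave_def exp_add[symmetric] inner_diff_right algebra_simps)
        moreover have "wave (- v) s0 * (b s * wave (u + v) s) = b s * wave u s * (wave (- v) s0 * wave v s)"
          unfolding wave_add by (simp only: mult_ac)
        ultimately have "wave (- v) s0 * (b s * wave (u + v) s) = b s * wave u s * wave v (s - s0)"
          by (simp only:)
        then show ?thesis by (simp add: c_def algebra_simps add_divide_distrib)
      qed
      ultimately show "((\<lambda>s. b s * c s * wave u s) has_sum G' u) A" by (simp only:)
    qed
    moreover have "\<forall>u\<in>cball y R. norm (G' u) \<le> M"
    proof
      fix u assume u: "u \<in> cball y R"
      have "dist y (u + v) \<le> dist y u + norm v"
        using dist_triangle[of y "u + v" u] by (simp add: dist_norm)
      then have "u \<in> cball y (R + norm v)" "u + v \<in> cball y (R + norm v)"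
        using u norm_ge_zero[of v] unfolding mem_cball by linarith+
      then have "norm (G u) \<le> M" "norm (G (u + v)) \<le> M" using M by blast+
      moreover have "norm (G' u) \<le> (norm (G u) + norm (G (u + v))) / 2"
        using norm_triangle_ineq[of "G u" "wave (- v) s0 * G (u + v)"]
        by (simp add: G'_def norm_divide norm_mult)
      ultimately show "norm (G' u) \<le> M" by simp
    qed
    ultimately have "norm (b s0 * c s0) \<le> M + infsum (\<lambda>s. norm (b s * c s)) (A - insert s0 F)"
      using s0 by (intro IH)
    \<comment> \<open>The term at \<open>s1\<close> is 0 by now, so \<open>s1\<close> may be taken
      out of the sum.\<close>
    also have "infsum (\<lambda>s. norm (b s * c s)) (A - insert s0 F) = infsum (\<lambda>s. norm (b s * c s)) (A - insert s0 (insert s1 F))"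
      by (rule infsum_cong_neutral) (auto simp: c1)
    also have "\<dots> \<le> infsum (\<lambda>s. norm (b s)) (A - insert s0 (insert s1 F))"
    proof (rule infsum_mono)
      show s: "(\<lambda>s. norm (b s)) summable_on A - insert s0 (insert s1 F)"
        by (rule summable_on_subset_banach[OF abs]) auto
      have "norm (b s * c s) \<le> norm (b s)" for s
        using mult_left_mono[OF cle[of s], of "norm (b s)"] by (simp add: norm_mult)
      then show "\<And>s. norm (b s * c s) \<le> norm (b s)" .
      then show "(\<lambda>s. norm (b s * c s)) summable_on A - insert s0 (insert s1 F)"
        by (intro summable_on_comparison_test[OF s]) auto
    qed
    finally show ?thesis by (simp add: c0)
  qed
  then show ?case using R by (intro exI[of _ "R + norm v"]) auto
qed

lemma infsum_tail_small:
  fixes f :: "'a \<Rightarrow> real"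
  assumes f: "f summable_on A" "\<And>x. f x \<ge> 0" and e: "\<epsilon> > 0"
  obtains F where "finite F" "F \<subseteq> A" "infsum f (A - F) \<le> \<epsilon>"
proof -
  have "(sum f \<longlongrightarrow> infsum f A) (finite_subsets_at_top A)"
    using has_sum_infsum[OF f(1)] by (simp add: has_sum_def)
  then have "\<forall>\<^sub>F F in finite_subsets_at_top A. dist (sum f F) (infsum f A) < \<epsilon>"
    using e by (rule tendstoD)
  then obtain F where F: "finite F" "F \<subseteq> A" "dist (sum f F) (infsum f A) < \<epsilon>"
    unfolding eventually_finite_subsets_at_top by blast
  have "infsum f (A - F) = infsum f A - sum f F"
    using infsum_Diff[OF f(1) summable_on_finite[OF F(1)] F(2)] F(1) by simp
  then show thesis using F by (intro that[of F]) (auto simp: dist_real_def)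
qed

section \<open>Almost periods\<close>

lemma almost_periods:
  assumes e: "exp_sum_of b A G" and "\<epsilon> > 0"
  shows "\<exists>F \<kappa>. finite F \<and> \<kappa> > 0 \<and> (\<forall>\<tau>. (\<forall>s\<in>F. norm (wave \<tau> s - 1) \<le> \<kappa>) \<longrightarrow> (\<forall>y. norm (G (y + \<tau>) - G y) \<le> \<epsilon>))"
proof -
  have abs: "(\<lambda>s. norm (b s)) summable_on A" using e by (simp add: exp_sum_of_def)
  \<comment> \<open>A shift changes each term by at most \<open>2 * norm (b s)\<close>, so the tail
    uses up half of \<epsilon>; the frequencies in \<open>F\<close> get the other half.\<close>
  obtain F where F: "finite F" "F \<subseteq> A" "infsum (\<lambda>s. norm (b s)) (A - F) \<le> \<epsilon> / 4"
    by (rule infsum_tail_small[OF abs, of "\<epsilon> / 4"]) (use \<open>\<epsilon> > 0\<close> in auto)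
  define S where "S = (\<Sum>s\<in>F. norm (b s))"
  have S: "S \<ge> 0" by (simp add: S_def sum_nonneg)
  \<comment> \<open>\<open>S + 1\<close> because \<open>S\<close> may be 0.\<close>
  define \<kappa> where "\<kappa> = \<epsilon> / (2 * (S + 1))"
  have \<kappa>: "\<kappa> > 0" "\<kappa> * S \<le> \<epsilon> / 2"
    using S \<open>\<epsilon> > 0\<close> by (auto simp: \<kappa>_def field_simps)
  have "norm (G (y + \<tau>) - G y) \<le> \<epsilon>" if \<tau>: "\<forall>s\<in>F. norm (wave \<tau> s - 1) \<le> \<kappa>" for \<tau> y
  proof -
    have "((\<lambda>s. b s * wave (y + \<tau>) s + (- 1) * (b s * wave y s)) has_sum (G (y + \<tau>) + (- 1) * G y)) A"
      using e by (intro has_sum_add has_sum_cmult_right) (auto simp: exp_sum_of_def)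
    moreover have "(\<lambda>s. b s * wave (y + \<tau>) s + (- 1) * (b s * wave y s)) = (\<lambda>s. b s * wave y s * (wave \<tau> s - 1))"
      by (simp add: fun_eq_iff wave_add algebra_simps)
    ultimately have d: "((\<lambda>s. b s * wave y s * (wave \<tau> s - 1)) has_sum (G (y + \<tau>) - G y)) A" by simp
    let ?g = "\<lambda>s. norm (b s) * (if s \<in> F then \<kappa> else 2)"
    have "((\<lambda>s. norm (b s) * \<kappa>) has_sum (S * \<kappa>)) F"
      unfolding S_def by (intro has_sum_cmult_left has_sum_finite F)
    then have 1: "(?g has_sum (S * \<kappa>)) F" by (subst has_sum_cong[where g = "\<lambda>s. norm (b s) * \<kappa>"]) auto
    have "((\<lambda>s. norm (b s)) has_sum infsum (\<lambda>s. norm (b s)) (A - F)) (A - F)"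
      by (intro has_sum_infsum summable_on_subset_banach[OF abs]) auto
    then have "((\<lambda>s. norm (b s) * 2) has_sum (infsum (\<lambda>s. norm (b s)) (A - F) * 2)) (A - F)"
      by (rule has_sum_cmult_left)
    then have 2: "(?g has_sum (infsum (\<lambda>s. norm (b s)) (A - F) * 2)) (A - F)"
      by (subst has_sum_cong[where g = "\<lambda>s. norm (b s) * 2"]) auto
    have "F \<union> (A - F) = A" using F by auto
    then have g: "(?g has_sum (S * \<kappa> + infsum (\<lambda>s. norm (b s)) (A - F) * 2)) A"
      using has_sum_Un_disjoint[OF 1 2] by auto
    have "norm (G (y + \<tau>) - G y) \<le> S * \<kappa> + infsum (\<lambda>s. norm (b s)) (A - F) * 2"
    proof (rule norm_infsum_le[OF d g])
      fix s
      have "norm (wave \<tau> s - 1) \<le> 2" using norm_triangle_ineq4[of "wave \<tau> s" 1] by simp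
      then show "norm (b s * wave y s * (wave \<tau> s - 1)) \<le> ?g s"
        using \<tau> by (auto simp: norm_mult intro!: mult_left_mono)
    qed
    also have "\<dots> \<le> \<epsilon>" using F(3) \<kappa>(2) by (simp add: mult.commute)
    finally show ?thesis .
  qed
  then show ?thesis using F(1) \<kappa>(1) by blast
qed

lemma norm_wave_diff_le: "norm (wave \<tau> s - 1) \<le> 2 * pi * \<bar>\<tau> \<bullet> s - of_int k\<bar>"
proof -
  define t where "t = - (2 * pi * (\<tau> \<bullet> s - of_int k))"
  have "wave \<tau> s = exp (\<i> * of_real t) * exp (- (2 * of_int k * pi * \<i>))"
    by (simp add: wave_def t_def exp_add[symmetric] algebra_simps)
  also have "exp (- (2 * of_int k * pi * \<i>)) = 1"
    using exp_integer_2pi[of "- of_int k"] by (simp add: mult_ac)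
  finally have "norm (wave \<tau> s - 1) = 2 * \<bar>sin (t / 2)\<bar>"
    using dist_exp_i_1[of t] by simp
  also have "\<dots> \<le> 2 * \<bar>t / 2\<bar>" using abs_sin_x_le_abs_x[of "t / 2"] by simp
  also have "\<dots> = 2 * pi * \<bar>\<tau> \<bullet> s - of_int k\<bar>" by (simp add: t_def abs_mult)
  finally show ?thesis .
qed

text \<open>Pigeonhole: the fractional parts of \<open>x \<bullet> s\<close>, \<open>s \<in> F\<close>, fall into one of finitely many cells.\<close>

lemma relatively_dense_periods:
  fixes F :: "'a::real_inner set"
  assumes F: "finite F" and \<kappa>: "\<kappa> > 0"
  shows "\<exists>L\<ge>0. \<forall>x. \<exists>\<tau>\<in>cball x L. \<forall>s\<in>F. norm (wave \<tau> s - 1) \<le> \<kappa>"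
proof -
  \<comment> \<open>\<open>N\<close> is the number of cells per frequency: points of one cell have
    waves that differ by at most 2 pi/N, which is below \<kappa>.\<close>
  obtain N where N: "real N * \<kappa> > 2 * pi" using ex_less_of_nat_mult[OF \<kappa>] by blast
  have N0: "N > 0" using N pi_gt_zero by (cases N) auto
  define cell where "cell x = (\<lambda>s\<in>F. \<lfloor>real N * frac (x \<bullet> s)\<rfloor>)" for x :: 'a
  have "cell x \<in> (\<Pi>\<^sub>E s\<in>F. {0..<int N})" for x
  proof -
    have "\<lfloor>real N * frac (x \<bullet> s)\<rfloor> < int N" for s
      using N0 frac_lt_1[of "x \<bullet> s"] by (subst floor_less_iff) simp
    then show ?thesis by (auto simp: cell_def frac_ge_0)
  qed
  then have "range cell \<subseteq> (\<Pi>\<^sub>E s\<in>F. {0..<int N})" by (rule image_subsetI)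
  moreover have "finite (\<Pi>\<^sub>E s\<in>F. {0..<int N})" by (rule finite_PiE[OF F]) simp
  ultimately have fin: "finite (range cell)" by (rule finite_subset)
  \<comment> \<open>One point for each occupied cell. Subtracting from \<open>x\<close> the
    representative of its cell gives a period near \<open>x\<close>; as there are finitely many
    representatives, one \<open>L\<close> serves all \<open>x\<close>.\<close>
  define rep where "rep c = (SOME t. cell t = c)" for c
  have rep: "cell (rep (cell x)) = cell x" for x
    unfolding rep_def by (rule someI[of _ x]) simp
  define L where "L = Max ((\<lambda>c. norm (rep c)) ` range cell)"
  have L: "norm (rep (cell x)) \<le> L" for x
    unfolding L_def using fin by (intro Max_ge) auto
  have "\<exists>\<tau>\<in>cball x L. \<forall>s\<in>F. norm (wave \<tau> s - 1) \<le> \<kappa>" for x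
  proof (intro bexI ballI)
    let ?t = "rep (cell x)"
    show "x - ?t \<in> cball x L" using L[of x] by (simp add: dist_norm)
    fix s assume s: "s \<in> F"
    have "\<lfloor>real N * frac (x \<bullet> s)\<rfloor> = \<lfloor>real N * frac (?t \<bullet> s)\<rfloor>"
      using fun_cong[OF rep[of x], of s] s by (simp add: cell_def)
    then have "\<bar>real N * frac (x \<bullet> s) - real N * frac (?t \<bullet> s)\<bar> \<le> 1" by linarith
    then have "real N * \<bar>frac (x \<bullet> s) - frac (?t \<bullet> s)\<bar> \<le> 1"
      by (simp add: right_diff_distrib[symmetric] abs_mult)
    then have 1: "\<bar>frac (x \<bullet> s) - frac (?t \<bullet> s)\<bar> \<le> 1 / real N" using N0 by (simp add: field_simps)
    have "norm (wave (x - ?t) s - 1) \<le> 2 * pi * \<bar>(x - ?t) \<bullet> s - of_int (\<lfloor>x \<bullet> s\<rfloor> - \<lfloor>?t \<bullet> s\<rfloor>)\<bar>"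
      by (rule norm_wave_diff_le)
    also have "(x - ?t) \<bullet> s - of_int (\<lfloor>x \<bullet> s\<rfloor> - \<lfloor>?t \<bullet> s\<rfloor>) = frac (x \<bullet> s) - frac (?t \<bullet> s)"
      by (simp add: frac_def inner_diff_left)
    also have "2 * pi * \<bar>frac (x \<bullet> s) - frac (?t \<bullet> s)\<bar> \<le> 2 * pi * (1 / real N)"
      using 1 by (intro mult_left_mono) auto
    also have "\<dots> \<le> \<kappa>" using N N0 by (simp add: field_simps)
    finally show "norm (wave (x - ?t) s - 1) \<le> \<kappa>" .
  qed
  moreover have "L \<ge> 0" using L norm_ge_zero order_trans by blast
  ultimately show ?thesis by blast
qed

text \<open>One pigeonhole argument for the union of both frequency sets; periods found for each sum
  separately need not coincide.\<close>

lemma common_almost_periods: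
  fixes G1 G2 :: "'a::real_inner \<Rightarrow> complex"
  assumes "exp_sum_of b1 A1 G1" "exp_sum_of b2 A2 G2" "\<epsilon> > 0"
  obtains L where "L \<ge> 0" "\<And>x. \<exists>\<tau>\<in>cball x L. \<forall>y. norm (G1 (y + \<tau>) - G1 y) \<le> \<epsilon> \<and> norm (G2 (y + \<tau>) - G2 y) \<le> \<epsilon>"
proof -
  obtain F1 \<kappa>1 where 1: "finite F1" "\<kappa>1 > 0"
    "\<And>\<tau> y. (\<forall>s\<in>F1. norm (wave \<tau> s - 1) \<le> \<kappa>1) \<Longrightarrow> norm (G1 (y + \<tau>) - G1 y) \<le> \<epsilon>"
    using almost_periods[OF assms(1,3)] by blast
  obtain F2 \<kappa>2 where 2: "finite F2" "\<kappa>2 > 0"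
    "\<And>\<tau> y. (\<forall>s\<in>F2. norm (wave \<tau> s - 1) \<le> \<kappa>2) \<Longrightarrow> norm (G2 (y + \<tau>) - G2 y) \<le> \<epsilon>"
    using almost_periods[OF assms(2,3)] by blast
  obtain L where L: "L \<ge> 0" "\<And>x. \<exists>\<tau>\<in>cball x L. \<forall>s\<in>F1 \<union> F2. norm (wave \<tau> s - 1) \<le> min \<kappa>1 \<kappa>2"
    using relatively_dense_periods[of "F1 \<union> F2" "min \<kappa>1 \<kappa>2"] 1(1,2) 2(1,2) by auto
  have "\<exists>\<tau>\<in>cball x L. \<forall>y. norm (G1 (y + \<tau>) - G1 y) \<le> \<epsilon> \<and> norm (G2 (y + \<tau>) - G2 y) \<le> \<epsilon>" for x
    using L(2)[of x] 1(3) 2(3) by (metis UnCI min.bounded_iff)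
  with L(1) show thesis by (rule that)
qed

section \<open>Test functions of small support\<close>

definition dtensor :: "('d::finite \<Rightarrow> nat) \<Rightarrow> ('d \<Rightarrow> real \<Rightarrow> complex) \<Rightarrow> real^'d \<Rightarrow> complex" where
  "dtensor j H = tensor (\<lambda>i. (vderiv ^^ j i) (H i))"

text \<open>The bound 1/(2d) for each of the d coordinates keeps the support of the tensor within
  distance 1/2 of the origin. A translate by \<open>y\<close> thus lives in \<open>ball y 1\<close>,
  the ball in which clusters are counted.\<close>

definition small_support :: "('d::finite \<Rightarrow> real \<Rightarrow> complex) \<Rightarrow> bool" where
  "small_support H \<longleftrightarrow> (\<forall>i. test1 (H i)) \<and> (\<forall>i t. 1 / (2 * CARD('d)) < \<bar>t\<bar> \<longrightarrow> H i t = 0)"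

lemma pow_vderiv_eq_0_outside: "(\<And>x. R < \<bar>x\<bar> \<Longrightarrow> f x = 0) \<Longrightarrow> R < \<bar>x\<bar> \<Longrightarrow> (vderiv ^^ n) f x = 0"
  by (induction n arbitrary: x) (auto intro: vderiv_eq_0_outside)

lemma norm_le_card_times:
  fixes u :: "real^'d" and e :: real
  assumes "\<And>i. \<bar>u $ i\<bar> \<le> e"
  shows "norm u \<le> CARD('d) * e"
proof -
  have "norm u \<le> (\<Sum>i\<in>UNIV. \<bar>u $ i\<bar>)" by (rule norm_le_l1_cart)
  also have "\<dots> \<le> (\<Sum>i\<in>(UNIV::'d set). e)" by (intro sum_mono assms)
  finally show ?thesis by simp
qed

lemma dtensor_eq_0:
  fixes u :: "real^'d"
  assumes "small_support H" "1 \<le> norm u"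
  shows "dtensor j H u = 0"
proof -
  have "\<exists>i. 1 / (2 * CARD('d)) < \<bar>u $ i\<bar>"
  proof (rule ccontr)
    assume "\<not> ?thesis"
    then have "norm u \<le> CARD('d) * (1 / (2 * CARD('d)))" by (intro norm_le_card_times) (auto simp: not_less)
    then show False using assms(2) by simp
  qed
  then obtain i where i: "1 / (2 * CARD('d)) < \<bar>u $ i\<bar>" by blast
  have "(vderiv ^^ j i) (H i) (u $ i) = 0"
    using assms(1) by (intro pow_vderiv_eq_0_outside[OF _ i]) (auto simp: small_support_def)
  then show ?thesis unfolding dtensor_def tensor_def by (intro prod_zero) auto
qed

lemma dtensor_lipschitz:
  fixes H :: "'d::finite \<Rightarrow> real \<Rightarrow> complex"
  assumes H: "\<And>i. test1 (H i)"
  obtains B K where "B \<ge> 0" "K \<ge> 0" "\<And>u. norm (dtensor j H u) \<le> B"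
    "\<And>u v. norm (dtensor j H u - dtensor j H v) \<le> K * norm (u - v)"
proof -
  let ?D = "\<lambda>i. (vderiv ^^ j i) (H i)"
  obtain C where C: "C \<ge> 1" "\<And>i. \<forall>t. norm (?D i t) \<le> C"
    by (rule uniform_bound[of "\<lambda>i C. \<forall>t. norm (?D i t) \<le> C"])
      (use test1_bounded[OF test1_pow_vderiv[OF H]] in blast, meson order_trans, blast)
  obtain K where K: "K \<ge> 1" "\<And>i. \<forall>x y. norm (?D i x - ?D i y) \<le> K * \<bar>x - y\<bar>"
  proof (rule uniform_bound[of "\<lambda>i K. \<forall>x y. norm (?D i x - ?D i y) \<le> K * \<bar>x - y\<bar>"])
    show "\<exists>K. \<forall>x y. norm (?D i x - ?D i y) \<le> K * \<bar>x - y\<bar>" for i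
      using test1_lipschitz[OF test1_pow_vderiv[OF H]] by blast
    show "\<forall>x y. norm (?D i x - ?D i y) \<le> K' * \<bar>x - y\<bar>"
      if "\<forall>x y. norm (?D i x - ?D i y) \<le> K * \<bar>x - y\<bar>" "K \<le> K'" for i K K'
      using that by (meson abs_ge_zero mult_right_mono order_trans)
  qed blast
  have lip: "norm (dtensor j H u - dtensor j H v) \<le> (C ^ CARD('d) * CARD('d) * K) * norm (u - v)" for u v
  proof -
    have "norm (0::real^'d) ^ 0 * norm (tensor (\<lambda>i t. ?D i (u $ i)) (0::real^'d) - tensor (\<lambda>i t. ?D i (v $ i)) 0)
       \<le> C ^ CARD('d) * (CARD('d) * (K * norm (u - v)))"
    proof (rule norm_tensor_diff_le)
      fix i and t :: real
      have "norm (?D i (u $ i) - ?D i (v $ i)) \<le> K * \<bar>u $ i - v $ i\<bar>" using K(2) by blast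
      also have "\<dots> \<le> K * norm (u - v)"
        using component_le_norm_cart[of "u - v" i] K(1) by (intro mult_left_mono) auto
      finally show "(1 + \<bar>t\<bar>) ^ 0 * norm (?D i (u $ i) - ?D i (v $ i)) \<le> K * norm (u - v)" by simp
    qed (use C in auto)
    then show ?thesis by (simp add: dtensor_def tensor_def mult_ac)
  qed
  have "norm (dtensor j H u) \<le> C ^ CARD('d)" for u
  proof -
    have "norm (dtensor j H u) = (\<Prod>i\<in>UNIV. norm (?D i (u $ i)))"
      by (simp add: dtensor_def tensor_def prod_norm)
    also have "\<dots> \<le> (\<Prod>i\<in>(UNIV::'d set). C)"
      using C(2) by (intro prod_mono) auto
    finally show ?thesis by simp
  qed
  then show thesis using C(1) K(1) lip by (intro that[of "C ^ CARD('d)" "C ^ CARD('d) * CARD('d) * K"]) auto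
qed

section \<open>Locally finite sums of derivatives of unit masses\<close>

text \<open>\<open>delta_series\<close> tested on translated tensors only, the form in which the
  window argument uses it.\<close>

definition tensor_series ::
  "((real^'d \<Rightarrow> complex) \<Rightarrow> complex) \<Rightarrow> (real^'d) set \<Rightarrow> nat \<Rightarrow> (real^'d \<Rightarrow> ('d \<Rightarrow> nat) \<Rightarrow> complex) \<Rightarrow> bool" where
  "tensor_series T L m p \<longleftrightarrow> (\<forall>H y. (\<forall>i. test1 (H i)) \<longrightarrow>
     ((\<lambda>l. \<Sum>j | multi_norm j \<le> m. p l j * ((- 1) ^ (\<Sum>i\<in>UNIV. j i) * dtensor j H (l - y)))
        has_sum T (tensor (shift y H))) L)"

lemma tensor_series_delta_series:
  assumes "delta_series T L m p"
  shows "tensor_series T L m p"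
  unfolding tensor_series_def
proof (intro allI impI)
  fix H :: "'a \<Rightarrow> real \<Rightarrow> complex" and y assume H: "\<forall>i. test1 (H i)"
  have d: "deriv_delta j l (tensor (shift y H)) = (- 1) ^ (\<Sum>i\<in>UNIV. j i) * dtensor j H (l - y)" for j l
    using H by (simp add: deriv_delta_def dtensor_def deriv_multi_tensor_shift)
  have "tensor (shift y H) \<in> test_functions"
    using H by (intro test_functions_tensor test1_shift) auto
  then show "((\<lambda>l. \<Sum>j | multi_norm j \<le> m. p l j * ((- 1) ^ (\<Sum>i\<in>UNIV. j i) * dtensor j H (l - y)))
        has_sum T (tensor (shift y H))) L"
    using assms unfolding delta_series_def d[symmetric] by blast
qed

text \<open>All values of \<phi> are compared with its value at one point of the cluster. The common
  value multiplies the difference of the totals, and the Lipschitz bound controls the deviations by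
  the diameter.\<close>

lemma cluster_estimate:
  fixes \<phi> :: "'a::real_normed_vector \<Rightarrow> complex" and p q :: "'a \<Rightarrow> complex"
  assumes \<phi>: "\<And>u. norm (\<phi> u) \<le> B" "\<And>u v. norm (\<phi> u - \<phi> v) \<le> K * norm (u - v)" and K: "K \<ge> 0" and B: "B \<ge> 0"
    and bd: "bounded (P \<union> Q)"
    and C: "(\<Sum>l\<in>P. norm (p l)) \<le> C" "(\<Sum>g\<in>Q. norm (q g)) \<le> C"
  shows "norm ((\<Sum>l\<in>P. p l * \<phi> (l - y)) - (\<Sum>g\<in>Q. q g * \<phi> (g - y)))
    \<le> B * norm ((\<Sum>l\<in>P. p l) - (\<Sum>g\<in>Q. q g)) + K * diameter (P \<union> Q) * (2 * C)"
proof (cases "P \<union> Q = {}")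
  case False
  then obtain z where z: "z \<in> P \<union> Q" by blast
  let ?d = "diameter (P \<union> Q)"
  have d: "0 \<le> ?d" by (rule diameter_ge_0[OF bd])
  have *: "norm (\<Sum>l\<in>S. f l * (\<phi> (l - y) - \<phi> (z - y))) \<le> K * ?d * C"
    if S: "S \<subseteq> P \<union> Q" and f: "(\<Sum>l\<in>S. norm (f l)) \<le> C" for S and f :: "'a \<Rightarrow> complex"
  proof -
    have "norm (\<Sum>l\<in>S. f l * (\<phi> (l - y) - \<phi> (z - y))) \<le> (\<Sum>l\<in>S. norm (f l) * (K * ?d))"
    proof (rule sum_norm_le)
      fix l assume l: "l \<in> S"
      have "norm (\<phi> (l - y) - \<phi> (z - y)) \<le> K * norm (l - z)" using \<phi>(2)[of "l - y" "z - y"] by simp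
      also have "\<dots> \<le> K * ?d"
        using diameter_bounded_bound[OF bd, of l z] l S z K by (intro mult_left_mono) (auto simp: dist_norm)
      finally show "norm (f l * (\<phi> (l - y) - \<phi> (z - y))) \<le> norm (f l) * (K * ?d)"
        by (simp add: norm_mult mult_left_mono)
    qed
    also have "\<dots> = (\<Sum>l\<in>S. norm (f l)) * (K * ?d)" by (simp add: sum_distrib_right)
    also have "\<dots> \<le> C * (K * ?d)" using f K d by (intro mult_right_mono) auto
    finally show ?thesis by (simp add: mult_ac)
  qed
  have split: "(\<Sum>l\<in>S. f l * \<phi> (l - y)) = \<phi> (z - y) * (\<Sum>l\<in>S. f l) + (\<Sum>l\<in>S. f l * (\<phi> (l - y) - \<phi> (z - y)))"
    for S and f :: "'a \<Rightarrow> complex"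
  proof -
    have "\<phi> (z - y) * (\<Sum>l\<in>S. f l) = (\<Sum>l\<in>S. f l * \<phi> (z - y))"
      by (subst mult.commute) (rule sum_distrib_right)
    then show ?thesis by (simp add: right_diff_distrib sum_subtractf)
  qed
  let ?X = "\<Sum>l\<in>P. p l * (\<phi> (l - y) - \<phi> (z - y))" and ?Y = "\<Sum>g\<in>Q. q g * (\<phi> (g - y) - \<phi> (z - y))"
  have "(\<Sum>l\<in>P. p l * \<phi> (l - y)) - (\<Sum>g\<in>Q. q g * \<phi> (g - y)) =
     \<phi> (z - y) * ((\<Sum>l\<in>P. p l) - (\<Sum>g\<in>Q. q g)) + (?X - ?Y)"
    unfolding split[of p P] split[of q Q] by (simp add: algebra_simps)
  then have "norm ((\<Sum>l\<in>P. p l * \<phi> (l - y)) - (\<Sum>g\<in>Q. q g * \<phi> (g - y))) \<le>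
     norm (\<phi> (z - y) * ((\<Sum>l\<in>P. p l) - (\<Sum>g\<in>Q. q g))) + norm (?X - ?Y)"
    by (simp only: norm_triangle_ineq)
  also have "norm (?X - ?Y) \<le> norm ?X + norm ?Y" by (rule norm_triangle_ineq4)
  also have "norm ?X + norm ?Y \<le> K * ?d * C + K * ?d * C"
    using C by (intro add_mono *) auto
  also have "norm (\<phi> (z - y) * ((\<Sum>l\<in>P. p l) - (\<Sum>g\<in>Q. q g))) \<le> B * norm ((\<Sum>l\<in>P. p l) - (\<Sum>g\<in>Q. q g))"
    unfolding norm_mult by (intro mult_right_mono \<phi>) auto
  finally show ?thesis by (simp add: algebra_simps)
qed (use B in auto)

section \<open>Windows\<close>

text \<open>The geometric hypotheses for arbitrary locally finite sets instead of the spectra,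
  because case (a) applies them to the points of nonzero mass.\<close>

locale windows =
  fixes L1 L2 E :: "(real^'d) set" and \<Lambda> \<Gamma> :: "nat \<Rightarrow> (real^'d) set"
    and x :: "nat \<Rightarrow> real^'d" and r :: "nat \<Rightarrow> real" and N :: nat
  assumes locally_finite: "\<And>S. bounded S \<Longrightarrow> finite (L1 \<inter> S)" "\<And>S. bounded S \<Longrightarrow> finite (L2 \<inter> S)"
    and disjoint: "disjoint_family \<Lambda>" "disjoint_family \<Gamma>"
    and r: "filterlim r at_top sequentially"
    and x: "eventually (\<lambda>k. x k \<noteq> 0) sequentially" "(\<lambda>k. r k / norm (x k)) \<longlonglongrightarrow> 0"
    and balls: "(\<Union>k. ball (x k) (r k)) \<subseteq> E"
    and clusters: "L1 \<inter> E = (\<Union>n. \<Lambda> n)" "L2 \<inter> E = (\<Union>n. \<Gamma> n)"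
    and bounded_cluster: "\<And>n. bounded (\<Lambda> n \<union> \<Gamma> n)"
    and diameter: "(\<lambda>n. diameter (\<Lambda> n \<union> \<Gamma> n)) \<longlonglongrightarrow> 0"
    and count: "\<And>y. y \<in> E \<Longrightarrow> finite {n. (\<Lambda> n \<union> \<Gamma> n) \<inter> ball y 1 \<noteq> {}} \<and>
           card {n. (\<Lambda> n \<union> \<Gamma> n) \<inter> ball y 1 \<noteq> {}} \<le> N"
begin

lemma finite_cluster: "finite (\<Lambda> n)" "finite (\<Gamma> n)"
proof -
  have "\<Lambda> n = L1 \<inter> \<Lambda> n" "\<Gamma> n = L2 \<inter> \<Gamma> n" using clusters by auto
  then show "finite (\<Lambda> n)" "finite (\<Gamma> n)"
    using locally_finite bounded_cluster[of n] by (metis bounded_Un)+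
qed

lemma eventually_window_in_ball:
  assumes "\<And>k. dist (z k) (x k) \<le> L"
  shows "\<forall>\<^sub>F k in sequentially. cball (z k) R \<subseteq> ball (x k) (r k)"
proof -
  have "\<forall>\<^sub>F k in sequentially. L + R < r k"
    using r by (auto simp: filterlim_at_top_dense)
  then show ?thesis
  proof eventually_elim
    case (elim k)
    show ?case
    proof
      fix u assume "u \<in> cball (z k) R"
      then have "dist (x k) u \<le> L + R"
        using assms[of k] dist_triangle[of "x k" u "z k"] by (simp add: dist_commute)
      then show "u \<in> ball (x k) (r k)" using elim by simp
    qed
  qed
qed

text \<open>Once r_k < |x_k|/2, all points of the ball have norm above r_k, and r_k exceeds every
  bound.\<close>

lemma ball_far:
  assumes "bounded S"
  shows "\<forall>\<^sub>F k in sequentially. S \<inter> ball (x k) (r k) = {}"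
proof -
  obtain W where W: "\<And>u. u \<in> S \<Longrightarrow> norm u \<le> W" using assms by (auto simp: bounded_iff)
  have "\<forall>\<^sub>F k in sequentially. W < r k" using r by (auto simp: filterlim_at_top_dense)
  moreover have "\<forall>\<^sub>F k in sequentially. r k / norm (x k) < 1 / 2"
    using x(2) by (rule order_tendstoD) simp
  ultimately show ?thesis using x(1)
  proof eventually_elim
    case (elim k)
    then have 1: "2 * r k < norm (x k)" by (simp add: field_simps)
    show ?case
    proof (rule ccontr)
      assume "\<not> ?thesis"
      then obtain u where u: "u \<in> S" "dist (x k) u < r k" by auto
      have "norm (x k) \<le> norm u + dist (x k) u" by (simp add: dist_norm norm_triangle_sub)
      then show False using W[OF u(1)] u(2) 1 elim by linarith
    qed
  qed
qed

lemma clusters_far: "\<forall>\<^sub>F k in sequentially. \<forall>n. (\<Lambda> n \<union> \<Gamma> n) \<inter> ball (x k) (r k) \<noteq> {} \<longrightarrow> n0 \<le> n"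
proof -
  have "bounded (\<Union>n<n0. \<Lambda> n \<union> \<Gamma> n)" using bounded_cluster by auto
  from ball_far[OF this] show ?thesis
  proof eventually_elim
    case (elim k)
    show ?case
    proof (intro allI impI, rule ccontr)
      fix n assume n: "(\<Lambda> n \<union> \<Gamma> n) \<inter> ball (x k) (r k) \<noteq> {}" "\<not> n0 \<le> n"
      then have "\<Lambda> n \<union> \<Gamma> n \<subseteq> (\<Union>n<n0. \<Lambda> n \<union> \<Gamma> n)" by (intro UN_upper) auto
      then show False using n(1) elim by blast
    qed
  qed
qed

text \<open>Clusters meeting the ball are summed in full, their points outside it contributing 0.
  This keeps the cluster totals intact, which are what the hypotheses speak about.\<close>

lemma cluster_sum:
  assumes L: "\<And>l. l \<in> L \<Longrightarrow> l \<in> ball y 1 \<Longrightarrow> \<exists>n. l \<in> M n" and M: "\<And>n. M n \<subseteq> L" "disjoint_family M" "\<And>n. finite (M n)"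
    and I: "finite I" "\<And>n. M n \<inter> ball y 1 \<noteq> {} \<Longrightarrow> n \<in> I"
    and f: "\<And>l. l \<notin> ball y 1 \<Longrightarrow> f l = (0 :: complex)" and S: "(f has_sum S) L"
  shows "S = (\<Sum>n\<in>I. \<Sum>l\<in>M n. f l)"
proof -
  have "(f has_sum S) (\<Union>n\<in>I. M n)"
  proof (rule has_sum_cong_neutral[THEN iffD1, OF _ _ _ S])
    show "f l = 0" if l: "l \<in> L - (\<Union>n\<in>I. M n)" for l
    proof (rule f, rule notI)
      assume "l \<in> ball y 1"
      then obtain n where "l \<in> M n" using L l by blast
      then show False using I(2)[of n] l \<open>l \<in> ball y 1\<close> by blast
    qed
    show "f l = 0" if "l \<in> (\<Union>n\<in>I. M n) - L" for l using that M(1) by blast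
  qed simp
  moreover have "(f has_sum (\<Sum>l\<in>(\<Union>n\<in>I. M n). f l)) (\<Union>n\<in>I. M n)"
    using I(1) M(3) by (intro has_sum_finite) auto
  ultimately have "S = (\<Sum>l\<in>(\<Union>n\<in>I. M n). f l)" by (rule has_sum_unique)
  also have "\<dots> = (\<Sum>n\<in>I. \<Sum>l\<in>M n. f l)"
    using I(1) M(2,3) by (intro sum.UNION_disjoint) (auto simp: disjoint_family_on_def)
  finally show ?thesis .
qed

text \<open>The ball around \<open>y\<close> meets at most \<open>N\<close> clusters, all of large
  index, and each contributes little by \<open>cluster_estimate\<close>. The bound \<open>C\<close>
  is asked for only near the centres \<open>z k\<close>, which may differ from \<open>x k\<close> by
  a bounded amount; this leaves room for the smaller balls of case (a).\<close>

theorem window_limit: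
  fixes p q :: "real^'d \<Rightarrow> ('d \<Rightarrow> nat) \<Rightarrow> complex"
  assumes T1: "tensor_series T1 L1 m p" and T2: "tensor_series T2 L2 m q"
    and pq: "\<And>j. multi_norm j \<le> m \<Longrightarrow> (\<lambda>n. (\<Sum>l\<in>\<Lambda> n. p l j) - (\<Sum>g\<in>\<Gamma> n. q g j)) \<longlonglongrightarrow> 0"
    and z: "\<And>k. dist (z k) (x k) \<le> L"
    and C: "\<forall>\<^sub>F k in sequentially. \<forall>n j. (\<Lambda> n \<union> \<Gamma> n) \<inter> cball (z k) (R + 1) \<noteq> {} \<longrightarrow> multi_norm j \<le> m \<longrightarrow>
       (\<Sum>l\<in>\<Lambda> n. norm (p l j)) \<le> C \<and> (\<Sum>g\<in>\<Gamma> n. norm (q g j)) \<le> C"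
    and H: "small_support H" and \<epsilon>: "\<epsilon> > 0"
  shows "\<forall>\<^sub>F k in sequentially. \<forall>y\<in>cball (z k) R. norm (T1 (tensor (shift y H)) - T2 (tensor (shift y H))) \<le> \<epsilon>"
proof -
  have tH: "test1 (H i)" for i using H by (simp add: small_support_def)
  define J where "J = {j :: 'd \<Rightarrow> nat. multi_norm j \<le> m}"
  have J: "finite J" unfolding J_def by (rule finite_multi_norm_le)
  define \<phi> where "\<phi> j u = (- 1) ^ (\<Sum>i\<in>UNIV. j i) * dtensor j H u" for j u
  have "\<exists>B K. B \<ge> 0 \<and> K \<ge> 0 \<and> (\<forall>u. norm (\<phi> j u) \<le> B) \<and> (\<forall>u v. norm (\<phi> j u - \<phi> j v) \<le> K * norm (u - v))" for j
  proof -
    obtain B K where BK: "B \<ge> 0" "K \<ge> 0" "\<And>u. norm (dtensor j H u) \<le> B"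
      "\<And>u v. norm (dtensor j H u - dtensor j H v) \<le> K * norm (u - v)"
      by (rule dtensor_lipschitz[of H j, OF tH]) (rule that)
    have "norm (\<phi> j u) \<le> B" "norm (\<phi> j u - \<phi> j v) \<le> K * norm (u - v)" for u v
      using BK(3)[of u] BK(4)[of u v]
      by (simp_all add: \<phi>_def norm_mult norm_power right_diff_distrib[symmetric])
    then show ?thesis using BK(1,2) by blast
  qed
  then obtain B K where BK: "\<And>j. B j \<ge> 0" "\<And>j. K j \<ge> 0" "\<And>j u. norm (\<phi> j u) \<le> B j"
      "\<And>j u v. norm (\<phi> j u - \<phi> j v) \<le> K j * norm (u - v)"
    by metis
  define e where "e j n = B j * norm ((\<Sum>l\<in>\<Lambda> n. p l j) - (\<Sum>g\<in>\<Gamma> n. q g j)) + K j * diameter (\<Lambda> n \<union> \<Gamma> n) * (2 * C)" for j n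
  have "(\<lambda>n. \<Sum>j\<in>J. e j n) \<longlonglongrightarrow> (\<Sum>j\<in>J. B j * 0 + K j * 0 * (2 * C))"
    unfolding e_def using pq diameter by (intro tendsto_intros tendsto_norm_zero) (auto simp: J_def)
  then have "(\<lambda>n. \<Sum>j\<in>J. e j n) \<longlonglongrightarrow> 0" by simp
  \<comment> \<open>At most \<open>N\<close> clusters share the error \<epsilon>;
    \<open>N + 1\<close> avoids division by 0.\<close>
  moreover have "\<epsilon> / (real N + 1) > 0" using \<epsilon> by simp
  ultimately have "\<forall>\<^sub>F n in sequentially. (\<Sum>j\<in>J. e j n) < \<epsilon> / (real N + 1)"
    by (rule order_tendstoD)
  then obtain n0 where n0: "\<And>n. n \<ge> n0 \<Longrightarrow> (\<Sum>j\<in>J. e j n) < \<epsilon> / (real N + 1)"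
    unfolding eventually_sequentially by blast
  show ?thesis
    using eventually_window_in_ball[OF z, of "R + 1"] clusters_far[of n0] C
  proof eventually_elim
    case (elim k)
    show ?case
    proof
      fix y assume y: "y \<in> cball (z k) R"
      have b1: "ball y 1 \<subseteq> cball (z k) (R + 1)"
      proof
        fix u assume "u \<in> ball y 1"
        then show "u \<in> cball (z k) (R + 1)" using y dist_triangle[of "z k" u y] by simp
      qed
      then have bE: "ball y 1 \<subseteq> E" using elim(1) balls by blast
      have yE: "y \<in> E" using bE by auto
      define I where "I = {n. (\<Lambda> n \<union> \<Gamma> n) \<inter> ball y 1 \<noteq> {}}"
      have I: "finite I" "card I \<le> N" using count[OF yE] by (auto simp: I_def)
      have In0: "n \<ge> n0" if "n \<in> I" for n
        using that elim(1,2) b1 unfolding I_def by blast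
      have CI: "(\<Sum>l\<in>\<Lambda> n. norm (p l j)) \<le> C" "(\<Sum>g\<in>\<Gamma> n. norm (q g j)) \<le> C" if "n \<in> I" "j \<in> J" for n j
        using that elim(3) b1 unfolding I_def J_def by blast+
      have far: "\<phi> j (l - y) = 0" if "l \<notin> ball y 1" for j l
        unfolding \<phi>_def using that dtensor_eq_0[OF H, of "l - y" j] by (simp add: dist_norm norm_minus_commute)
      have "T1 (tensor (shift y H)) = (\<Sum>n\<in>I. \<Sum>l\<in>\<Lambda> n. \<Sum>j\<in>J. p l j * \<phi> j (l - y))"
      proof (rule cluster_sum[of L1 y])
        show "\<exists>n. l \<in> \<Lambda> n" if "l \<in> L1" "l \<in> ball y 1" for l
          using that bE clusters(1) by blast
        show "((\<lambda>l. \<Sum>j\<in>J. p l j * \<phi> j (l - y)) has_sum T1 (tensor (shift y H))) L1"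
          using T1 tH unfolding tensor_series_def J_def \<phi>_def by blast
      qed (use clusters disjoint finite_cluster I far in \<open>auto simp: I_def\<close>)
      moreover have "T2 (tensor (shift y H)) = (\<Sum>n\<in>I. \<Sum>l\<in>\<Gamma> n. \<Sum>j\<in>J. q l j * \<phi> j (l - y))"
      proof (rule cluster_sum[of L2 y])
        show "\<exists>n. l \<in> \<Gamma> n" if "l \<in> L2" "l \<in> ball y 1" for l
          using that bE clusters(2) by blast
        show "((\<lambda>l. \<Sum>j\<in>J. q l j * \<phi> j (l - y)) has_sum T2 (tensor (shift y H))) L2"
          using T2 tH unfolding tensor_series_def J_def \<phi>_def by blast
      qed (use clusters disjoint finite_cluster I far in \<open>auto simp: I_def\<close>)
      ultimately have "T1 (tensor (shift y H)) - T2 (tensor (shift y H)) =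
         (\<Sum>n\<in>I. \<Sum>j\<in>J. (\<Sum>l\<in>\<Lambda> n. p l j * \<phi> j (l - y)) - (\<Sum>g\<in>\<Gamma> n. q g j * \<phi> j (g - y)))"
        by (simp add: sum_subtractf sum.swap[of _ _ J])
      also have "norm \<dots> \<le> (\<Sum>n\<in>I. \<epsilon> / (real N + 1))"
      proof (rule sum_norm_le)
        fix n assume n: "n \<in> I"
        have "norm (\<Sum>j\<in>J. (\<Sum>l\<in>\<Lambda> n. p l j * \<phi> j (l - y)) - (\<Sum>g\<in>\<Gamma> n. q g j * \<phi> j (g - y))) \<le> (\<Sum>j\<in>J. e j n)"
        proof (rule sum_norm_le)
          fix j assume j: "j \<in> J"
          show "norm ((\<Sum>l\<in>\<Lambda> n. p l j * \<phi> j (l - y)) - (\<Sum>g\<in>\<Gamma> n. q g j * \<phi> j (g - y))) \<le> e j n"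
            unfolding e_def by (rule cluster_estimate[OF BK(3,4,2,1) bounded_cluster CI[OF n j]])
        qed
        also have "\<dots> \<le> \<epsilon> / (real N + 1)" using n0[OF In0[OF n]] by simp
        finally show "norm (\<Sum>j\<in>J. (\<Sum>l\<in>\<Lambda> n. p l j * \<phi> j (l - y)) - (\<Sum>g\<in>\<Gamma> n. q g j * \<phi> j (g - y))) \<le> \<epsilon> / (real N + 1)" .
      qed
      also have "\<dots> = real (card I) * (\<epsilon> / (real N + 1))" by simp
      also have "\<dots> \<le> (real N + 1) * (\<epsilon> / (real N + 1))"
        using I(2) \<epsilon> by (intro mult_right_mono) auto
      also have "\<dots> = \<epsilon>" by simp
      finally show "norm (T1 (tensor (shift y H)) - T2 (tensor (shift y H))) \<le> \<epsilon>" .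
    qed
  qed
qed

end

section \<open>Uniqueness from windows\<close>

text \<open>A larger index set adds only points of mass 0, so two measures can be summed over a
  common set.\<close>

lemma has_sum_atoms_superset:
  fixes \<mu> :: "'a::euclidean_space set \<Rightarrow> complex"
  assumes A: "\<And>B. B \<in> bounded_borel \<Longrightarrow> ((\<lambda>s. \<mu> {s}) has_sum \<mu> B) (A \<inter> B)" and "A \<subseteq> A'" and B: "B \<in> bounded_borel"
  shows "((\<lambda>s. \<mu> {s}) has_sum \<mu> B) (A' \<inter> B)"
proof (rule has_sum_cong_neutral[THEN iffD1, OF _ _ _ A[OF B]])
  show "\<mu> {s} = 0" if "s \<in> A' \<inter> B - A \<inter> B" for s
  proof -
    have "A \<inter> {s} = {}" using that by auto
    then have "((\<lambda>s. \<mu> {s}) has_sum \<mu> {s}) {}" using A[OF bounded_borel_intros(5)[of s]] by simp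
    then show ?thesis using has_sum_unique[OF _ has_sum_empty] by blast
  qed
qed (use \<open>A \<subseteq> A'\<close> in auto)

text \<open>Coefficients and frequencies may depend on \<open>H\<close>; only the form of the sum is
  used.\<close>

definition almost_periodic :: "((real^'d \<Rightarrow> complex) \<Rightarrow> complex) \<Rightarrow> bool" where
  "almost_periodic T \<longleftrightarrow> (\<forall>H. (\<forall>i. test1 (H i)) \<longrightarrow> (\<exists>b A. exp_sum_of b A (\<lambda>y. T (tensor (shift y H)))))"

lemma fourier_measure_shift:
  fixes \<mu> :: "(real^'d) set \<Rightarrow> complex"
  assumes A: "countable A" "\<And>B. B \<in> bounded_borel \<Longrightarrow> ((\<lambda>s. \<mu> {s}) has_sum \<mu> B) (A \<inter> B)"
    and \<mu>: "radon \<mu>" "tempered_measure (total_variation \<mu>)" and H: "\<And>i. test1 (H i)"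
  shows "((\<lambda>s. (\<mu> {s} * fourier (tensor H) s) * wave y s) has_sum fourier_measure \<mu> (tensor (shift y H))) A"
proof -
  have "((\<lambda>s. \<mu> {s} * fourier (tensor (shift y H)) s) has_sum fourier_measure \<mu> (tensor (shift y H))) A"
    by (rule fourier_measure_tensor[OF A \<mu> test1_shift[OF H]])
  moreover have "\<mu> {s} * fourier (tensor (shift y H)) s = (\<mu> {s} * fourier (tensor H) s) * wave y s" for s
    unfolding fourier_tensor_shift[OF H] wave_def by (simp only: mult_ac)
  ultimately show ?thesis by (simp only:)
qed

lemma almost_periodic_fourier_measure:
  fixes \<mu> :: "(real^'d) set \<Rightarrow> complex"
  assumes "atomic \<mu>" "tempered_measure (total_variation \<mu>)"
  shows "almost_periodic (fourier_measure \<mu>)"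
proof -
  have \<mu>: "radon \<mu>" using assms(1) by (simp add: atomic_def)
  obtain A where A: "countable A" "\<And>B. B \<in> bounded_borel \<Longrightarrow> ((\<lambda>s. \<mu> {s}) has_sum \<mu> B) (A \<inter> B)"
    using assms(1) by (rule atomic_has_sum) (rule that)
  show ?thesis
    unfolding almost_periodic_def
    using exp_sum_ofI[OF fourier_measure_shift[OF A \<mu> assms(2)]] by blast
qed

text \<open>Modulation does not enlarge the support, so a test function of small support can still
  detect the atom at \<open>s\<close>.\<close>

lemma fourier_nonzero_at:
  fixes s :: "real^'d"
  obtains H where "small_support H" "fourier (tensor H) s \<noteq> 0"
proof -
  define e where "e = 1 / (2 * real CARD('d))"
  have e: "e > 0" by (simp add: e_def)
  define H where "H i t = exp (\<i> * of_real (2 * pi * s $ i * t)) * complex_of_real (bump 1 (-e) e t)" for i t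
  have H: "test1 (H i)" for i
    unfolding H_def[abs_def] by (intro test1_mult smooth1_intros test1_bump) simp
  have "H i t = 0" if "e < \<bar>t\<bar>" for i t
  proof -
    have "\<not> (- e < t \<and> t < e)" using that by linarith
    then show ?thesis using bump_eq_0[of 1 "-e" t e] by (simp add: H_def)
  qed
  then have "small_support H" using H by (simp add: small_support_def e_def)
  moreover have "ft (H i) (s $ i) \<noteq> 0" for i
    unfolding H_def[abs_def] by (rule ft_modulated_bump_nonzero[OF e])
  then have "fourier (tensor H) s \<noteq> 0" by (simp add: fourier_tensor[OF H] tensor_def)
  ultimately show thesis by (rule that)
qed

theorem coincide_if_windows:
  fixes \<mu> \<nu> :: "(real^'d) set \<Rightarrow> complex"
  assumes at: "atomic \<mu>" "atomic \<nu>"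
    and tv: "tempered_measure (total_variation \<mu>)" "tempered_measure (total_variation \<nu>)"
    and win: "\<And>R H \<epsilon>. small_support H \<Longrightarrow> \<epsilon> > 0 \<Longrightarrow> \<exists>z. \<forall>y\<in>cball z R.
       norm (fourier_measure \<mu> (tensor (shift y H)) - fourier_measure \<nu> (tensor (shift y H))) \<le> \<epsilon>"
    and B: "B \<in> bounded_borel"
  shows "\<mu> B = \<nu> B"
proof -
  have rad: "radon \<mu>" "radon \<nu>" using at by (auto simp: atomic_def)
  obtain A1 where A1: "countable A1" "\<And>B. B \<in> bounded_borel \<Longrightarrow> ((\<lambda>s. \<mu> {s}) has_sum \<mu> B) (A1 \<inter> B)"
    using at(1) by (rule atomic_has_sum) (rule that)
  obtain A2 where A2: "countable A2" "\<And>B. B \<in> bounded_borel \<Longrightarrow> ((\<lambda>s. \<nu> {s}) has_sum \<nu> B) (A2 \<inter> B)"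
    using at(2) by (rule atomic_has_sum) (rule that)
  define A where "A = A1 \<union> A2"
  have A: "countable A" "\<And>B. B \<in> bounded_borel \<Longrightarrow> ((\<lambda>s. \<mu> {s}) has_sum \<mu> B) (A \<inter> B)"
    "\<And>B. B \<in> bounded_borel \<Longrightarrow> ((\<lambda>s. \<nu> {s}) has_sum \<nu> B) (A \<inter> B)"
    using A1(1) A2(1) by (auto simp: A_def intro: has_sum_atoms_superset[OF A1(2)] has_sum_atoms_superset[OF A2(2)])
  have eq: "\<mu> {s0} = \<nu> {s0}" if s0: "s0 \<in> A" for s0
  proof -
    obtain H where H: "small_support H" "fourier (tensor H) s0 \<noteq> 0" by (rule fourier_nonzero_at)
    have tH: "test1 (H i)" for i using H(1) by (simp add: small_support_def)
    define b where "b s = (\<mu> {s} - \<nu> {s}) * fourier (tensor H) s" for s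
    define G where "G y = fourier_measure \<mu> (tensor (shift y H)) - fourier_measure \<nu> (tensor (shift y H))" for y
    have e: "exp_sum_of b A G"
    proof (rule exp_sum_ofI)
      fix y
      have "((\<lambda>s. (\<mu> {s} * fourier (tensor H) s) * wave y s - (\<nu> {s} * fourier (tensor H) s) * wave y s) has_sum G y) A"
        unfolding G_def
        by (intro has_sum_minus fourier_measure_shift[OF A(1,2) rad(1) tv(1) tH] fourier_measure_shift[OF A(1,3) rad(2) tv(2) tH])
      then show "((\<lambda>s. b s * wave y s) has_sum G y) A"
        by (simp add: b_def left_diff_distrib)
    qed
    then have abs: "(\<lambda>s. norm (b s)) summable_on A" by (simp add: exp_sum_of_def)
    have "norm (b s0) \<le> 0 + \<epsilon>" if "\<epsilon> > 0" for \<epsilon>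
    proof -
      \<comment> \<open>\<open>F\<close> carries the coefficients up to \<epsilon>/2 and determines
        the radius \<open>R\<close>; smallness on the window accounts for the other
        \<epsilon>/2.\<close>
      obtain F where F: "finite F" "F \<subseteq> A" "infsum (\<lambda>s. norm (b s)) (A - F) \<le> \<epsilon> / 2"
        by (rule infsum_tail_small[OF abs, of "\<epsilon> / 2"]) (use \<open>\<epsilon> > 0\<close> in auto)
      obtain R where R: "\<forall>b A G M y. exp_sum_of b A G \<longrightarrow> s0 \<in> A \<longrightarrow> (\<forall>u\<in>cball y R. norm (G u) \<le> M) \<longrightarrow>
         norm (b s0) \<le> M + infsum (\<lambda>s. norm (b s)) (A - insert s0 (F - {s0}))"
        using coefficient_bound[of "F - {s0}" s0] F(1) by blast
      obtain z where z: "\<forall>y\<in>cball z R. norm (G y) \<le> \<epsilon> / 2"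
        using win[OF H(1), of "\<epsilon> / 2" R] \<open>\<epsilon> > 0\<close> unfolding G_def by auto
      have "norm (b s0) \<le> \<epsilon> / 2 + infsum (\<lambda>s. norm (b s)) (A - insert s0 (F - {s0}))"
        using R e s0 z by blast
      also have "infsum (\<lambda>s. norm (b s)) (A - insert s0 (F - {s0})) \<le> infsum (\<lambda>s. norm (b s)) (A - F)"
        by (rule infsum_mono_neutral) (auto intro: summable_on_subset_banach[OF abs])
      finally show ?thesis using F(3) by simp
    qed
    then have "norm (b s0) \<le> 0" by (rule field_le_epsilon)
    then show ?thesis using H(2) by (simp add: b_def)
  qed
  have "((\<lambda>s. \<mu> {s}) has_sum \<nu> B) (A \<inter> B)"
    using A(3)[OF B] by (subst has_sum_cong[where g = "\<lambda>s. \<nu> {s}"]) (auto simp: eq)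
  with A(2)[OF B] show ?thesis by (rule has_sum_unique)
qed

section \<open>Almost periodic sums of point masses\<close>

definition mass_series ::
  "((real^'d \<Rightarrow> complex) \<Rightarrow> complex) \<Rightarrow> (real^'d) set \<Rightarrow> (real^'d \<Rightarrow> complex) \<Rightarrow> bool" where
  "mass_series T L a \<longleftrightarrow> (\<forall>H y. (\<forall>i. test1 (H i)) \<longrightarrow>
     ((\<lambda>l. a l * tensor H (l - y)) has_sum T (tensor (shift y H))) L)"

lemma tensor_series_mass_series:
  assumes "mass_series T L a"
  shows "tensor_series T L 0 (\<lambda>l j. a l)"
proof -
  have "{j :: 'a \<Rightarrow> nat. multi_norm j \<le> 0} = {\<lambda>i. 0}"
  proof (intro equalityI subsetI)
    fix j :: "'a \<Rightarrow> nat" assume "j \<in> {j. multi_norm j \<le> 0}"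
    then have "j i \<le> 0" for i
      using Max_ge[of "range j" "j i"] by (simp add: multi_norm_def)
    then show "j \<in> {\<lambda>i. 0}" by (simp add: fun_eq_iff)
  qed (simp add: multi_norm_def)
  then show ?thesis
    using assms by (simp add: tensor_series_def mass_series_def dtensor_def)
qed

lemma mass_series_single:
  assumes T: "mass_series T L a" and H: "\<And>i. test1 (H i)" and l: "l \<in> L"
    and single: "\<And>l'. l' \<in> L \<Longrightarrow> tensor H (l' - u) \<noteq> 0 \<Longrightarrow> l' = l"
  shows "T (tensor (shift u H)) = a l * tensor H (l - u)"
proof -
  have "((\<lambda>l. a l * tensor H (l - u)) has_sum T (tensor (shift u H))) L"
    using T H by (simp add: mass_series_def)
  then have "((\<lambda>l. a l * tensor H (l - u)) has_sum T (tensor (shift u H))) {l}"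
    by (rule has_sum_cong_neutral[THEN iffD1, rotated -1]) (use l single in auto)
  moreover have "((\<lambda>l. a l * tensor H (l - u)) has_sum (a l * tensor H (l - u))) {l}"
    by (rule has_sum_finiteI) simp_all
  ultimately show ?thesis by (rule has_sum_unique)
qed

lemma mass_series_nonzeroD:
  assumes T: "mass_series T L a" and H: "\<And>i. test1 (H i)" and nz: "T (tensor (shift u H)) \<noteq> 0"
  shows "\<exists>l\<in>L. tensor H (l - u) \<noteq> 0"
proof (rule ccontr)
  assume "\<not> ?thesis"
  moreover have "((\<lambda>l. a l * tensor H (l - u)) has_sum T (tensor (shift u H))) L"
    using T H by (simp add: mass_series_def)
  moreover have "((\<lambda>l. a l * tensor H (l - u)) has_sum 0) L"
    by (rule has_sum_0) (use calculation(1) in auto)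
  ultimately show False using nz has_sum_unique by blast
qed

text \<open>For \<open>norm u \<le> \<theta>\<close> every coordinate keeps distance at least
  \<theta> from both ends of (-2\<theta>, 2\<theta>), which bounds the bumps from below. The ratio
  2d of the two radii reappears as \<kappa> in later proofs.\<close>

lemma bump_tensor:
  fixes \<theta> :: real
  assumes "\<theta> > 0"
  obtains H :: "'d::finite \<Rightarrow> real \<Rightarrow> complex" and c where "\<And>i. test1 (H i)" "c > 0"
    "\<And>u. norm u \<le> \<theta> \<Longrightarrow> c \<le> norm (tensor H u)"
    "\<And>u. tensor H u \<noteq> 0 \<Longrightarrow> norm u \<le> 2 * real CARD('d) * \<theta>"
proof -
  define H where "H (i::'d) t = complex_of_real (bump 1 (- 2 * \<theta>) (2 * \<theta>) t)" for i t
  define b where "b = flatr 0 \<theta> * flatr 0 \<theta>"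
  have b: "b > 0" using assms by (simp add: b_def flatr_bounds)
  have "test1 (H i)" for i unfolding H_def[abs_def] by (rule test1_bump) simp
  moreover have "b ^ CARD('d) > 0" using b by simp
  moreover have "b ^ CARD('d) \<le> norm (tensor H u)" if "norm u \<le> \<theta>" for u
  proof -
    have "(\<Prod>i\<in>(UNIV::'d set). b) \<le> (\<Prod>i\<in>UNIV. norm (H i (u $ i)))"
    proof (intro prod_mono conjI)
      fix i
      have u: "\<bar>u $ i\<bar> \<le> \<theta>" using that component_le_norm_cart order_trans by blast
      have "b \<le> bump 1 (- 2 * \<theta>) (2 * \<theta>) (u $ i)"
        unfolding b_def bump_def by (intro mult_mono flatr_mono flatr_bounds) (use u in auto)
      then show "b \<le> norm (H i (u $ i))" by (simp add: H_def bump_bounds)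
    qed (use b in simp)
    then show ?thesis by (simp add: tensor_def prod_norm)
  qed
  moreover have "norm u \<le> 2 * real CARD('d) * \<theta>" if "tensor H u \<noteq> 0" for u
  proof -
    have "H i (u $ i) \<noteq> 0" for i using that by (auto simp: tensor_def)
    then have "- 2 * \<theta> < u $ i \<and> u $ i < 2 * \<theta>" for i
      using bump_eq_0[of 1 "- 2 * \<theta>" "u $ i" "2 * \<theta>"] by (force simp: H_def)
    then have "\<bar>u $ i\<bar> \<le> 2 * \<theta>" for i by (smt (verit))
    then have "norm u \<le> CARD('d) * (2 * \<theta>)" by (rule norm_le_card_times)
    then show ?thesis by simp
  qed
  ultimately show thesis by (rule that)
qed

section \<open>Finite configurations of points and their copies\<close>

lemma finite_positive_lower_bound:
  fixes f :: "'a \<Rightarrow> real"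
  assumes "finite S" "\<And>s. s \<in> S \<Longrightarrow> f s > 0"
  obtains \<eta> where "\<eta> > 0" "\<And>s. s \<in> S \<Longrightarrow> \<eta> \<le> f s"
proof (rule that)
  show "Min (insert 1 (f ` S)) > 0" using assms by (subst Min_gr_iff) auto
  show "Min (insert 1 (f ` S)) \<le> f s" if "s \<in> S" for s using assms(1) that by (intro Min_le) auto
qed

lemma finite_separated:
  fixes S :: "'a::metric_space set"
  assumes "finite S"
  obtains \<sigma> where "\<sigma> > 0" "\<And>p q. p \<in> S \<Longrightarrow> q \<in> S \<Longrightarrow> dist p q < \<sigma> \<Longrightarrow> p = q"
proof -
  obtain \<sigma> where \<sigma>: "\<sigma> > 0" "\<And>pq. pq \<in> {pq \<in> S \<times> S. fst pq \<noteq> snd pq} \<Longrightarrow> \<sigma> \<le> dist (fst pq) (snd pq)"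
    by (rule finite_positive_lower_bound[of "{pq \<in> S \<times> S. fst pq \<noteq> snd pq}" "\<lambda>pq. dist (fst pq) (snd pq)"])
      (use assms in auto)
  have "p = q" if "p \<in> S" "q \<in> S" "dist p q < \<sigma>" for p q
    using \<sigma>(2)[of "(p, q)"] that by auto
  with \<sigma>(1) show thesis by (rule that)
qed

lemma finite_separated2:
  fixes S S' :: "'a::metric_space set"
  assumes "finite S" "finite S'"
  obtains \<sigma> where "\<sigma> > 0" "\<And>p q. p \<in> S \<Longrightarrow> q \<in> S \<Longrightarrow> dist p q < \<sigma> \<Longrightarrow> p = q"
    "\<And>p q. p \<in> S' \<Longrightarrow> q \<in> S' \<Longrightarrow> dist p q < \<sigma> \<Longrightarrow> p = q"
proof -
  obtain \<sigma> where 1: "\<sigma> > 0" "\<And>p q. p \<in> S \<Longrightarrow> q \<in> S \<Longrightarrow> dist p q < \<sigma> \<Longrightarrow> p = q"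
    by (rule finite_separated[OF assms(1)]) (rule that)
  obtain \<sigma>' where 2: "\<sigma>' > 0" "\<And>p q. p \<in> S' \<Longrightarrow> q \<in> S' \<Longrightarrow> dist p q < \<sigma>' \<Longrightarrow> p = q"
    by (rule finite_separated[OF assms(2)]) (rule that)
  show thesis using 1 2 by (intro that[of "min \<sigma> \<sigma>'"]) auto
qed

text \<open>A bump isolating the atom \<open>p\<close> gives a nonzero value at \<open>p\<close>. A
  period with error below these finitely many values keeps them nonzero after the shift, and a
  nonzero value forces an atom nearby. Both sums share the period, since points of \<open>L1\<close>
  and \<open>L2\<close> will be counted in the same shifted ball.\<close>

lemma copy_configuration:
  fixes y :: "real^'d" and R :: real
  assumes lf: "\<And>S. bounded S \<Longrightarrow> finite (L1 \<inter> S)" "\<And>S. bounded S \<Longrightarrow> finite (L2 \<inter> S)"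
    and T1: "mass_series T1 L1 a1" "almost_periodic T1" "\<And>l. l \<in> L1 \<Longrightarrow> a1 l \<noteq> 0"
    and T2: "mass_series T2 L2 a2" "almost_periodic T2" "\<And>l. l \<in> L2 \<Longrightarrow> a2 l \<noteq> 0"
    and \<delta>: "\<delta> > 0"
  shows "\<exists>L f1 f2 \<tau>. L \<ge> 0 \<and> (\<forall>x. dist (y + \<tau> x) x \<le> L) \<and>
    (\<forall>x. \<forall>p\<in>L1 \<inter> cball y R. f1 x p \<in> L1 \<and> dist (f1 x p) (p + \<tau> x) \<le> \<delta>) \<and>
    (\<forall>x. \<forall>p\<in>L2 \<inter> cball y R. f2 x p \<in> L2 \<and> dist (f2 x p) (p + \<tau> x) \<le> \<delta>)"
proof -
  let ?P = "L1 \<inter> cball y R" and ?Q = "L2 \<inter> cball y R"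
  \<comment> \<open>Neighbours of a point of \<open>cball y R\<close> may lie just outside that
    ball, so separation is taken in radius \<open>R + 1\<close>.\<close>
  obtain \<sigma> where \<sigma>: "\<sigma> > 0" "\<And>p q. p \<in> L1 \<inter> cball y (R + 1) \<Longrightarrow> q \<in> L1 \<inter> cball y (R + 1) \<Longrightarrow> dist p q < \<sigma> \<Longrightarrow> p = q"
    "\<And>p q. p \<in> L2 \<inter> cball y (R + 1) \<Longrightarrow> q \<in> L2 \<inter> cball y (R + 1) \<Longrightarrow> dist p q < \<sigma> \<Longrightarrow> p = q"
    by (rule finite_separated2[OF lf(1)[OF bounded_cball] lf(2)[OF bounded_cball]]) (rule that)
  define \<kappa> where "\<kappa> = 2 * real CARD('d)"
  have \<kappa>: "\<kappa> > 0" by (simp add: \<kappa>_def)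
  \<comment> \<open>The three terms ensure displacement at most \<delta>, isolation of each atom,
    and that the bump does not leave the enlarged ball.\<close>
  define \<theta> where "\<theta> = min \<delta> (min (\<sigma> / 2) 1) / \<kappa>"
  have \<theta>: "\<theta> > 0" using \<delta> \<sigma>(1) \<kappa> by (simp add: \<theta>_def)
  have "\<kappa> * \<theta> = min \<delta> (min (\<sigma> / 2) 1)" using \<kappa> by (simp add: \<theta>_def)
  then have \<kappa>\<theta>: "\<kappa> * \<theta> \<le> \<delta>" "\<kappa> * \<theta> < \<sigma>" "\<kappa> * \<theta> \<le> 1" using \<sigma>(1) by auto
  obtain H :: "'d \<Rightarrow> real \<Rightarrow> complex" and c where H: "\<And>i. test1 (H i)" and c: "c > 0"
    "\<And>u. norm u \<le> \<theta> \<Longrightarrow> c \<le> norm (tensor H u)" "\<And>u. tensor H u \<noteq> 0 \<Longrightarrow> norm u \<le> \<kappa> * \<theta>"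
    by (rule bump_tensor[OF \<theta>, where 'd = 'd, folded \<kappa>_def]) (rule that)
  define G1 where "G1 u = T1 (tensor (shift u H))" for u
  define G2 where "G2 u = T2 (tensor (shift u H))" for u
  have nz: "T (tensor (shift p H)) \<noteq> 0"
    if T: "mass_series T L a" "\<And>l. l \<in> L \<Longrightarrow> a l \<noteq> 0" and p: "p \<in> L \<inter> cball y R"
      and sep: "\<And>p q. p \<in> L \<inter> cball y (R + 1) \<Longrightarrow> q \<in> L \<inter> cball y (R + 1) \<Longrightarrow> dist p q < \<sigma> \<Longrightarrow> p = q"
    for T L a p
  proof -
    have "T (tensor (shift p H)) = a p * tensor H (p - p)"
    proof (rule mass_series_single[OF T(1) H])
      fix l' assume l': "l' \<in> L" "tensor H (l' - p) \<noteq> 0"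
      have d: "dist l' p \<le> \<kappa> * \<theta>" using c(3)[OF l'(2)] by (simp add: dist_norm)
      have "dist y l' \<le> R + 1" using d \<kappa>\<theta>(3) p dist_triangle[of y l' p] by (simp add: dist_commute)
      then show "l' = p" using l'(1) p d \<kappa>\<theta>(2) by (intro sep) auto
    qed (use p in auto)
    moreover have "tensor H (p - p) \<noteq> 0" using c(1) c(2)[of "p - p"] \<theta> by auto
    ultimately show ?thesis using T(2) p by simp
  qed
  have fin: "finite ?P" "finite ?Q" by (intro lf bounded_cball)+
  obtain \<eta>1 where \<eta>1: "\<eta>1 > 0" "\<And>p. p \<in> ?P \<Longrightarrow> \<eta>1 \<le> norm (G1 p)"
    by (rule finite_positive_lower_bound[OF fin(1), of "\<lambda>p. norm (G1 p)"])
      (use nz[OF T1(1,3) _ \<sigma>(2)] in \<open>auto simp: G1_def\<close>)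
  obtain \<eta>2 where \<eta>2: "\<eta>2 > 0" "\<And>p. p \<in> ?Q \<Longrightarrow> \<eta>2 \<le> norm (G2 p)"
    by (rule finite_positive_lower_bound[OF fin(2), of "\<lambda>p. norm (G2 p)"])
      (use nz[OF T2(1,3) _ \<sigma>(3)] in \<open>auto simp: G2_def\<close>)
  define \<epsilon> where "\<epsilon> = min \<eta>1 \<eta>2 / 2"
  have \<epsilon>: "\<epsilon> > 0" "\<epsilon> < \<eta>1" "\<epsilon> < \<eta>2" using \<eta>1(1) \<eta>2(1) by (auto simp: \<epsilon>_def min_def)
  obtain b1 A1 where e1: "exp_sum_of b1 A1 G1"
    using T1(2) H unfolding almost_periodic_def G1_def by blast
  obtain b2 A2 where e2: "exp_sum_of b2 A2 G2"
    using T2(2) H unfolding almost_periodic_def G2_def by blast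
  obtain L where L: "L \<ge> 0" "\<And>x. \<exists>\<tau>\<in>cball x L. \<forall>u. norm (G1 (u + \<tau>) - G1 u) \<le> \<epsilon> \<and> norm (G2 (u + \<tau>) - G2 u) \<le> \<epsilon>"
    by (rule common_almost_periods[OF e1 e2 \<epsilon>(1)]) (rule that)
  then have "\<forall>x. \<exists>\<tau>. \<tau> \<in> cball x L \<and> (\<forall>u. norm (G1 (u + \<tau>) - G1 u) \<le> \<epsilon> \<and> norm (G2 (u + \<tau>) - G2 u) \<le> \<epsilon>)"
    by blast
  then obtain t where "\<forall>x. t x \<in> cball x L \<and> (\<forall>u. norm (G1 (u + t x) - G1 u) \<le> \<epsilon> \<and> norm (G2 (u + t x) - G2 u) \<le> \<epsilon>)"
    by (rule choice[THEN exE])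
  then have t: "\<And>x. t x \<in> cball x L"
    "\<And>x u. norm (G1 (u + t x) - G1 u) \<le> \<epsilon>" "\<And>x u. norm (G2 (u + t x) - G2 u) \<le> \<epsilon>"
    by blast+
  \<comment> \<open>A period near \<open>x - y\<close> carries the centre \<open>y\<close> near
    \<open>x\<close>.\<close>
  define \<tau> where "\<tau> x = t (x - y)" for x
  have near: "\<exists>l\<in>L'. dist l (p + \<tau> x) \<le> \<delta>"
    if T: "mass_series T L' a" and d: "norm (T (tensor (shift (p + \<tau> x) H)) - T (tensor (shift p H))) \<le> \<epsilon>"
      and p: "\<epsilon> < norm (T (tensor (shift p H)))" for T L' a p x
  proof -
    have "T (tensor (shift (p + \<tau> x) H)) \<noteq> 0" using d p by auto
    then obtain l where l: "l \<in> L'" "tensor H (l - (p + \<tau> x)) \<noteq> 0"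
      using mass_series_nonzeroD[of T L' a H "p + \<tau> x", OF T H] by blast
    then show ?thesis using c(3)[OF l(2)] \<kappa>\<theta>(1) by (intro bexI[of _ l]) (auto simp: dist_norm)
  qed
  have "\<exists>l. l \<in> L1 \<and> dist l (p + \<tau> x) \<le> \<delta>" if "p \<in> ?P" for p x
    using near[OF T1(1), of p x] t(2)[of p "x - y"] \<eta>1(2)[OF that] \<epsilon>(2) unfolding \<tau>_def G1_def by fastforce
  note ex1 = this
  define f1 where "f1 x p = (SOME l. l \<in> L1 \<and> dist l (p + \<tau> x) \<le> \<delta>)" for x p
  have f1: "f1 x p \<in> L1 \<and> dist (f1 x p) (p + \<tau> x) \<le> \<delta>" if "p \<in> ?P" for x p
    unfolding f1_def by (rule someI_ex[OF ex1[OF that]])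
  have "\<exists>l. l \<in> L2 \<and> dist l (p + \<tau> x) \<le> \<delta>" if "p \<in> ?Q" for p x
    using near[OF T2(1), of p x] t(3)[of p "x - y"] \<eta>2(2)[OF that] \<epsilon>(3) unfolding \<tau>_def G2_def by fastforce
  note ex2 = this
  define f2 where "f2 x p = (SOME l. l \<in> L2 \<and> dist l (p + \<tau> x) \<le> \<delta>)" for x p
  have f2: "f2 x p \<in> L2 \<and> dist (f2 x p) (p + \<tau> x) \<le> \<delta>" if "p \<in> ?Q" for x p
    unfolding f2_def by (rule someI_ex[OF ex2[OF that]])
  have "dist (y + \<tau> x) x \<le> L" for x
    using t(1)[of "x - y"] by (simp add: \<tau>_def dist_norm algebra_simps norm_minus_commute)
  then show ?thesis
    by (intro exI[of _ L] exI[of _ f1] exI[of _ f2] exI[of _ \<tau>] conjI allI ballI L(1) f1 f2)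
qed

lemma copy_close:
  fixes \<tau> :: "'a::real_normed_vector"
  assumes "dist a (p + \<tau>) \<le> \<alpha>" "dist b (q + \<tau>) \<le> \<beta>"
  shows "dist p q \<le> \<alpha> + dist a b + \<beta>"
proof -
  have "dist p q = dist (p + \<tau>) (q + \<tau>)" by simp
  also have "\<dots> \<le> dist (p + \<tau>) a + dist a (q + \<tau>)" by (rule dist_triangle)
  also have "dist a (q + \<tau>) \<le> dist a b + dist b (q + \<tau>)" by (rule dist_triangle)
  finally show ?thesis using assms by (simp add: dist_commute)
qed

text \<open>Otherwise \<open>f\<close> would increase strictly \<open>n + 1\<close> times and exceed
  \<open>n\<close> at the end.\<close>

lemma nat_plateau:
  fixes f :: "nat \<Rightarrow> nat"
  assumes "\<And>i. i \<le> n \<Longrightarrow> f i \<le> f (Suc i)" "f (Suc n) \<le> n"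
  shows "\<exists>i\<le>n. f i = f (Suc i)"
proof (rule ccontr)
  assume "\<not> ?thesis"
  then have *: "f i < f (Suc i)" if "i \<le> n" for i using assms(1)[OF that] that by (metis le_neq_implies_less)
  have "i \<le> Suc n \<Longrightarrow> i \<le> f i" for i
  proof (induction i)
    case (Suc i)
    then show ?case using *[of i] by simp
  qed simp
  from this[of "Suc n"] assms(2) show False by simp
qed

section \<open>Windows for sums of point masses\<close>

locale mass_windows = windows L1 L2 E \<Lambda> \<Gamma> x r N
  for L1 L2 E :: "(real^'d) set" and \<Lambda> \<Gamma> x r N +
  fixes T1 T2 :: "(real^'d \<Rightarrow> complex) \<Rightarrow> complex" and a1 a2 :: "real^'d \<Rightarrow> complex"
  assumes T1: "mass_series T1 L1 a1" "almost_periodic T1" "\<And>l. l \<in> L1 \<Longrightarrow> a1 l \<noteq> 0"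
    and T2: "mass_series T2 L2 a2" "almost_periodic T2" "\<And>l. l \<in> L2 \<Longrightarrow> a2 l \<noteq> 0"
begin

lemma finite_cball: "finite (L1 \<inter> cball y R)" "finite (L2 \<inter> cball y R)"
  by (intro locally_finite bounded_cball)+

lemma copies:
  assumes "\<delta> > 0"
  shows "\<exists>L f1 f2 \<tau>. L \<ge> 0 \<and> (\<forall>x. dist (y + \<tau> x) x \<le> L) \<and>
    (\<forall>x. \<forall>p\<in>L1 \<inter> cball y R. f1 x p \<in> L1 \<and> dist (f1 x p) (p + \<tau> x) \<le> \<delta>) \<and>
    (\<forall>x. \<forall>p\<in>L2 \<inter> cball y R. f2 x p \<in> L2 \<and> dist (f2 x p) (p + \<tau> x) \<le> \<delta>)"
  by (rule copy_configuration) (fact locally_finite T1 T2 assms)+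

lemma eventually_diameter: "\<sigma> > 0 \<Longrightarrow> \<exists>n0. \<forall>n\<ge>n0. diameter (\<Lambda> n \<union> \<Gamma> n) < \<sigma>"
  using order_tendstoD(2)[OF diameter] by (simp add: eventually_sequentially)

text \<open>A configuration of points is copied into a window, where its points fall into distinct clusters.\<close>

lemma card_bounded:
  obtains M where "\<And>y. card (L1 \<inter> cball y R) + card (L2 \<inter> cball y R) \<le> M"
proof -
  \<comment> \<open>Clusters are counted in unit balls; a finite cover by these allows at most
    \<open>card Z * N\<close> clusters in a ball of radius \<open>R + 1\<close>.\<close>
  obtain Z where Z: "finite Z" "Z \<subseteq> cball (0::real^'d) (R + 1)" "cball 0 (R + 1) \<subseteq> (\<Union>c\<in>Z. ball c 1)"
    using compactE_image[OF compact_cball[of "0::real^'d" "R + 1"], of "cball 0 (R + 1)" "\<lambda>c. ball c 1"]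
    by (metis UN_I centre_in_ball open_ball subsetI zero_less_one)
  have "card (L1 \<inter> cball y R) + card (L2 \<inter> cball y R) \<le> 2 * (card Z * N)" for y
  proof -
    let ?P = "L1 \<inter> cball y R" and ?Q = "L2 \<inter> cball y R"
    obtain \<sigma> where \<sigma>: "\<sigma> > 0" "\<And>p q. p \<in> ?P \<Longrightarrow> q \<in> ?P \<Longrightarrow> dist p q < \<sigma> \<Longrightarrow> p = q"
      "\<And>p q. p \<in> ?Q \<Longrightarrow> q \<in> ?Q \<Longrightarrow> dist p q < \<sigma> \<Longrightarrow> p = q"
      by (rule finite_separated2[OF finite_cball]) (rule that)
    \<comment> \<open>If two copies lay in one cluster of diameter below \<sigma>/4, the originals
      would be closer than \<sigma>/4 + 2\<delta> < \<sigma>. The cap 1 keeps the copies in the ball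
      of radius \<open>R + 1\<close>.\<close>
    define \<delta> where "\<delta> = min (\<sigma> / 4) 1"
    have \<delta>: "\<delta> > 0" "\<delta> \<le> \<sigma> / 4" "\<delta> \<le> 1" using \<sigma>(1) by (auto simp: \<delta>_def)
    obtain L f1 f2 \<tau> where L: "L \<ge> 0" "\<forall>x. dist (y + \<tau> x) x \<le> L"
      and "\<forall>x. \<forall>p\<in>?P. f1 x p \<in> L1 \<and> dist (f1 x p) (p + \<tau> x) \<le> \<delta>"
      and "\<forall>x. \<forall>p\<in>?Q. f2 x p \<in> L2 \<and> dist (f2 x p) (p + \<tau> x) \<le> \<delta>"
      using copies[OF \<delta>(1), of y R] by (elim exE conjE)
    note f1 = this(3)[THEN spec, THEN bspec] and f2 = this(4)[THEN spec, THEN bspec] and L = L(1) L(2)[THEN spec]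
    \<comment> \<open>\<open>n0\<close> depends on the configuration, but the final bound does not:
      one sufficiently far window is enough.\<close>
    obtain n0 where n0: "\<And>n. n \<ge> n0 \<Longrightarrow> diameter (\<Lambda> n \<union> \<Gamma> n) < \<sigma> / 4"
      using eventually_diameter[of "\<sigma> / 4"] \<sigma>(1) by auto
    have "\<forall>\<^sub>F k in sequentially. cball (y + \<tau> (x k)) (R + 1) \<subseteq> ball (x k) (r k) \<and>
        (\<forall>n. (\<Lambda> n \<union> \<Gamma> n) \<inter> ball (x k) (r k) \<noteq> {} \<longrightarrow> n0 \<le> n)"
      by (intro eventually_conj eventually_window_in_ball[of "\<lambda>k. y + \<tau> (x k)" L] L clusters_far)
    then obtain k where k: "cball (y + \<tau> (x k)) (R + 1) \<subseteq> ball (x k) (r k)"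
        "\<And>n. (\<Lambda> n \<union> \<Gamma> n) \<inter> ball (x k) (r k) \<noteq> {} \<Longrightarrow> n0 \<le> n"
      by (auto simp: eventually_sequentially)
    define w where "w = y + \<tau> (x k)"
    define I where "I = (\<Union>c\<in>Z. {n. (\<Lambda> n \<union> \<Gamma> n) \<inter> ball (w + c) 1 \<noteq> {}})"
    have E: "cball w (R + 1) \<subseteq> E" using k(1) balls unfolding w_def by blast
    have cE: "w + c \<in> E" if "c \<in> Z" for c
    proof -
      have "c \<in> cball 0 (R + 1)" using Z(2) that by blast
      then have "w + c \<in> cball w (R + 1)" by (simp add: dist_norm)
      then show ?thesis using E by blast
    qed
    have I: "finite I" "card I \<le> card Z * N"
    proof -
      show "finite I" unfolding I_def using Z(1) count[OF cE] by blast
      have "card I \<le> (\<Sum>c\<in>Z. card {n. (\<Lambda> n \<union> \<Gamma> n) \<inter> ball (w + c) 1 \<noteq> {}})"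
        unfolding I_def by (rule card_UN_le[OF Z(1)])
      also have "\<dots> \<le> (\<Sum>c\<in>Z. N)" using count[OF cE] by (intro sum_mono) blast
      finally show "card I \<le> card Z * N" by simp
    qed
    have key: "card P \<le> card I"
      if P: "P \<subseteq> cball y R" and f: "\<And>p. p \<in> P \<Longrightarrow> f p \<in> L' \<and> dist (f p) (p + \<tau> (x k)) \<le> \<delta>"
        and M: "L' \<inter> E = (\<Union>n. M n)" "\<And>n. M n \<subseteq> \<Lambda> n \<union> \<Gamma> n"
        and sep: "\<And>p q. p \<in> P \<Longrightarrow> q \<in> P \<Longrightarrow> dist p q < \<sigma> \<Longrightarrow> p = q"
      for P f L' and M :: "nat \<Rightarrow> (real^'d) set"
    proof -
      have fw: "f p \<in> cball w (R + 1)" if "p \<in> P" for p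
      proof -
        have "dist w (f p) \<le> dist w (p + \<tau> (x k)) + dist (p + \<tau> (x k)) (f p)" by (rule dist_triangle)
        also have "dist w (p + \<tau> (x k)) = dist y p" by (simp add: w_def)
        finally show ?thesis using that P f[OF that] \<delta>(3) by (auto simp: dist_commute)
      qed
      then have "\<exists>n. f p \<in> M n" if "p \<in> P" for p using f[OF that] E M(1) that by blast
      then obtain n where n: "\<And>p. p \<in> P \<Longrightarrow> f p \<in> M (n p)" by metis
      have inj: "inj_on n P"
      proof (rule inj_onI)
        fix p q assume pq: "p \<in> P" "q \<in> P" "n p = n q"
        have m: "f p \<in> \<Lambda> (n p) \<union> \<Gamma> (n p)" "f q \<in> \<Lambda> (n p) \<union> \<Gamma> (n p)" using n pq M(2) by (metis subsetD)+
        have "n0 \<le> n p" using k(1) fw[OF pq(1)] m(1) unfolding w_def by (intro k(2)) blast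
        then have "dist (f p) (f q) < \<sigma> / 4"
          using diameter_bounded_bound[OF bounded_cluster m] n0 by (meson order_le_less_trans)
        then have "dist p q < \<sigma>"
          using copy_close[of "f p" p "\<tau> (x k)" \<delta> "f q" q \<delta>] f[OF pq(1)] f[OF pq(2)] \<delta>(2) \<sigma>(1) by linarith
        then show "p = q" using pq by (intro sep)
      qed
      have "n p \<in> I" if "p \<in> P" for p
      proof -
        have "f p - w \<in> cball 0 (R + 1)" using fw[OF that] by (simp add: dist_norm norm_minus_commute)
        then obtain c where c: "c \<in> Z" "f p - w \<in> ball c 1" using Z(3) by blast
        then have "f p \<in> ball (w + c) 1" by (simp add: dist_norm algebra_simps)
        then show ?thesis using n[OF that] M(2)[of "n p"] c(1) unfolding I_def by blast
      qed
      then show ?thesis using card_inj_on_le[OF inj _ I(1)] by blast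
    qed
    \<comment> \<open>The two sets are treated separately, as a cluster may receive a copy from
      each; hence the factor 2.\<close>
    have "card ?P \<le> card I" by (rule key[of _ "f1 (x k)" L1 \<Lambda>]) (use f1 \<sigma>(2) clusters in auto)
    moreover have "card ?Q \<le> card I" by (rule key[of _ "f2 (x k)" L2 \<Gamma>]) (use f2 \<sigma>(3) clusters in auto)
    ultimately show ?thesis using I(2) by linarith
  qed
  then show thesis by (rule that)
qed

text \<open>Take a configuration with the largest possible number of points in a ball, for a radius at
  which this number does not jump. Then its copies contain no further points, hence no two points of
  such a copy can collide, and their masses are controlled by the almost periodic sums.\<close>

lemma bounded_masses:
  obtains L C where "\<And>x. \<exists>z\<in>cball x L. (\<forall>l\<in>L1 \<inter> cball z R. norm (a1 l) \<le> C) \<and> (\<forall>l\<in>L2 \<inter> cball z R. norm (a2 l) \<le> C)"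
proof -
  define cnt where "cnt \<rho> y = card (L1 \<inter> cball y \<rho>) + card (L2 \<inter> cball y \<rho>)" for \<rho> y
  define mx where "mx \<rho> = Max (range (cnt \<rho>))" for \<rho>
  have fin: "finite (range (cnt \<rho>))" for \<rho>
  proof -
    obtain M where "\<And>y. card (L1 \<inter> cball y \<rho>) + card (L2 \<inter> cball y \<rho>) \<le> M"
      by (rule card_bounded[where R = \<rho>]) (rule that)
    then have "range (cnt \<rho>) \<subseteq> {..M}" by (auto simp: cnt_def)
    then show ?thesis by (rule finite_subset) simp
  qed
  have cnt_le: "cnt \<rho> y \<le> mx \<rho>" for \<rho> y unfolding mx_def using fin by (intro Max_ge) auto
  have mx_mono: "mx \<rho> \<le> mx \<rho>'" if "\<rho> \<le> \<rho>'" for \<rho> \<rho>'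
  proof -
    have "cnt \<rho> y \<le> mx \<rho>'" for y
    proof -
      have "cball y \<rho> \<subseteq> cball y \<rho>'" using that by auto
      then have "cnt \<rho> y \<le> cnt \<rho>' y"
        unfolding cnt_def by (intro add_mono card_mono finite_cball Int_mono) auto
      then show ?thesis using cnt_le order_trans by blast
    qed
    then show ?thesis unfolding mx_def[of \<rho>] using fin by (intro Max.boundedI) auto
  qed
  \<comment> \<open>At most \<open>n\<close> points fit into a ball of radius \<open>R + 1\<close>,
    so the maximal count cannot rise at each of the \<open>n + 1\<close> steps from \<open>R\<close>
    to \<open>R + 1\<close>.\<close>
  define n where "n = mx (R + 1)"
  define \<rho> where "\<rho> i = R + real i / real (Suc n)" for i
  have \<rho>mono: "\<rho> i < \<rho> (Suc i)" for i by (simp add: \<rho>_def divide_strict_right_mono del: of_nat_Suc)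
  have "\<exists>i\<le>n. mx (\<rho> i) = mx (\<rho> (Suc i))"
  proof (rule nat_plateau)
    show "mx (\<rho> i) \<le> mx (\<rho> (Suc i))" for i using \<rho>mono[of i] by (intro mx_mono) simp
    show "mx (\<rho> (Suc n)) \<le> n" by (simp add: \<rho>_def n_def del: of_nat_Suc)
  qed
  then obtain i where i: "mx (\<rho> i) = mx (\<rho> (Suc i))" by blast
  define R1 where "R1 = \<rho> i"
  define R2 where "R2 = \<rho> (Suc i)"
  have R12: "R1 < R2" "mx R1 = mx R2" "R \<le> R1"
    using \<rho>mono i by (auto simp: R1_def R2_def \<rho>_def)
  have "mx R1 \<in> range (cnt R1)" unfolding mx_def using fin by (intro Max_in) auto
  then obtain y where y: "cnt R1 y = mx R1" by auto
  let ?P = "L1 \<inter> cball y R1" and ?Q = "L2 \<inter> cball y R1"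
  obtain \<sigma> where \<sigma>: "\<sigma> > 0" "\<And>p q. p \<in> ?P \<Longrightarrow> q \<in> ?P \<Longrightarrow> dist p q < \<sigma> \<Longrightarrow> p = q"
    "\<And>p q. p \<in> ?Q \<Longrightarrow> q \<in> ?Q \<Longrightarrow> dist p q < \<sigma> \<Longrightarrow> p = q"
    by (rule finite_separated2[OF finite_cball]) (rule that)
  define \<kappa> where "\<kappa> = 2 * real CARD('d)"
  have \<kappa>: "\<kappa> \<ge> 1" 
  proof -
    have "0 < CARD('d)" by simp
    then have "1 \<le> real CARD('d)" by linarith
    then show ?thesis unfolding \<kappa>_def by linarith
  qed
  \<comment> \<open>Atoms seen by the bump lie within \<kappa>\<delta> of the shifted point, copies
    within \<delta>. The sum of both has to fit into the gap between the radii and to stay below the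
    separation \<sigma>.\<close>
  define \<delta> where "\<delta> = min (R2 - R1) (\<sigma> / 2) / (\<kappa> + 1)"
  have \<delta>: "\<delta> > 0" using R12(1) \<sigma>(1) \<kappa> by (simp add: \<delta>_def)
  have "(\<kappa> + 1) * \<delta> = min (R2 - R1) (\<sigma> / 2)" using \<kappa> by (simp add: \<delta>_def)
  then have \<kappa>\<delta>: "\<kappa> * \<delta> + \<delta> \<le> R2 - R1" "\<kappa> * \<delta> + \<delta> < \<sigma>" using \<sigma>(1) by (auto simp: algebra_simps)
  have \<delta>\<kappa>: "\<delta> \<le> \<kappa> * \<delta>" using \<kappa> \<delta> by simp
  obtain L f1 f2 \<tau> where L: "L \<ge> 0" "\<forall>x. dist (y + \<tau> x) x \<le> L"
    and "\<forall>x. \<forall>p\<in>?P. f1 x p \<in> L1 \<and> dist (f1 x p) (p + \<tau> x) \<le> \<delta>"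
    and "\<forall>x. \<forall>p\<in>?Q. f2 x p \<in> L2 \<and> dist (f2 x p) (p + \<tau> x) \<le> \<delta>"
    using copies[OF \<delta>, of y R1] by (elim exE conjE)
  note f1 = this(3)[THEN spec, THEN bspec] and f2 = this(4)[THEN spec, THEN bspec] and L = L(1) L(2)[THEN spec]
  obtain H :: "'d \<Rightarrow> real \<Rightarrow> complex" and c where H: "\<And>i. test1 (H i)" and c: "c > 0"
    "\<And>u. norm u \<le> \<delta> \<Longrightarrow> c \<le> norm (tensor H u)" "\<And>u. tensor H u \<noteq> 0 \<Longrightarrow> norm u \<le> \<kappa> * \<delta>"
    by (rule bump_tensor[OF \<delta>, where 'd = 'd, folded \<kappa>_def]) (rule that)
  have "\<exists>B. \<forall>u. norm (T (tensor (shift u H))) \<le> B" if "almost_periodic T" for T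
    using that H exp_sum_of_bounded unfolding almost_periodic_def by metis
  then obtain B1 B2 where B1: "\<And>u. norm (T1 (tensor (shift u H))) \<le> B1"
    and B2: "\<And>u. norm (T2 (tensor (shift u H))) \<le> B2"
    using T1(2) T2(2) by metis
  \<comment> \<open>Independent of \<open>x\<close>: \<open>B1\<close> and \<open>B2\<close> bound
    the almost periodic functions everywhere, and \<open>c\<close> comes from the bump.\<close>
  define C where "C = max B1 B2 / c"
  have "\<exists>z\<in>cball x L. (\<forall>l\<in>L1 \<inter> cball z R. norm (a1 l) \<le> C) \<and> (\<forall>l\<in>L2 \<inter> cball z R. norm (a2 l) \<le> C)" for x
  proof -
    define z where "z = y + \<tau> x"
    have z: "z \<in> cball x L" using L(2)[of x] by (simp add: z_def dist_commute)
    have props: "inj_on f P" "f ` P \<subseteq> L' \<inter> cball z R2"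
      if P: "P \<subseteq> cball y R1" and f: "\<And>p. p \<in> P \<Longrightarrow> f p \<in> L' \<and> dist (f p) (p + \<tau> x) \<le> \<delta>"
        and sep: "\<And>p q. p \<in> P \<Longrightarrow> q \<in> P \<Longrightarrow> dist p q < \<sigma> \<Longrightarrow> p = q" for P f L'
    proof -
      show "inj_on f P"
      proof (rule inj_onI)
        fix p q assume pq: "p \<in> P" "q \<in> P" "f p = f q"
        then have "dist p q \<le> \<delta> + dist (f p) (f q) + \<delta>"
          using f[OF pq(1)] f[OF pq(2)] by (intro copy_close) auto
        then show "p = q" using pq \<kappa>\<delta>(2) \<delta>\<kappa> by (intro sep) auto
      qed
      show "f ` P \<subseteq> L' \<inter> cball z R2"
      proof
        fix l assume "l \<in> f ` P"
        then obtain p where p: "p \<in> P" "l = f p" by blast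
        have "dist z (f p) \<le> dist z (p + \<tau> x) + dist (p + \<tau> x) (f p)" by (rule dist_triangle)
        also have "dist z (p + \<tau> x) = dist y p" by (simp add: z_def)
        finally have "dist z (f p) \<le> R1 + \<delta>" using p P f[OF p(1)] by (auto simp: dist_commute)
        also have "\<dots> \<le> R2" using \<kappa>\<delta>(1) \<delta>\<kappa> \<delta> by linarith
        finally show "l \<in> L' \<inter> cball z R2" using f[OF p(1)] p(2) by simp
      qed
    qed
    have 1: "inj_on (f1 x) ?P" "f1 x ` ?P \<subseteq> L1 \<inter> cball z R2"
      using props[of ?P "f1 x" L1, OF _ f1 \<sigma>(2)] by auto
    have 2: "inj_on (f2 x) ?Q" "f2 x ` ?Q \<subseteq> L2 \<inter> cball z R2"
      using props[of ?Q "f2 x" L2, OF _ f2 \<sigma>(3)] by auto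
    have "card ?P \<le> card (L1 \<inter> cball z R2)" "card ?Q \<le> card (L2 \<inter> cball z R2)"
      using card_inj_on_le[OF 1 finite_cball(1)] card_inj_on_le[OF 2 finite_cball(2)] by auto
    \<comment> \<open>Maximality enters here: the larger ball around \<open>z\<close> holds no more
      points in total than the configuration, so both inequalities are equalities and every point in
      it is a copy.\<close>
    moreover have "card (L1 \<inter> cball z R2) + card (L2 \<inter> cball z R2) \<le> card ?P + card ?Q"
      using cnt_le[of R2 z] y R12(2) by (simp add: cnt_def)
    ultimately have "card (f1 x ` ?P) = card (L1 \<inter> cball z R2)" "card (f2 x ` ?Q) = card (L2 \<inter> cball z R2)"
      using card_image[OF 1(1)] card_image[OF 2(1)] by linarith+
    then have surj: "f1 x ` ?P = L1 \<inter> cball z R2" "f2 x ` ?Q = L2 \<inter> cball z R2"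
      using card_subset_eq[OF finite_cball(1) 1(2)] card_subset_eq[OF finite_cball(2) 2(2)] by auto
    have bound: "norm (a l) \<le> B / c"
      if T: "mass_series T L' a" and B: "\<And>u. norm (T (tensor (shift u H))) \<le> B"
        and P: "P \<subseteq> cball y R1" and f: "\<And>p. p \<in> P \<Longrightarrow> f p \<in> L' \<and> dist (f p) (p + \<tau> x) \<le> \<delta>"
        and sep: "\<And>p q. p \<in> P \<Longrightarrow> q \<in> P \<Longrightarrow> dist p q < \<sigma> \<Longrightarrow> p = q"
        and surj: "f ` P = L' \<inter> cball z R2" and l: "l \<in> L' \<inter> cball z R" for T L' a B P f l
    proof -
      have "l \<in> f ` P" unfolding surj using l R12 by auto
      then obtain p where p: "p \<in> P" "l = f p" by blast
      \<comment> \<open>The bump around \<open>p + \<tau> x\<close> sees \<open>l\<close> alone, so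
        the bounded value on the left controls the mass of \<open>l\<close>.\<close>
      have "T (tensor (shift (p + \<tau> x) H)) = a l * tensor H (l - (p + \<tau> x))"
      proof (rule mass_series_single[OF T H])
        show "l \<in> L'" using l by simp
        fix l' assume l': "l' \<in> L'" "tensor H (l' - (p + \<tau> x)) \<noteq> 0"
        have d: "dist l' (p + \<tau> x) \<le> \<kappa> * \<delta>" using c(3)[OF l'(2)] by (simp add: dist_norm)
        have "dist z l' \<le> dist z (p + \<tau> x) + dist (p + \<tau> x) l'" by (rule dist_triangle)
        also have "dist z (p + \<tau> x) = dist y p" by (simp add: z_def)
        finally have "dist z l' \<le> R2" using p(1) P d \<kappa>\<delta>(1) \<delta> by (auto simp: dist_commute)
        then have "l' \<in> f ` P" unfolding surj using l'(1) by simp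
        then obtain q where q: "q \<in> P" "l' = f q" by blast
        have "dist q p \<le> \<delta> + dist l' l' + \<kappa> * \<delta>"
          using f[OF q(1)] q(2) d by (intro copy_close) auto
        then have "q = p" using \<kappa>\<delta>(2) q(1) p(1) by (intro sep) auto
        then show "l' = l" using p q by simp
      qed
      then have "norm (a l) * norm (tensor H (l - (p + \<tau> x))) \<le> B" using B[of "p + \<tau> x"] by (simp add: norm_mult)
      moreover have "c \<le> norm (tensor H (l - (p + \<tau> x)))"
        using f[OF p(1)] p(2) by (intro c(2)) (simp add: dist_norm)
      then have "norm (a l) * c \<le> norm (a l) * norm (tensor H (l - (p + \<tau> x)))" by (intro mult_left_mono) auto
      ultimately have "norm (a l) * c \<le> B" by linarith
      then show ?thesis using c(1) by (simp add: pos_le_divide_eq)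
    qed
    have "B1 / c \<le> C" "B2 / c \<le> C" using c(1) by (auto simp: C_def divide_right_mono)
    then have "norm (a1 l) \<le> C" if "l \<in> L1 \<inter> cball z R" for l
      using bound[OF T1(1) B1 _ f1 \<sigma>(2) surj(1) that] by (meson Int_lower2 order_trans)
    moreover have "norm (a2 l) \<le> C" if "l \<in> L2 \<inter> cball z R" for l
      using bound[OF T2(1) B2 _ f2 \<sigma>(3) surj(2) that] \<open>B2 / c \<le> C\<close> by (meson Int_lower2 order_trans)
    ultimately show ?thesis using z by blast
  qed
  then show thesis by (rule that)
qed

theorem mass_window_limit:
  assumes sums: "(\<lambda>n. (\<Sum>l\<in>\<Lambda> n. a1 l) - (\<Sum>g\<in>\<Gamma> n. a2 g)) \<longlonglongrightarrow> 0"
    and H: "small_support H" and \<epsilon>: "\<epsilon> > 0"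
  shows "\<exists>z. \<forall>y\<in>cball z R. norm (T1 (tensor (shift y H)) - T2 (tensor (shift y H))) \<le> \<epsilon>"
proof -
  \<comment> \<open>Beyond \<open>R\<close>, one unit is for the support of the test function and
    one for the diameter of a cluster.\<close>
  obtain L C where LC: "\<And>x. \<exists>z\<in>cball x L. (\<forall>l\<in>L1 \<inter> cball z (R + 2). norm (a1 l) \<le> C) \<and> (\<forall>l\<in>L2 \<inter> cball z (R + 2). norm (a2 l) \<le> C)"
    by (rule bounded_masses[of "R + 2"]) (rule that)
  then have "\<forall>k. \<exists>z. z \<in> cball (x k) L \<and> (\<forall>l\<in>L1 \<inter> cball z (R + 2). norm (a1 l) \<le> C)
      \<and> (\<forall>l\<in>L2 \<inter> cball z (R + 2). norm (a2 l) \<le> C)"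
    by blast
  then obtain z where zz: "\<forall>k. z k \<in> cball (x k) L \<and> (\<forall>l\<in>L1 \<inter> cball (z k) (R + 2). norm (a1 l) \<le> C)
      \<and> (\<forall>l\<in>L2 \<inter> cball (z k) (R + 2). norm (a2 l) \<le> C)"
    by (rule choice[THEN exE])
  then have z: "z k \<in> cball (x k) L" and z1: "l \<in> L1 \<inter> cball (z k) (R + 2) \<Longrightarrow> norm (a1 l) \<le> C"
    and z2: "l \<in> L2 \<inter> cball (z k) (R + 2) \<Longrightarrow> norm (a2 l) \<le> C" for k l
    by blast+
  have dz: "dist (z k) (x k) \<le> L" for k using z[of k] by (simp add: dist_commute)
  obtain M where M: "\<And>y. card (L1 \<inter> cball y (R + 2)) + card (L2 \<inter> cball y (R + 2)) \<le> M"
    by (rule card_bounded[where R = "R + 2"]) (rule that)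
  \<comment> \<open>A cluster near the window has at most \<open>M\<close> points, each of mass at
    most \<open>C\<close>.\<close>
  define C' where "C' = real M * max C 0"
  obtain n0 where n0: "\<And>n. n \<ge> n0 \<Longrightarrow> diameter (\<Lambda> n \<union> \<Gamma> n) < 1"
    using eventually_diameter[of 1] by auto
  have le: "(\<Sum>l\<in>S. norm (a l)) \<le> C'"
    if S: "S \<subseteq> L' \<inter> cball y (R + 2)" "finite (L' \<inter> cball y (R + 2))" "card (L' \<inter> cball y (R + 2)) \<le> M"
      and a: "\<And>l. l \<in> L' \<inter> cball y (R + 2) \<Longrightarrow> norm (a l) \<le> C" for S L' y and a :: "real^'d \<Rightarrow> complex"
  proof -
    have "(\<Sum>l\<in>S. norm (a l)) \<le> (\<Sum>l\<in>S. max C 0)"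
    proof (rule sum_mono)
      fix l assume "l \<in> S"
      then have "norm (a l) \<le> C" using S(1) by (intro a) blast
      then show "norm (a l) \<le> max C 0" by simp
    qed
    also have "\<dots> = real (card S) * max C 0" by simp
    also have "\<dots> \<le> real M * max C 0"
      using card_mono[OF S(2,1)] S(3) by (intro mult_right_mono) auto
    finally show ?thesis by (simp add: C'_def)
  qed
  have bd: "\<forall>\<^sub>F k in sequentially. \<forall>n (j :: 'd \<Rightarrow> nat). (\<Lambda> n \<union> \<Gamma> n) \<inter> cball (z k) (R + 1) \<noteq> {} \<longrightarrow> multi_norm j \<le> 0 \<longrightarrow>
     (\<Sum>l\<in>\<Lambda> n. norm (a1 l)) \<le> C' \<and> (\<Sum>g\<in>\<Gamma> n. norm (a2 g)) \<le> C'"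
    using eventually_window_in_ball[OF dz, of "R + 1"] clusters_far[of n0]
  proof eventually_elim
    case (elim k)
    show ?case
    proof (intro allI impI)
      fix n assume n: "(\<Lambda> n \<union> \<Gamma> n) \<inter> cball (z k) (R + 1) \<noteq> {}"
      then obtain u where u: "u \<in> \<Lambda> n \<union> \<Gamma> n" "u \<in> cball (z k) (R + 1)" by blast
      have "n0 \<le> n" using n elim by blast
      have sub: "\<Lambda> n \<union> \<Gamma> n \<subseteq> cball (z k) (R + 2)"
      proof
        fix v assume v: "v \<in> \<Lambda> n \<union> \<Gamma> n"
        have "dist u v < 1"
          using diameter_bounded_bound[OF bounded_cluster u(1) v] n0[OF \<open>n0 \<le> n\<close>] by linarith
        then show "v \<in> cball (z k) (R + 2)" using u(2) dist_triangle[of "z k" v u] by simp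
      qed
      have "\<Lambda> n \<subseteq> L1" "\<Gamma> n \<subseteq> L2" using clusters by auto
      then show "(\<Sum>l\<in>\<Lambda> n. norm (a1 l)) \<le> C' \<and> (\<Sum>g\<in>\<Gamma> n. norm (a2 g)) \<le> C'"
        using sub M[of "z k"]
        by (intro conjI le[of _ L1 "z k"] le[of _ L2 "z k"] finite_cball z1 z2) auto
    qed
  qed
  have "\<forall>\<^sub>F k in sequentially. \<forall>y\<in>cball (z k) R. norm (T1 (tensor (shift y H)) - T2 (tensor (shift y H))) \<le> \<epsilon>"
    by (rule window_limit[OF tensor_series_mass_series[OF T1(1)] tensor_series_mass_series[OF T2(1)] sums dz bd H \<epsilon>])
  then show ?thesis by (auto simp: eventually_sequentially)
qed

end

section \<open>From the transforms of the measures to windows\<close>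

lemma locally_finite_spectrum: "discrete (spectrum \<mu>) \<Longrightarrow> bounded S \<Longrightarrow> finite (spectrum \<mu> \<inter> S)"
  unfolding spectrum_def by (rule finite_Int_bounded_discrete[OF closed_dist_support])

text \<open>The measure does not charge the complement of the spectrum, which is countable because
  it is closed and discrete; so the integral becomes a sum over its points.\<close>

lemma mass_series_measure:
  fixes \<mu> \<rho> :: "(real^'d) set \<Rightarrow> complex"
  assumes \<rho>: "radon \<rho>" "dist_of_measure (fourier_measure \<mu>) \<rho>" and d: "discrete (spectrum \<mu>)"
  shows "mass_series (fourier_measure \<mu>) {l \<in> spectrum \<mu>. \<rho> {l} \<noteq> 0} (\<lambda>l. \<rho> {l})"
  unfolding mass_series_def
proof (intro allI impI)
  fix H :: "'d \<Rightarrow> real \<Rightarrow> complex" and y assume H: "\<forall>i. test1 (H i)"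
  have f: "tensor (shift y H) \<in> test_functions"
    using H by (intro test_functions_tensor test1_shift) auto
  have "((\<lambda>s. \<rho> {s} * tensor (shift y H) s) has_sum radon_integral \<rho> (tensor (shift y H))) (spectrum \<mu>)"
  proof (rule test_functions_bounds[OF f], rule radon_integral_concentrated[OF \<rho>(1)])
    show "countable (spectrum \<mu>)"
      using d unfolding spectrum_def by (rule countable_closed_discrete[OF closed_dist_support])
    show "\<rho> X = 0" if "X \<in> bounded_borel" "X \<inter> spectrum \<mu> = {}" for X
      using radon_eq_0_off_support[OF \<rho> that[unfolded spectrum_def]] .
  qed
  moreover have "radon_integral \<rho> (tensor (shift y H)) = fourier_measure \<mu> (tensor (shift y H))"
    using \<rho>(2) f by (simp add: dist_of_measure_def)
  ultimately have "((\<lambda>s. \<rho> {s} * tensor H (s - y)) has_sum fourier_measure \<mu> (tensor (shift y H))) (spectrum \<mu>)"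
    by (simp add: tensor_shift)
  then show "((\<lambda>l. \<rho> {l} * tensor H (l - y)) has_sum fourier_measure \<mu> (tensor (shift y H))) {l \<in> spectrum \<mu>. \<rho> {l} \<noteq> 0}"
    by (rule has_sum_cong_neutral[THEN iffD1, rotated -1]) auto
qed

theorem theorem5:
  fixes \<mu> \<nu> :: "(real^'d) set \<Rightarrow> complex"
    and E :: "(real^'d) set"
    and \<Lambda> \<Gamma> :: "nat \<Rightarrow> (real^'d) set"
    and x :: "nat \<Rightarrow> real^'d" and r :: "nat \<Rightarrow> real" and N :: nat
  assumes "atomic \<mu>" and "atomic \<nu>"
    and "tempered_measure (total_variation \<mu>)" and "tempered_measure (total_variation \<nu>)"
    and "discrete (spectrum \<mu>)" and "discrete (spectrum \<nu>)"
    and "disjoint_family \<Lambda>" and "disjoint_family \<Gamma>"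
    and "filterlim r at_top sequentially"
    and "eventually (\<lambda>k. x k \<noteq> 0) sequentially" and "(\<lambda>k. r k / norm (x k)) \<longlonglongrightarrow> 0"
    and "(\<Union>k. ball (x k) (r k)) \<subseteq> E"
    and "spectrum \<mu> \<inter> E = (\<Union>n. \<Lambda> n)" and "spectrum \<nu> \<inter> E = (\<Union>n. \<Gamma> n)"
    and "\<And>n. bounded (\<Lambda> n \<union> \<Gamma> n)"
    and "(\<lambda>n. diameter (\<Lambda> n \<union> \<Gamma> n)) \<longlonglongrightarrow> 0"
    and "\<And>y. y \<in> E \<Longrightarrow> finite {n. (\<Lambda> n \<union> \<Gamma> n) \<inter> ball y 1 \<noteq> {}} \<and>
           card {n. (\<Lambda> n \<union> \<Gamma> n) \<inter> ball y 1 \<noteq> {}} \<le> N"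
    and "(\<exists>\<rho> \<sigma>. radon \<rho> \<and> dist_of_measure (fourier_measure \<mu>) \<rho> \<and>
                radon \<sigma> \<and> dist_of_measure (fourier_measure \<nu>) \<sigma> \<and>
                (\<lambda>n. \<rho> (\<Lambda> n) - \<sigma> (\<Gamma> n)) \<longlonglongrightarrow> 0)
       \<or> (\<exists>m p q. delta_series (fourier_measure \<mu>) (spectrum \<mu>) m p \<and>
                  delta_series (fourier_measure \<nu>) (spectrum \<nu>) m q \<and>
                  (\<forall>j. multi_norm j \<le> m \<longrightarrow>
                     (\<lambda>n. (\<Sum>l\<in>\<Lambda> n. p l j) - (\<Sum>g\<in>\<Gamma> n. q g j)) \<longlonglongrightarrow> 0 \<and>
                     bdd_above (range (\<lambda>n. \<Sum>l\<in>\<Lambda> n. norm (p l j))) \<and>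
                     bdd_above (range (\<lambda>n. \<Sum>g\<in>\<Gamma> n. norm (q g j)))))"
  shows "\<forall>B\<in>bounded_borel. \<mu> B = \<nu> B"
proof -
  interpret W: windows "spectrum \<mu>" "spectrum \<nu>" E \<Lambda> \<Gamma> x r N
    by unfold_locales (fact locally_finite_spectrum[OF assms(5)] locally_finite_spectrum[OF assms(6)] assms)+
  have "\<exists>z. \<forall>y\<in>cball z R. norm (fourier_measure \<mu> (tensor (shift y H)) - fourier_measure \<nu> (tensor (shift y H))) \<le> \<epsilon>"
    if H: "small_support H" and \<epsilon>: "\<epsilon> > 0" for R H \<epsilon>
    using assms(18)
  proof (elim disjE exE conjE)
    fix \<rho> \<sigma>
    assume \<rho>: "radon \<rho>" "dist_of_measure (fourier_measure \<mu>) \<rho>"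
      and \<sigma>: "radon \<sigma>" "dist_of_measure (fourier_measure \<nu>) \<sigma>"
      and lim: "(\<lambda>n. \<rho> (\<Lambda> n) - \<sigma> (\<Gamma> n)) \<longlonglongrightarrow> 0"
    \<comment> \<open>The restriction to points of nonzero mass supplies the nonvanishing condition
      of \<open>mass_windows\<close> without an argument that every point of the spectrum carries
      mass.\<close>
    define S1 where "S1 = {l \<in> spectrum \<mu>. \<rho> {l} \<noteq> 0}"
    define S2 where "S2 = {l \<in> spectrum \<nu>. \<sigma> {l} \<noteq> 0}"
    define M1 where "M1 n = \<Lambda> n \<inter> S1" for n
    define M2 where "M2 n = \<Gamma> n \<inter> S2" for n
    have sub: "M1 n \<union> M2 n \<subseteq> \<Lambda> n \<union> \<Gamma> n" for n by (auto simp: M1_def M2_def)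
    interpret V: mass_windows S1 S2 E M1 M2 x r N "fourier_measure \<mu>" "fourier_measure \<nu>" "\<lambda>l. \<rho> {l}" "\<lambda>l. \<sigma> {l}"
    proof unfold_locales
      show "finite (S1 \<inter> S)" if "bounded S" for S
        by (rule finite_subset[OF _ W.locally_finite(1)[OF that]]) (auto simp: S1_def)
      show "finite (S2 \<inter> S)" if "bounded S" for S
        by (rule finite_subset[OF _ W.locally_finite(2)[OF that]]) (auto simp: S2_def)
      show "disjoint_family M1" "disjoint_family M2"
        using W.disjoint unfolding disjoint_family_on_def M1_def M2_def by blast+
      show "S1 \<inter> E = (\<Union>n. M1 n)" "S2 \<inter> E = (\<Union>n. M2 n)"
        using W.clusters by (auto simp: M1_def M2_def S1_def S2_def)
      show "bounded (M1 n \<union> M2 n)" for n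
        by (rule bounded_subset[OF W.bounded_cluster sub])
      show "(\<lambda>n. diameter (M1 n \<union> M2 n)) \<longlonglongrightarrow> 0"
      proof (rule tendsto_sandwich[OF _ _ tendsto_const W.diameter])
        show "\<forall>\<^sub>F n in sequentially. 0 \<le> diameter (M1 n \<union> M2 n)"
          by (intro always_eventually allI diameter_ge_0 bounded_subset[OF W.bounded_cluster sub])
        show "\<forall>\<^sub>F n in sequentially. diameter (M1 n \<union> M2 n) \<le> diameter (\<Lambda> n \<union> \<Gamma> n)"
          by (intro always_eventually allI diameter_subset sub W.bounded_cluster)
      qed
      fix y assume "y \<in> E"
      note c = W.count[OF this]
      have "{n. (M1 n \<union> M2 n) \<inter> ball y 1 \<noteq> {}} \<subseteq> {n. (\<Lambda> n \<union> \<Gamma> n) \<inter> ball y 1 \<noteq> {}}"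
        using sub by blast
      then show "finite {n. (M1 n \<union> M2 n) \<inter> ball y 1 \<noteq> {}} \<and> card {n. (M1 n \<union> M2 n) \<inter> ball y 1 \<noteq> {}} \<le> N"
        using c by (meson card_mono finite_subset order_trans)
    next
      show "mass_series (fourier_measure \<mu>) S1 (\<lambda>l. \<rho> {l})" "mass_series (fourier_measure \<nu>) S2 (\<lambda>l. \<sigma> {l})"
        unfolding S1_def S2_def by (intro mass_series_measure \<rho> \<sigma> assms)+
      show "almost_periodic (fourier_measure \<mu>)" "almost_periodic (fourier_measure \<nu>)"
        by (intro almost_periodic_fourier_measure assms)+
      show "\<rho> {l} \<noteq> 0" if "l \<in> S1" for l using that by (simp add: S1_def)
      show "\<sigma> {l} \<noteq> 0" if "l \<in> S2" for l using that by (simp add: S2_def)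
    qed (fact W.r W.x W.balls)+
    \<comment> \<open>The reduced clusters have the same totals as the full ones, so the limit
      hypothesis carries over.\<close>
    have "(\<Sum>l\<in>M1 n. \<rho> {l}) = \<rho> (\<Lambda> n)" for n
    proof -
      have "(\<Sum>l\<in>M1 n. \<rho> {l}) = (\<Sum>l\<in>\<Lambda> n. \<rho> {l})"
        using W.clusters(1) by (intro sum.mono_neutral_left W.finite_cluster) (auto simp: M1_def S1_def)
      then show ?thesis by (simp add: radon_eq_sum[OF \<rho>(1) W.finite_cluster(1)])
    qed
    moreover have "(\<Sum>l\<in>M2 n. \<sigma> {l}) = \<sigma> (\<Gamma> n)" for n
    proof -
      have "(\<Sum>l\<in>M2 n. \<sigma> {l}) = (\<Sum>l\<in>\<Gamma> n. \<sigma> {l})"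
        using W.clusters(2) by (intro sum.mono_neutral_left W.finite_cluster) (auto simp: M2_def S2_def)
      then show ?thesis by (simp add: radon_eq_sum[OF \<sigma>(1) W.finite_cluster(2)])
    qed
    ultimately show ?thesis
      using V.mass_window_limit[OF _ H \<epsilon>] lim by simp
  next
    fix m p q
    assume p: "delta_series (fourier_measure \<mu>) (spectrum \<mu>) m p"
      and q: "delta_series (fourier_measure \<nu>) (spectrum \<nu>) m q"
      and j: "\<forall>j. multi_norm j \<le> m \<longrightarrow>
         (\<lambda>n. (\<Sum>l\<in>\<Lambda> n. p l j) - (\<Sum>g\<in>\<Gamma> n. q g j)) \<longlonglongrightarrow> 0 \<and>
         bdd_above (range (\<lambda>n. \<Sum>l\<in>\<Lambda> n. norm (p l j))) \<and>
         bdd_above (range (\<lambda>n. \<Sum>g\<in>\<Gamma> n. norm (q g j)))"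
    have "\<exists>c. \<forall>n. multi_norm j \<le> m \<longrightarrow> (\<Sum>l\<in>\<Lambda> n. norm (p l j)) \<le> c \<and> (\<Sum>g\<in>\<Gamma> n. norm (q g j)) \<le> c" for j
    proof (cases "multi_norm j \<le> m")
      case True
      then obtain c1 c2 where "\<And>n. (\<Sum>l\<in>\<Lambda> n. norm (p l j)) \<le> c1" "\<And>n. (\<Sum>g\<in>\<Gamma> n. norm (q g j)) \<le> c2"
        using j unfolding bdd_above_def by blast
      then show ?thesis by (intro exI[of _ "max c1 c2"]) (simp add: le_max_iff_disj)
    qed simp
    then obtain c where c: "\<And>j n. multi_norm j \<le> m \<Longrightarrow> (\<Sum>l\<in>\<Lambda> n. norm (p l j)) \<le> c j \<and> (\<Sum>g\<in>\<Gamma> n. norm (q g j)) \<le> c j"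
      by metis
    \<comment> \<open>Only finitely many multi-indices occur, so their bounds merge into
      one.\<close>
    define C where "C = Max (c ` {j. multi_norm j \<le> m})"
    have C: "c j \<le> C" if "multi_norm j \<le> m" for j
      unfolding C_def using that finite_multi_norm_le by (intro Max_ge) auto
    \<comment> \<open>The coefficient bounds are global here, so the windows can be centred at the
      given points \<open>x k\<close>.\<close>
    have "\<forall>\<^sub>F k in sequentially. \<forall>y\<in>cball (x k) R.
        norm (fourier_measure \<mu> (tensor (shift y H)) - fourier_measure \<nu> (tensor (shift y H))) \<le> \<epsilon>"
    proof (rule W.window_limit[OF tensor_series_delta_series[OF p] tensor_series_delta_series[OF q] _ _ _ H \<epsilon>])
      show "(\<lambda>n. (\<Sum>l\<in>\<Lambda> n. p l j) - (\<Sum>g\<in>\<Gamma> n. q g j)) \<longlonglongrightarrow> 0" if "multi_norm j \<le> m" for j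
        using j that by blast
      show "dist (x k) (x k) \<le> 0" for k by simp
      show "\<forall>\<^sub>F k in sequentially. \<forall>n j. (\<Lambda> n \<union> \<Gamma> n) \<inter> cball (x k) (R + 1) \<noteq> {} \<longrightarrow> multi_norm j \<le> m \<longrightarrow>
         (\<Sum>l\<in>\<Lambda> n. norm (p l j)) \<le> C \<and> (\<Sum>g\<in>\<Gamma> n. norm (q g j)) \<le> C"
        using c C by (intro always_eventually) (meson order_trans)
    qed
    then show ?thesis by (auto simp: eventually_sequentially)
  qed
  then show ?thesis
    by (intro ballI coincide_if_windows[OF assms(1-4)])
qed

end
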